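(* Let $W$ be the space-time white noise on $\mathbb R_+^2$. There exists a constant $C>0$ such that for every $\beta\ge\frac14$, every $n\ge1$, every $p\ge2$ and all $z,t>0$, the $n$-th Wiener chaos component $u_n(z,t)$ of the mild solution $u$ of $$\partial_tu(z,t)=z\,\partial_z^2u(z,t)+\hat z^{\beta}u(z,t)\dot W(z,t)\quad(z,t>0),\qquad u(z,0)=1\ (z>0),\qquad u(0,t)=0\ (t>0),$$ where $\hat z=\min\{z,1\}$, satisfies $$\mathbb E\big[|u_n(z,t)|^p\big]^{1/p}\le\frac{\big(C(p-1)\sqrt\pi\,\sqrt t\big)^{n/2}}{\sqrt{\Gamma\big(\frac n2+1\big)}\;z^{1/4}},$$ where $\Gamma$ is the Gamma function. Moreover, for every $z,t>0$ and $p\ge2$ we have $u(z,t)\in L^p(\Omega)$, and the series $\sum_{n=0}^\infty u_n(z,t)$ converges to $u(z,t)$ in $L^p(\Omega)$.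
   Context: $\mathbb{R}_+=(0,\infty)$. For $z,w,t>0$, $$q_0(z,w,t)=\sqrt{\tfrac{z}{w}}\,\frac{e^{-(z+w)/t}}{t}\,I_1\!\Big(\frac{2\sqrt{zw}}{t}\Big),\qquad u_0(z,t)=\int_0^\infty q_0(z,w,t)\,dw=1-e^{-z/t},$$ where $I_1$ is the modified Bessel function of the first kind of order $1$. Noise: $H=L^2(\mathbb{R}_+^2)$, and $W=\{W(h)\mid h\in H\}$ is an isonormal Gaussian process over $H$ on $(\Omega,\mathcal F,\mathbb P)$ with $\mathcal F$ generated by $W$ (space-time white noise). $\mathcal I_n$ denotes the $n$-fold multiple Wiener (Skorohod) integral on $H^{\otimes n}$, with $\mathcal I_n(g)=\mathcal I_n(\tilde g)$ and $\mathbb E[\mathcal I_n(g)^2]=n!\|\tilde g\|^2_{H^{\otimes n}}$, $\tilde g$ being the symmetrization of $g$ in its $n$ pairs of variables. Mild solution $u$: the (unique up to modification) square-integrable random field with $u(z,0)=1$, $u(0,t)=0$ and, for $z,t>0$, a.s. $$u(z,t)=u_0(z,t)+\int_0^t\!\int_0^\infty q_0(z,w,t-\tau)\,\hat w^{\beta}u(w,\tau)\,W(dw,d\tau)$$ (Skorohod integral). It is given by the $L^2(\Omega)$-convergent series $u(z,t)=\sum_{n\ge0}u_n(z,t)$ with $u_n(z,t)=\mathcal I_n(f_n(\cdot;z,t))$, where $f_0(z,t)=u_0(z,t)$ and, for $n\ge1$, $$f_n(z_1,t_1,\dots,z_n,t_n;z,t)=\mathbf 1_{(0,t)}(t_n)\,q_0(z,z_n,t-t_n)\,\hat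 z_n^{\beta}\,f_{n-1}(z_1,t_1,\dots,z_{n-1},t_{n-1};z_n,t_n).$$ *)

theory Defs
  imports "HOL-Probability.Probability"
begin

definition in_Lp :: "real \<Rightarrow> 'a measure \<Rightarrow> ('a \<Rightarrow> real) \<Rightarrow> bool" where
  "in_Lp p M f \<longleftrightarrow> f \<in> borel_measurable M \<and> integrable M (\<lambda>x. \<bar>f x\<bar> powr p)"

definition Lp_norm :: "real \<Rightarrow> 'a measure \<Rightarrow> ('a \<Rightarrow> real) \<Rightarrow> real" where
  "Lp_norm p M f = (\<integral>x. \<bar>f x\<bar> powr p \<partial>M) powr (1 / p)"

definition Lp_tendsto :: "real \<Rightarrow> 'a measure \<Rightarrow> (nat \<Rightarrow> 'a \<Rightarrow> real) \<Rightarrow> ('a \<Rightarrow> real) \<Rightarrow> bool" where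
  "Lp_tendsto p M X Y \<longleftrightarrow> (\<forall>k. in_Lp p M (X k)) \<and> in_Lp p M Y \<and>
     (\<lambda>k. Lp_norm p M (\<lambda>x. X k x - Y x)) \<longlonglongrightarrow> 0"

text \<open>Points of the quadrant are pairs (space, time).\<close>

definition quadrant :: "(real \<times> real) measure" where
  "quadrant = restrict_space lborel ({0<..} \<times> {0<..})"

text \<open>Normal with mean zero; the degenerate law concentrated at zero is included.\<close>

definition centered_gaussian :: "'a measure \<Rightarrow> ('a \<Rightarrow> real) \<Rightarrow> bool" where
  "centered_gaussian M X \<longleftrightarrow> X \<in> borel_measurable M \<and>
     ((AE \<omega> in M. X \<omega> = 0) \<or> (\<exists>\<sigma>>0. distributed M lborel X (normal_density 0 \<sigma>)))"

text \<open>The process is indexed by square integrable functions instead of their classes modulo null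
  sets. The covariance condition makes the random variables of two representatives of one class
  equal almost surely.\<close>

definition isonormal :: "'a measure \<Rightarrow> ((real \<times> real \<Rightarrow> real) \<Rightarrow> 'a \<Rightarrow> real) \<Rightarrow> bool" where
  "isonormal M W \<longleftrightarrow> prob_space M \<and>
     (\<forall>I c. finite I \<and> (\<forall>h\<in>I. in_Lp 2 quadrant h) \<longrightarrow>
        centered_gaussian M (\<lambda>\<omega>. \<Sum>h\<in>I. c h * W h \<omega>)) \<and>
     (\<forall>g h. in_Lp 2 quadrant g \<and> in_Lp 2 quadrant h \<longrightarrow>
        (\<integral>\<omega>. W g \<omega> * W h \<omega> \<partial>M) = (\<integral>x. g x * h x \<partial>quadrant))"

text \<open>The sigma-algebra is only required to be generated by the process up to null sets. This covers
  both the sigma-algebra generated in the strict sense and its completion.\<close>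

definition generated_by :: "'a measure \<Rightarrow> ((real \<times> real \<Rightarrow> real) \<Rightarrow> 'a \<Rightarrow> real) \<Rightarrow> bool" where
  "generated_by M W \<longleftrightarrow>
     (\<forall>A\<in>sets M.
        \<exists>B\<in>sigma_sets (space M) {W h -` S \<inter> space M | h S. in_Lp 2 quadrant h \<and> S \<in> sets borel}.
          AE \<omega> in M. \<omega> \<in> A \<longleftrightarrow> \<omega> \<in> B)"

definition white_noise :: "'a measure \<Rightarrow> ((real \<times> real \<Rightarrow> real) \<Rightarrow> 'a \<Rightarrow> real) \<Rightarrow> bool" where
  "white_noise M W \<longleftrightarrow> isonormal M W \<and> generated_by M W"

text \<open>The variables of a kernel of order \<open>n\<close> are numbered \<open>0, \<dots>, n - 1\<close>.\<close>

definition quadrant_pow :: "nat \<Rightarrow> (nat \<Rightarrow> real \<times> real) measure" where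
  "quadrant_pow n = PiM {..<n} (\<lambda>_. quadrant)"

text \<open>A list of pairs \<open>(c, A)\<close> represents an elementary kernel: a linear combination of indicators
  of rectangles whose sides are pairwise disjoint (so that it vanishes on the diagonals) and of
  finite measure.\<close>

type_synonym elementary = "(real \<times> (nat \<Rightarrow> (real \<times> real) set)) list"

definition is_elementary :: "nat \<Rightarrow> elementary \<Rightarrow> bool" where
  "is_elementary n L \<longleftrightarrow>
     (\<forall>(c, A)\<in>set L. (\<forall>i<n. A i \<in> sets quadrant \<and> emeasure quadrant (A i) < \<infinity>) \<and>
        disjoint_family_on A {..<n})"

definition elementary_fun :: "nat \<Rightarrow> elementary \<Rightarrow> (nat \<Rightarrow> real \<times> real) \<Rightarrow> real" where
  "elementary_fun n L x = (\<Sum>(c, A)\<leftarrow>L. c * (\<Prod>i<n. indicator (A i) (x i)))"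

definition elementary_integral ::
    "((real \<times> real \<Rightarrow> real) \<Rightarrow> 'a \<Rightarrow> real) \<Rightarrow> nat \<Rightarrow> elementary \<Rightarrow> 'a \<Rightarrow> real" where
  "elementary_integral W n L \<omega> = (\<Sum>(c, A)\<leftarrow>L. c * (\<Prod>i<n. W (indicator (A i)) \<omega>))"

text \<open>Extension from elementary kernels to all square integrable ones by continuity.\<close>

definition has_wiener_integral ::
    "'a measure \<Rightarrow> ((real \<times> real \<Rightarrow> real) \<Rightarrow> 'a \<Rightarrow> real) \<Rightarrow> nat \<Rightarrow>
     ((nat \<Rightarrow> real \<times> real) \<Rightarrow> real) \<Rightarrow> ('a \<Rightarrow> real) \<Rightarrow> bool" where
  "has_wiener_integral M W n f X \<longleftrightarrow>
     (\<exists>L. (\<forall>k. is_elementary n (L k)) \<and>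
        Lp_tendsto 2 (quadrant_pow n) (\<lambda>k. elementary_fun n (L k)) f \<and>
        Lp_tendsto 2 M (\<lambda>k. elementary_integral W n (L k)) X)"

text \<open>A version of the integral; it is determined up to null sets if \<open>f\<close> is square integrable,
  and has no meaning otherwise.\<close>

definition wiener_integral ::
    "'a measure \<Rightarrow> ((real \<times> real \<Rightarrow> real) \<Rightarrow> 'a \<Rightarrow> real) \<Rightarrow> nat \<Rightarrow>
     ((nat \<Rightarrow> real \<times> real) \<Rightarrow> real) \<Rightarrow> 'a \<Rightarrow> real" where
  "wiener_integral M W n f = (SOME X. has_wiener_integral M W n f X)"

definition wiener_chaos ::
    "'a measure \<Rightarrow> ((real \<times> real \<Rightarrow> real) \<Rightarrow> 'a \<Rightarrow> real) \<Rightarrow> nat \<Rightarrow> ('a \<Rightarrow> real) set" where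
  "wiener_chaos M W n = {X. \<exists>f. has_wiener_integral M W n f X}"

text \<open>\<open>Y\<close> is the orthogonal projection of \<open>X\<close> to the chaos of order \<open>n\<close>.\<close>

definition chaos_component ::
    "'a measure \<Rightarrow> ((real \<times> real \<Rightarrow> real) \<Rightarrow> 'a \<Rightarrow> real) \<Rightarrow> nat \<Rightarrow>
     ('a \<Rightarrow> real) \<Rightarrow> ('a \<Rightarrow> real) \<Rightarrow> bool" where
  "chaos_component M W n X Y \<longleftrightarrow> in_Lp 2 M X \<and> Y \<in> wiener_chaos M W n \<and>
     (\<forall>Z\<in>wiener_chaos M W n. (\<integral>\<omega>. (X \<omega> - Y \<omega>) * Z \<omega> \<partial>M) = 0)"

text \<open>Definition by chaos expansion: if the integrand at \<open>x\<close> is the sum of the integrals of the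
  kernels \<open>g n (\<dots>, x)\<close> of order \<open>n\<close>, its integral is the sum of the integrals of the
  kernels \<open>g n\<close> of order \<open>n + 1\<close>, provided that this series converges in the
  square mean. The parameter \<open>x\<close> is the variable of \<open>g n\<close> with number \<open>n\<close>. No symmetrization
  is written, since the multiple integral of a kernel is that of its symmetrization.\<close>

definition has_skorohod_integral ::
    "'a measure \<Rightarrow> ((real \<times> real \<Rightarrow> real) \<Rightarrow> 'a \<Rightarrow> real) \<Rightarrow>
     (real \<times> real \<Rightarrow> 'a \<Rightarrow> real) \<Rightarrow> ('a \<Rightarrow> real) \<Rightarrow> bool" where
  "has_skorohod_integral M W v Y \<longleftrightarrow>
     in_Lp 2 (M \<Otimes>\<^sub>M quadrant) (\<lambda>(\<omega>, x). v x \<omega>) \<and>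
     (\<exists>g. (\<forall>n. in_Lp 2 (quadrant_pow (Suc n)) (g n)) \<and>
        (AE x in quadrant.
           Lp_tendsto 2 M (\<lambda>N \<omega>. \<Sum>n<N. wiener_integral M W n (\<lambda>y. g n (y(n := x))) \<omega>) (v x)) \<and>
        Lp_tendsto 2 M (\<lambda>N \<omega>. \<Sum>n<N. wiener_integral M W (Suc n) (g n) \<omega>) Y)"

definition bessel_I :: "nat \<Rightarrow> real \<Rightarrow> real" where
  "bessel_I m x = (\<Sum>k. (x / 2) ^ (2 * k + m) / (fact k * fact (k + m)))"

definition q0 :: "real \<Rightarrow> real \<Rightarrow> real \<Rightarrow> real" where
  "q0 z w t = sqrt (z / w) * (exp (- (z + w) / t) / t) * bessel_I 1 (2 * sqrt (z * w) / t)"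

definition u0 :: "real \<Rightarrow> real \<Rightarrow> real" where
  "u0 z t = (LINT w:{0<..}|lborel. q0 z w t)"

definition mild_solution ::
    "'a measure \<Rightarrow> ((real \<times> real \<Rightarrow> real) \<Rightarrow> 'a \<Rightarrow> real) \<Rightarrow> real \<Rightarrow>
     (real \<Rightarrow> real \<Rightarrow> 'a \<Rightarrow> real) \<Rightarrow> bool" where
  "mild_solution M W \<beta> u \<longleftrightarrow>
     (\<forall>z>0. \<forall>t>0. in_Lp 2 M (u z t)) \<and>
     (\<forall>z>0. AE \<omega> in M. u z 0 \<omega> = 1) \<and>
     (\<forall>t>0. AE \<omega> in M. u 0 t \<omega> = 0) \<and>
     (\<forall>z>0. \<forall>t>0. \<exists>Y.
        has_skorohod_integral M W
          (\<lambda>(w, \<tau>) \<omega>. indicator {0<..<t} \<tau> * q0 z w (t - \<tau>) * min w 1 powr \<beta> * u w \<tau> \<omega>) Y \<and>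
        (AE \<omega> in M. u z t \<omega> = u0 z t + Y \<omega>))"

fun chaos_kernel :: "real \<Rightarrow> nat \<Rightarrow> real \<Rightarrow> real \<Rightarrow> (nat \<Rightarrow> real \<times> real) \<Rightarrow> real" where
  "chaos_kernel \<beta> 0 z t x = u0 z t"
| "chaos_kernel \<beta> (Suc n) z t x =
     (case x n of (w, \<tau>) \<Rightarrow>
        indicator {0<..<t} \<tau> * q0 z w (t - \<tau>) * min w 1 powr \<beta> * chaos_kernel \<beta> n w \<tau> x)"

definition chaos_term ::
    "'a measure \<Rightarrow> ((real \<times> real \<Rightarrow> real) \<Rightarrow> 'a \<Rightarrow> real) \<Rightarrow> real \<Rightarrow> nat \<Rightarrow>
     real \<Rightarrow> real \<Rightarrow> 'a \<Rightarrow> real" where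
  "chaos_term M W \<beta> n z t = wiener_integral M W n (chaos_kernel \<beta> n z t)"

end

theory Submission
  imports Defs "HOL-Combinatorics.Permutations"
begin

text \<open>
  The second moment of the chaos component is the squared norm of its kernel, since the kernel is
  supported on increasing times. The bounds \<open>q0 z w t \<le> 2 / sqrt (z t)\<close> and \<open>\<integral> q0 z w t dw \<le> 1\<close>
  give \<open>\<integral> (q0 z w t)\<^sup>2 dw \<le> 2 / sqrt (z t)\<close>. The resulting singularity \<open>1 / sqrt w\<close> in the next space
  variable is absorbed by the weight \<open>min w 1 powr (2 * \<beta>)\<close> exactly when \<open>\<beta> \<ge> 1/4\<close>, and the
  time integrals are Beta integrals. The higher moments follow from hypercontractivity for even
  exponents, which suffices because the constant is free. For multilinear polynomials in orthogonal
  Gaussian variables it is proved by induction on the number of variables. It carries over to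
  multiple integrals by refining elementary kernels to disjoint sets and passing to the limit.

  The chaos expansion of a mild solution is identified order by order: the integral equation
  expresses the component of order \<open>n + 1\<close> by a kernel whose sections have the same integrals as the
  components of order \<open>n\<close>, and a kernel is determined up to symmetrization by its integral.
\<close>

section \<open>Square integrable functions\<close>

text \<open>\<open>W\<close> is a family of random variables, one for each function, so even
  additivity holds only outside a null set that depends on the functions involved. The Gaussian
  facts are therefore drawn from covariances and from the moments of a single \<open>W h\<close>,
  polarized by differentiating in a parameter; neither joint densities nor Hermite polynomials
  occur. Kernels stay unsymmetrized. Their covariances are expressed by a sum over permutations,
  which is n! times the inner product of the symmetrizations. The norm of a chaos kernel behaves
  like \<open>1 / sqrt z\<close> in its end point, so an induction on the bare norm would not close;
  the norm multiplied by the squared weight at the end point is bounded uniformly in space and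
  reproduces itself. A mild solution is given by its equation alone. The kernels inside its Skorohod
  integral are unknown, and only the integrals of their sections in the last variable can be
  compared with the solution. Hence uniqueness is proved for sections, and only then lifted to the
  full kernels.\<close>

lemma abs_powr_2: "\<bar>x::real\<bar> powr 2 = x\<^sup>2"
  by (simp add: powr_numeral)

lemma in_Lp_2_iff: "in_Lp 2 M f \<longleftrightarrow> f \<in> borel_measurable M \<and> integrable M (\<lambda>x. (f x)\<^sup>2)"
  by (simp add: in_Lp_def abs_powr_2)

lemma in_Lp_2_measurable: "in_Lp 2 M f \<Longrightarrow> f \<in> borel_measurable M"
  by (simp add: in_Lp_2_iff)

lemma Lp_norm_2: "Lp_norm 2 M f = sqrt (\<integral>x. (f x)\<^sup>2 \<partial>M)"
  by (simp add: Lp_norm_def abs_powr_2 powr_half_sqrt)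

lemma sqrt_tendsto_0_iff:
  fixes a :: "nat \<Rightarrow> real" assumes "\<And>k. a k \<ge> 0"
  shows "(\<lambda>k. sqrt (a k)) \<longlonglongrightarrow> 0 \<longleftrightarrow> a \<longlonglongrightarrow> 0"
proof
  assume "(\<lambda>k. sqrt (a k)) \<longlonglongrightarrow> 0"
  from tendsto_power[OF this, of 2] show "a \<longlonglongrightarrow> 0" using assms by simp
next
  assume "a \<longlonglongrightarrow> 0"
  from tendsto_real_sqrt[OF this] show "(\<lambda>k. sqrt (a k)) \<longlonglongrightarrow> 0" by simp
qed

lemma Lp_tendsto_2_iff:
  "Lp_tendsto 2 M X Y \<longleftrightarrow> (\<forall>k. in_Lp 2 M (X k)) \<and> in_Lp 2 M Y \<and>
     (\<lambda>k. \<integral>x. (X k x - Y x)\<^sup>2 \<partial>M) \<longlonglongrightarrow> 0"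
  unfolding Lp_tendsto_def Lp_norm_2
  by (subst sqrt_tendsto_0_iff) auto

lemma in_Lp_2_prod_integrable:
  assumes "in_Lp 2 M f" "in_Lp 2 M g"
  shows "integrable M (\<lambda>x. f x * g x)"
proof (rule Bochner_Integration.integrable_bound)
  show "integrable M (\<lambda>x. (f x)\<^sup>2 + (g x)\<^sup>2)" using assms by (auto simp: in_Lp_2_iff)
  show "(\<lambda>x. f x * g x) \<in> borel_measurable M" using assms by (auto simp: in_Lp_2_iff)
  have "\<bar>a * b\<bar> \<le> a\<^sup>2 + b\<^sup>2" for a b :: real
  proof -
    have "2 * \<bar>a\<bar> * \<bar>b\<bar> \<le> \<bar>a\<bar>\<^sup>2 + \<bar>b\<bar>\<^sup>2" by (rule sum_squares_bound)
    moreover have "0 \<le> \<bar>a\<bar> * \<bar>b\<bar>" by simp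
    ultimately have "\<bar>a\<bar> * \<bar>b\<bar> \<le> \<bar>a\<bar>\<^sup>2 + \<bar>b\<bar>\<^sup>2" by linarith
    then show ?thesis by (simp add: abs_mult)
  qed
  then show "AE x in M. norm (f x * g x) \<le> norm ((f x)\<^sup>2 + (g x)\<^sup>2)" by (auto intro!: AE_I2)
qed

lemma in_Lp_2_add:
  assumes "in_Lp 2 M f" "in_Lp 2 M g"
  shows "in_Lp 2 M (\<lambda>x. f x + g x)"
  using assms in_Lp_2_prod_integrable[OF assms] unfolding in_Lp_2_iff
  by (auto simp: power2_sum mult.assoc)

lemma in_Lp_2_cmult: "in_Lp 2 M f \<Longrightarrow> in_Lp 2 M (\<lambda>x. c * f x)"
  by (auto simp: in_Lp_2_iff power_mult_distrib)

lemma in_Lp_2_diff: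
  assumes "in_Lp 2 M f" "in_Lp 2 M g"
  shows "in_Lp 2 M (\<lambda>x. f x - g x)"
  using in_Lp_2_add[OF assms(1) in_Lp_2_cmult[OF assms(2), of "-1"]] by simp

lemma in_Lp_2_zero: "in_Lp 2 M (\<lambda>x. 0)"
  by (simp add: in_Lp_2_iff)

lemma in_Lp_2_sum:
  assumes "\<And>i. i \<in> I \<Longrightarrow> in_Lp 2 M (f i)"
  shows "in_Lp 2 M (\<lambda>x. \<Sum>i\<in>I. f i x)"
  using assms by (induction I rule: infinite_finite_induct) (auto intro: in_Lp_2_add in_Lp_2_zero)

lemma in_Lp_2_bound:
  assumes "in_Lp 2 M g" "f \<in> borel_measurable M" "AE x in M. \<bar>f x\<bar> \<le> \<bar>g x\<bar>"
  shows "in_Lp 2 M f"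
  unfolding in_Lp_2_iff
proof (intro conjI)
  show "integrable M (\<lambda>x. (f x)\<^sup>2)"
  proof (rule Bochner_Integration.integrable_bound)
    show "integrable M (\<lambda>x. (g x)\<^sup>2)" using assms(1) by (simp add: in_Lp_2_iff)
    show "AE x in M. norm ((f x)\<^sup>2) \<le> norm ((g x)\<^sup>2)"
      using assms(3) by eventually_elim (simp add: abs_le_square_iff)
  qed (use assms in auto)
qed (use assms in auto)

lemma in_Lp_2_cong_AE:
  assumes "in_Lp 2 M f" "g \<in> borel_measurable M" "AE x in M. f x = g x"
  shows "in_Lp 2 M g"
  by (rule in_Lp_2_bound[OF assms(1,2)]) (use assms(3) in eventually_elim, simp)

text \<open>The integral of the square of \<open>f x + s * g x\<close> is a nonnegative quadratic in
  \<open>s\<close>, so its discriminant is at most 0. The case \<open>c = 0\<close> is separate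
  because the polynomial is then only affine.\<close>

lemma Cauchy_Schwarz_in_Lp_2:
  assumes f: "in_Lp 2 M f" and g: "in_Lp 2 M g"
  shows "(\<integral>x. f x * g x \<partial>M)\<^sup>2 \<le> (\<integral>x. (f x)\<^sup>2 \<partial>M) * (\<integral>x. (g x)\<^sup>2 \<partial>M)"
proof -
  define a b c where "a = (\<integral>x. (f x)\<^sup>2 \<partial>M)" and "b = (\<integral>x. f x * g x \<partial>M)" and "c = (\<integral>x. (g x)\<^sup>2 \<partial>M)"
  have q: "0 \<le> a + 2 * s * b + s\<^sup>2 * c" for s
  proof -
    have "0 \<le> (\<integral>x. (f x + s * g x)\<^sup>2 \<partial>M)" by simp
    also have "\<dots> = (\<integral>x. (f x)\<^sup>2 + 2 * s * (f x * g x) + s\<^sup>2 * (g x)\<^sup>2 \<partial>M)"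
      by (simp add: power2_eq_square algebra_simps)
    also have "\<dots> = a + 2 * s * b + s\<^sup>2 * c"
      using f g in_Lp_2_prod_integrable[OF f g] by (simp add: in_Lp_2_iff a_def b_def c_def)
    finally show ?thesis .
  qed
  have "c \<ge> 0" by (simp add: c_def)
  show ?thesis
  proof (cases "c = 0")
    case True
    have "b = 0"
    proof (rule ccontr)
      assume "b \<noteq> 0"
      \<comment> \<open>At this value of \<open>s\<close> the affine function would equal
        -1.\<close>
      then have "2 * (- (a + 1) / (2 * b)) * b = - (a + 1)" by simp
      moreover have "0 \<le> a + 2 * s * b" for s using q[of s] True by simp
      from this[of "- (a + 1) / (2 * b)"]
      have "0 \<le> a + 2 * (- (a + 1) / (2 * b)) * b" .
      ultimately show False by linarith
    qed
    then show ?thesis using True by (simp add: a_def b_def c_def)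
  next
    case False
    then have "c > 0" using \<open>c \<ge> 0\<close> by simp
    have "0 \<le> a - b\<^sup>2 / c"
      using q[of "- b / c"] \<open>c > 0\<close> by (simp add: power2_eq_square field_simps)
    then have "b\<^sup>2 \<le> a * c" using \<open>c > 0\<close> by (simp add: field_simps)
    then show ?thesis by (simp add: a_def b_def c_def)
  qed
qed

lemma Lp_tendsto_2_D:
  assumes "Lp_tendsto 2 M X Y"
  shows "in_Lp 2 M (X k)" "in_Lp 2 M Y" "(\<lambda>k. \<integral>x. (X k x - Y x)\<^sup>2 \<partial>M) \<longlonglongrightarrow> 0"
  using assms by (auto simp: Lp_tendsto_2_iff)

text \<open>By Cauchy-Schwarz the squared inner product is at most the product of a null sequence
  and a convergent one.\<close>

lemma in_Lp_2_inner_tendsto_0: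
  assumes U: "\<And>k. in_Lp 2 M (U k)" and V: "\<And>k. in_Lp 2 M (V k)"
    and u: "(\<lambda>k. \<integral>x. (U k x)\<^sup>2 \<partial>M) \<longlonglongrightarrow> 0" and v: "(\<lambda>k. \<integral>x. (V k x)\<^sup>2 \<partial>M) \<longlonglongrightarrow> b"
  shows "(\<lambda>k. \<integral>x. U k x * V k x \<partial>M) \<longlonglongrightarrow> 0"
proof -
  have "(\<lambda>k. (\<integral>x. (U k x)\<^sup>2 \<partial>M) * (\<integral>x. (V k x)\<^sup>2 \<partial>M)) \<longlonglongrightarrow> 0 * b" by (intro tendsto_mult u v)
  then have "(\<lambda>k. (\<integral>x. (U k x)\<^sup>2 \<partial>M) * (\<integral>x. (V k x)\<^sup>2 \<partial>M)) \<longlonglongrightarrow> 0" by simp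
  then have "(\<lambda>k. (\<integral>x. U k x * V k x \<partial>M)\<^sup>2) \<longlonglongrightarrow> 0"
    by (rule tendsto_sandwich[OF _ _ tendsto_const, rotated 2])
      (auto intro!: always_eventually Cauchy_Schwarz_in_Lp_2 U V)
  then have "(\<lambda>k. sqrt ((\<integral>x. U k x * V k x \<partial>M)\<^sup>2)) \<longlonglongrightarrow> 0" by (subst sqrt_tendsto_0_iff) auto
  then show ?thesis by (simp add: tendsto_rabs_zero_iff)
qed

text \<open>Both factors are expanded around their limits; each of the three error terms contains a
  factor that tends to 0 in the square mean.\<close>

lemma Lp_tendsto_2_inner:
  assumes X: "Lp_tendsto 2 M X x" and Y: "Lp_tendsto 2 M Y y"
  shows "(\<lambda>k. \<integral>w. X k w * Y k w \<partial>M) \<longlonglongrightarrow> (\<integral>w. x w * y w \<partial>M)"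
proof -
  note x = Lp_tendsto_2_D[OF X] and y = Lp_tendsto_2_D[OF Y]
  have dX: "in_Lp 2 M (\<lambda>w. X k w - x w)" and dY: "in_Lp 2 M (\<lambda>w. Y k w - y w)" for k
    by (auto intro!: in_Lp_2_diff x y)
  have "(\<lambda>k. (\<integral>w. (X k w - x w) * (Y k w - y w) \<partial>M) + (\<integral>w. (X k w - x w) * y w \<partial>M)
      + (\<integral>w. (Y k w - y w) * x w \<partial>M) + (\<integral>w. x w * y w \<partial>M)) \<longlonglongrightarrow> 0 + 0 + 0 + (\<integral>w. x w * y w \<partial>M)"
    by (intro tendsto_add tendsto_const in_Lp_2_inner_tendsto_0[where b="\<integral>w. (y w)\<^sup>2 \<partial>M"]
        in_Lp_2_inner_tendsto_0[where b="\<integral>w. (x w)\<^sup>2 \<partial>M"] in_Lp_2_inner_tendsto_0[where b=0] dX dY x y)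
  moreover have "(\<integral>w. (X k w - x w) * (Y k w - y w) \<partial>M) + (\<integral>w. (X k w - x w) * y w \<partial>M)
      + (\<integral>w. (Y k w - y w) * x w \<partial>M) + (\<integral>w. x w * y w \<partial>M) = (\<integral>w. X k w * Y k w \<partial>M)" for k
    by (subst Bochner_Integration.integral_add[symmetric],
        (intro Bochner_Integration.integrable_add in_Lp_2_prod_integrable dX dY x y)+)+
      (simp add: algebra_simps)
  ultimately show ?thesis by simp
qed

lemma Lp_tendsto_2_const: "in_Lp 2 M f \<Longrightarrow> Lp_tendsto 2 M (\<lambda>k. f) f"
  by (simp add: Lp_tendsto_2_iff)

lemma Lp_tendsto_2_cmult: "Lp_tendsto 2 M X Y \<Longrightarrow> Lp_tendsto 2 M (\<lambda>k x. c * X k x) (\<lambda>x. c * Y x)"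
  unfolding Lp_tendsto_2_iff
  by (auto intro!: in_Lp_2_cmult simp: right_diff_distrib[symmetric] power_mult_distrib
      intro: tendsto_mult_right_zero)

lemma Lp_tendsto_2_add:
  assumes X: "Lp_tendsto 2 M X x" and Y: "Lp_tendsto 2 M Y y"
  shows "Lp_tendsto 2 M (\<lambda>k w. X k w + Y k w) (\<lambda>w. x w + y w)"
proof -
  note x = Lp_tendsto_2_D[OF X] and y = Lp_tendsto_2_D[OF Y]
  have dX: "in_Lp 2 M (\<lambda>w. X k w - x w)" and dY: "in_Lp 2 M (\<lambda>w. Y k w - y w)" for k
    by (auto intro!: in_Lp_2_diff x y)
  have "(\<lambda>k. 2 * (\<integral>w. (X k w - x w)\<^sup>2 \<partial>M) + 2 * (\<integral>w. (Y k w - y w)\<^sup>2 \<partial>M)) \<longlonglongrightarrow> 2 * 0 + 2 * 0"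
    by (intro tendsto_add tendsto_mult tendsto_const x y)
  then have lim: "(\<lambda>k. 2 * (\<integral>w. (X k w - x w)\<^sup>2 \<partial>M) + 2 * (\<integral>w. (Y k w - y w)\<^sup>2 \<partial>M)) \<longlonglongrightarrow> 0" by simp
  have le: "(\<integral>w. (X k w + Y k w - (x w + y w))\<^sup>2 \<partial>M)
      \<le> 2 * (\<integral>w. (X k w - x w)\<^sup>2 \<partial>M) + 2 * (\<integral>w. (Y k w - y w)\<^sup>2 \<partial>M)" for k
  proof -
    have i: "integrable M (\<lambda>w. (X k w - x w)\<^sup>2)" "integrable M (\<lambda>w. (Y k w - y w)\<^sup>2)"
      "integrable M (\<lambda>w. (X k w + Y k w - (x w + y w))\<^sup>2)"
      using dX[of k] dY[of k] in_Lp_2_diff[OF in_Lp_2_add[OF x(1)[of k] y(1)[of k]] in_Lp_2_add[OF x(2) y(2)]]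
      by (auto simp: in_Lp_2_iff)
    have sq: "(a + b - (c + d))\<^sup>2 \<le> 2 * (a - c)\<^sup>2 + 2 * (b - d)\<^sup>2" for a b c d :: real
      using zero_le_power2[of "(a - c) - (b - d)"] by (simp add: power2_eq_square algebra_simps)
    have "(\<integral>w. (X k w + Y k w - (x w + y w))\<^sup>2 \<partial>M)
        \<le> (\<integral>w. 2 * (X k w - x w)\<^sup>2 + 2 * (Y k w - y w)\<^sup>2 \<partial>M)"
      by (rule integral_mono) (use i sq in auto)
    also have "\<dots> = 2 * (\<integral>w. (X k w - x w)\<^sup>2 \<partial>M) + 2 * (\<integral>w. (Y k w - y w)\<^sup>2 \<partial>M)"
      using i by simp
    finally show ?thesis .
  qed
  have "(\<lambda>k. \<integral>w. (X k w + Y k w - (x w + y w))\<^sup>2 \<partial>M) \<longlonglongrightarrow> 0"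
    by (rule tendsto_sandwich[OF _ _ tendsto_const lim]) (auto intro!: always_eventually le)
  then show ?thesis unfolding Lp_tendsto_2_iff by (auto intro!: in_Lp_2_add x y)
qed

lemma Lp_tendsto_2_diff:
  assumes X: "Lp_tendsto 2 M X x" and Y: "Lp_tendsto 2 M Y y"
  shows "Lp_tendsto 2 M (\<lambda>k w. X k w - Y k w) (\<lambda>w. x w - y w)"
  using Lp_tendsto_2_add[OF X Lp_tendsto_2_cmult[OF Y, of "-1"]] by simp

lemma Lp_tendsto_2_cong_AE:
  assumes "Lp_tendsto 2 M X Y" "\<And>k. X' k \<in> borel_measurable M" "Y' \<in> borel_measurable M"
    and X: "\<And>k. AE x in M. X k x = X' k x" and Y: "AE x in M. Y x = Y' x"
  shows "Lp_tendsto 2 M X' Y'"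
proof -
  have "(\<integral>x. (X k x - Y x)\<^sup>2 \<partial>M) = (\<integral>x. (X' k x - Y' x)\<^sup>2 \<partial>M)" for k
  proof (rule integral_cong_AE)
    show "AE x in M. (X k x - Y x)\<^sup>2 = (X' k x - Y' x)\<^sup>2" using X[of k] Y by eventually_elim simp
  qed (use assms(2,3) Lp_tendsto_2_D[OF assms(1)] in
      \<open>auto simp: in_Lp_2_iff intro!: borel_measurable_power borel_measurable_diff\<close>)
  then show ?thesis
    using assms(1) in_Lp_2_cong_AE[OF _ assms(2) X] in_Lp_2_cong_AE[OF _ assms(3) Y]
    unfolding Lp_tendsto_2_iff by auto
qed

text \<open>The squared distance is dominated by
  \<open>2 * (G x)\<^sup>2 + 2 * (Y x)\<^sup>2\<close>. All approximations by truncation or by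
  removal of the diagonals are justified in this way.\<close>

lemma Lp_tendsto_2_dominated:
  assumes X: "\<And>k. X k \<in> borel_measurable M" and Y: "in_Lp 2 M Y" and G: "in_Lp 2 M G"
    and lim: "AE x in M. (\<lambda>k. X k x) \<longlonglongrightarrow> Y x" and dom: "\<And>k. AE x in M. \<bar>X k x\<bar> \<le> \<bar>G x\<bar>"
  shows "Lp_tendsto 2 M X Y"
proof -
  have XL: "in_Lp 2 M (X k)" for k by (rule in_Lp_2_bound[OF G X dom])
  have "(\<lambda>k. \<integral>x. (X k x - Y x)\<^sup>2 \<partial>M) \<longlonglongrightarrow> (\<integral>x. 0 \<partial>M)"
  proof (rule integral_dominated_convergence[where w="\<lambda>x. 2 * (G x)\<^sup>2 + 2 * (Y x)\<^sup>2"])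
    show "integrable M (\<lambda>x. 2 * (G x)\<^sup>2 + 2 * (Y x)\<^sup>2)" using G Y by (auto simp: in_Lp_2_iff)
    show "AE x in M. (\<lambda>k. (X k x - Y x)\<^sup>2) \<longlonglongrightarrow> 0"
      using lim
    proof eventually_elim
      case (elim x)
      from tendsto_power[OF tendsto_diff[OF elim tendsto_const[of "Y x"]], of 2] show ?case by simp
    qed
    show "AE x in M. norm ((X k x - Y x)\<^sup>2) \<le> 2 * (G x)\<^sup>2 + 2 * (Y x)\<^sup>2" for k
      using dom[of k]
    proof eventually_elim
      case (elim x)
      then have "(X k x)\<^sup>2 \<le> (G x)\<^sup>2" by (simp add: abs_le_square_iff)
      moreover have "(X k x - Y x)\<^sup>2 \<le> 2 * (X k x)\<^sup>2 + 2 * (Y x)\<^sup>2"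
        using zero_le_power2[of "X k x + Y x"] by (simp add: power2_eq_square algebra_simps)
      ultimately show ?case by simp
    qed
  qed (use X Y in \<open>auto simp: in_Lp_2_iff\<close>)
  then show ?thesis using XL Y by (simp add: Lp_tendsto_2_iff)
qed

lemma in_Lp_2_norm_triangle:
  assumes "in_Lp 2 M f" "in_Lp 2 M g" "in_Lp 2 M h"
  shows "(\<integral>x. (f x - h x)\<^sup>2 \<partial>M) \<le> 2 * (\<integral>x. (f x - g x)\<^sup>2 \<partial>M) + 2 * (\<integral>x. (g x - h x)\<^sup>2 \<partial>M)"
proof -
  have i: "integrable M (\<lambda>w. (f w - h w)\<^sup>2)" "integrable M (\<lambda>w. (f w - g w)\<^sup>2)" "integrable M (\<lambda>w. (g w - h w)\<^sup>2)"
    using in_Lp_2_diff assms unfolding in_Lp_2_iff by blast+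
  have sq: "(a - c)\<^sup>2 \<le> 2 * (a - b)\<^sup>2 + 2 * (b - c)\<^sup>2" for a b c :: real
    using zero_le_power2[of "a + c - 2 * b"] by (simp add: power2_eq_square algebra_simps)
  have "(\<integral>x. (f x - h x)\<^sup>2 \<partial>M) \<le> (\<integral>x. 2 * (f x - g x)\<^sup>2 + 2 * (g x - h x)\<^sup>2 \<partial>M)"
    by (rule integral_mono) (use i sq in auto)
  also have "\<dots> = 2 * (\<integral>x. (f x - g x)\<^sup>2 \<partial>M) + 2 * (\<integral>x. (g x - h x)\<^sup>2 \<partial>M)"
    using i by simp
  finally show ?thesis .
qed

text \<open>The approximants \<open>g\<close> may be syntactic objects and \<open>F g\<close> the
  functions that they denote, as with lists and elementary kernels; \<open>P\<close> is the
  admissibility condition on them.\<close>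

lemma Lp_tendsto_2_closure:
  assumes f: "in_Lp 2 M f" and "\<And>e. e > 0 \<Longrightarrow> \<exists>g. P g \<and> in_Lp 2 M (F g) \<and> (\<integral>x. (F g x - f x)\<^sup>2 \<partial>M) < e"
  shows "\<exists>g. (\<forall>k. P (g k)) \<and> Lp_tendsto 2 M (\<lambda>k. F (g k)) f"
proof -
  have "\<exists>g. P g \<and> in_Lp 2 M (F g) \<and> (\<integral>x. (F g x - f x)\<^sup>2 \<partial>M) < 1 / real (Suc k)" for k
    by (rule assms(2)) simp
  then obtain g where g: "\<And>k. P (g k) \<and> in_Lp 2 M (F (g k)) \<and> (\<integral>x. (F (g k) x - f x)\<^sup>2 \<partial>M) < 1 / real (Suc k)"
    by metis
  have "(\<lambda>k. \<integral>x. (F (g k) x - f x)\<^sup>2 \<partial>M) \<longlonglongrightarrow> 0"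
    by (rule tendsto_sandwich[OF _ _ tendsto_const LIMSEQ_Suc[OF lim_1_over_n]])
      (use g in \<open>auto intro!: always_eventually less_imp_le simp del: of_nat_Suc\<close>)
  with g f show ?thesis unfolding Lp_tendsto_2_iff by blast
qed

section \<open>Almost sure subsequences and completeness in the square mean\<close>

text \<open>The arithmetic-geometric mean inequality gives
  \<open>\<bar>d\<bar> \<le> 2 ^ k * d\<^sup>2 + (1/2) ^ k\<close>, and the squares with weights
  \<open>2 ^ k\<close> have integrals bounded by a geometric series. This works on spaces of
  infinite mass such as \<open>quadrant\<close>, where square integrals do not control integrals of
  absolute values.\<close>

lemma AE_subsequence_summable:
  assumes X: "\<And>k. in_Lp 2 M (D k)" and le: "\<And>k. (\<integral>x. (D k x)\<^sup>2 \<partial>M) \<le> (1/4) ^ k"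
  shows "AE x in M. summable (\<lambda>k. \<bar>D k x\<bar>)"
proof -
  have m[measurable]: "D k \<in> borel_measurable M" for k using X by (simp add: in_Lp_2_iff)
  have "(\<integral>\<^sup>+x. (\<Sum>k. ennreal (2 ^ k * (D k x)\<^sup>2)) \<partial>M) = (\<Sum>k. \<integral>\<^sup>+x. ennreal (2 ^ k * (D k x)\<^sup>2) \<partial>M)"
    by (rule nn_integral_suminf) simp
  also have "\<dots> \<le> (\<Sum>k. ennreal ((1/2) ^ k))"
  proof (intro suminf_le)
    fix k
    have "(\<integral>\<^sup>+x. ennreal (2 ^ k * (D k x)\<^sup>2) \<partial>M) = ennreal (\<integral>x. 2 ^ k * (D k x)\<^sup>2 \<partial>M)"
      using X[of k] by (intro nn_integral_eq_integral) (auto simp: in_Lp_2_iff)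
    also have "\<dots> \<le> ennreal (2 ^ k * (1/4) ^ k)"
      using le[of k] by (intro ennreal_leI) simp
    also have "2 ^ k * (1/4) ^ k = ((1/2) ^ k :: real)" by (simp add: power_mult_distrib[symmetric])
    finally show "(\<integral>\<^sup>+x. ennreal (2 ^ k * (D k x)\<^sup>2) \<partial>M) \<le> ennreal ((1/2) ^ k)" .
  qed auto
  also have "\<dots> = ennreal (\<Sum>k. (1/2) ^ k)"
    by (rule suminf_ennreal2) (auto intro!: summable_geometric)
  also have "\<dots> < \<infinity>" by simp
  finally have "(\<integral>\<^sup>+x. (\<Sum>k. ennreal (2 ^ k * (D k x)\<^sup>2)) \<partial>M) \<noteq> \<infinity>" by simp
  then have "AE x in M. (\<Sum>k. ennreal (2 ^ k * (D k x)\<^sup>2)) \<noteq> \<infinity>"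
    by (rule nn_integral_PInf_AE[rotated]) simp
  then show ?thesis
  proof eventually_elim
    case (elim x)
    then have "summable (\<lambda>k. 2 ^ k * (D k x)\<^sup>2)"
      by (intro summable_suminf_not_top) (auto simp: infinity_ennreal_def)
    then have s: "summable (\<lambda>k. 2 ^ k * (D k x)\<^sup>2 + (1/2) ^ k)"
      by (intro summable_add summable_geometric) auto
    have "norm \<bar>D k x\<bar> \<le> 2 ^ k * (D k x)\<^sup>2 + (1/2) ^ k" for k
    proof -
      define r :: real where "r = sqrt 2 ^ k"
      have r: "r > 0" "r\<^sup>2 = 2 ^ k" by (auto simp: r_def power_mult[symmetric] mult.commute[of k 2] power_mult)
      have "2 * (r * \<bar>D k x\<bar>) * (1 / r) \<le> (r * \<bar>D k x\<bar>)\<^sup>2 + (1 / r)\<^sup>2" by (rule sum_squares_bound)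
      also have "\<dots> = 2 ^ k * (D k x)\<^sup>2 + (1/2) ^ k"
        by (simp add: power_mult_distrib power_divide r)
      finally show ?thesis using r by simp
    qed
    then show "summable (\<lambda>k. \<bar>D k x\<bar>)" by (intro summable_comparison_test'[OF s]) auto
  qed
qed

lemma L2_Cauchy_subsequence:
  assumes X: "\<And>k. in_Lp 2 M (X k)"
    and C: "\<And>e. e > 0 \<Longrightarrow> \<exists>N. \<forall>m\<ge>N. \<forall>n\<ge>N. (\<integral>x. (X m x - X n x)\<^sup>2 \<partial>M) < e"
  obtains r :: "nat \<Rightarrow> nat" where "strict_mono r" "AE x in M. convergent (\<lambda>k. X (r k) x)"
proof -
  have "\<exists>N. \<forall>m\<ge>N. \<forall>n\<ge>N. (\<integral>x. (X m x - X n x)\<^sup>2 \<partial>M) < (1/4) ^ k" for k by (rule C) simp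
  then obtain N where N: "\<And>k m n. m \<ge> N k \<Longrightarrow> n \<ge> N k \<Longrightarrow> (\<integral>x. (X m x - X n x)\<^sup>2 \<partial>M) < (1/4) ^ k"
    by metis
  \<comment> \<open>The sum makes \<open>r k\<close> at least \<open>N k\<close>, the summand
    \<open>k\<close> makes \<open>r\<close> strictly increasing.\<close>
  define r where "r k = k + (\<Sum>i\<le>k. N i)" for k
  have r: "strict_mono r" unfolding strict_mono_Suc_iff r_def by simp
  have rN: "r k \<ge> N k" for k unfolding r_def using member_le_sum[of k "{..k}" N] by simp
  have rN': "r (Suc k) \<ge> N k" for k using rN[of k] strict_monoD[OF r, of k "Suc k"] by simp
  have "AE x in M. summable (\<lambda>k. \<bar>X (r (Suc k)) x - X (r k) x\<bar>)"
    by (rule AE_subsequence_summable) (auto intro!: in_Lp_2_diff X less_imp_le[OF N] rN rN')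
  then have "AE x in M. convergent (\<lambda>k. X (r k) x)"
  proof eventually_elim
    case (elim x)
    then have "summable (\<lambda>k. X (r (Suc k)) x - X (r k) x)" by (rule summable_rabs_cancel)
    then have "convergent (\<lambda>n. \<Sum>k<n. X (r (Suc k)) x - X (r k) x)"
      by (simp add: summable_iff_convergent)
    then have "convergent (\<lambda>n. X (r n) x - X (r 0) x)" by (simp add: sum_lessThan_telescope[of "\<lambda>k. X (r k) x"])
    from convergent_add[OF this convergent_const[of "X (r 0) x"]] show ?case by simp
  qed
  with r that show ?thesis by blast
qed

lemma Lp_tendsto_2_Cauchy:
  assumes "Lp_tendsto 2 M X Y" "e > 0"
  shows "\<exists>N. \<forall>m\<ge>N. \<forall>n\<ge>N. (\<integral>x. (X m x - X n x)\<^sup>2 \<partial>M) < e"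
proof -
  note D = Lp_tendsto_2_D[OF assms(1)]
  \<comment> \<open>The triangle inequality for squared distances has a factor 2 on each of its two
    terms.\<close>
  have "e / 4 > 0" using assms(2) by simp
  from order_tendstoD(2)[OF D(3) this] obtain N where N: "\<And>n. n \<ge> N \<Longrightarrow> (\<integral>x. (X n x - Y x)\<^sup>2 \<partial>M) < e / 4"
    by (auto simp: eventually_sequentially)
  have "(\<integral>x. (X m x - X n x)\<^sup>2 \<partial>M) < e" if "m \<ge> N" "n \<ge> N" for m n
    using in_Lp_2_norm_triangle[OF D(1)[of m] D(2) D(1)[of n]] N[OF that(1)] N[OF that(2)]
    by (simp add: power2_commute[of "Y _"])
  then show ?thesis by blast
qed

text \<open>Fatou's lemma with right-hand sides that may vary with \<open>k\<close>: in the
  hypercontractive estimate the bound for an approximant is computed from its own second moment and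
  converges along with it.\<close>

lemma nn_integral_Fatou_bound:
  assumes X: "\<And>k. X k \<in> borel_measurable M" and lim: "AE x in M. (\<lambda>k. X k x) \<longlonglongrightarrow> Y x"
    and c: "continuous_on UNIV (\<phi> :: real \<Rightarrow> real)"
    and le: "\<forall>\<^sub>F k in sequentially. (\<integral>\<^sup>+x. ennreal (\<phi> (X k x)) \<partial>M) \<le> ennreal (B k)"
    and B: "B \<longlonglongrightarrow> b"
  shows "(\<integral>\<^sup>+x. ennreal (\<phi> (Y x)) \<partial>M) \<le> ennreal b"
proof -
  have [measurable]: "\<phi> \<in> borel_measurable borel" by (rule borel_measurable_continuous_onI[OF c])
  note X[measurable]
  have "(\<integral>\<^sup>+x. ennreal (\<phi> (Y x)) \<partial>M) = (\<integral>\<^sup>+x. liminf (\<lambda>k. ennreal (\<phi> (X k x))) \<partial>M)"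
  proof (rule nn_integral_cong_AE)
    show "AE x in M. ennreal (\<phi> (Y x)) = liminf (\<lambda>k. ennreal (\<phi> (X k x)))"
      using lim
    proof eventually_elim
      case (elim x)
      have "(\<lambda>k. \<phi> (X k x)) \<longlonglongrightarrow> \<phi> (Y x)"
        using c elim by (rule continuous_on_tendsto_compose) auto
      then have "(\<lambda>k. ennreal (\<phi> (X k x))) \<longlonglongrightarrow> ennreal (\<phi> (Y x))" by (rule tendsto_ennrealI)
      then show ?case by (simp add: lim_imp_Liminf)
    qed
  qed
  also have "\<dots> \<le> liminf (\<lambda>k. \<integral>\<^sup>+x. ennreal (\<phi> (X k x)) \<partial>M)" by (rule nn_integral_liminf) simp
  also have "\<dots> \<le> liminf (\<lambda>k. ennreal (B k))" by (rule Liminf_mono[OF le])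
  also have "\<dots> = ennreal b" using tendsto_ennrealI[OF B] by (simp add: lim_imp_Liminf)
  finally show ?thesis .
qed

text \<open>The candidate limit is the pointwise limit of an almost everywhere convergent
  subsequence. Fatou's lemma along that subsequence, with \<open>n\<close> fixed, turns the Cauchy
  condition into a bound for the distance from \<open>X n\<close> to it.\<close>

lemma L2_complete:
  assumes X: "\<And>k. in_Lp 2 M (X k)"
    and C: "\<And>e. e > 0 \<Longrightarrow> \<exists>N. \<forall>m\<ge>N. \<forall>n\<ge>N. (\<integral>x. (X m x - X n x)\<^sup>2 \<partial>M) < e"
  shows "\<exists>Y. Lp_tendsto 2 M X Y"
proof -
  obtain r where r: "strict_mono r" and conv: "AE x in M. convergent (\<lambda>k. X (r k) x)"
    by (rule L2_Cauchy_subsequence[OF X C])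
  have Xm[measurable]: "X k \<in> borel_measurable M" for k using X by (simp add: in_Lp_2_iff)
  \<comment> \<open>Where the subsequence diverges, \<open>lim\<close> has an unspecified value;
    \<open>Y\<close> is still measurable, and these points form a null set.\<close>
  define Y where "Y x = lim (\<lambda>k. X (r k) x)" for x
  have Ym[measurable]: "Y \<in> borel_measurable M" unfolding Y_def by measurable
  have lim: "AE x in M. (\<lambda>k. X (r k) x) \<longlonglongrightarrow> Y x"
    using conv unfolding Y_def by eventually_elim (simp add: convergent_LIMSEQ_iff)
  have bound: "\<exists>N. \<forall>n\<ge>N. (\<integral>\<^sup>+x. ennreal ((X n x - Y x)\<^sup>2) \<partial>M) \<le> ennreal e" if "e > 0" for e
  proof -
    obtain N where N: "\<And>m n. m \<ge> N \<Longrightarrow> n \<ge> N \<Longrightarrow> (\<integral>x. (X m x - X n x)\<^sup>2 \<partial>M) < e" using C[OF \<open>e > 0\<close>] by blast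
    have "(\<integral>\<^sup>+x. ennreal ((X n x - Y x)\<^sup>2) \<partial>M) \<le> ennreal e" if n: "n \<ge> N" for n
    proof (rule nn_integral_Fatou_bound[where X="\<lambda>k x. X n x - X (r k) x" and \<phi>="\<lambda>s. s\<^sup>2" and B="\<lambda>k. e"])
      show "AE x in M. (\<lambda>k. X n x - X (r k) x) \<longlonglongrightarrow> X n x - Y x"
        using lim by eventually_elim (intro tendsto_intros)
      show "\<forall>\<^sub>F k in sequentially. (\<integral>\<^sup>+x. ennreal ((X n x - X (r k) x)\<^sup>2) \<partial>M) \<le> ennreal e"
        unfolding eventually_sequentially
      proof (intro exI[of _ N] allI impI)
        fix k assume "k \<ge> N"
        then have "r k \<ge> N" using seq_suble[OF r, of k] by simp
        then have "(\<integral>x. (X n x - X (r k) x)\<^sup>2 \<partial>M) < e" using N n by blast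
        moreover have "(\<integral>\<^sup>+x. ennreal ((X n x - X (r k) x)\<^sup>2) \<partial>M) = ennreal (\<integral>x. (X n x - X (r k) x)\<^sup>2 \<partial>M)"
          using in_Lp_2_diff[OF X[of n] X[of "r k"]] by (intro nn_integral_eq_integral) (auto simp: in_Lp_2_iff)
        ultimately show "(\<integral>\<^sup>+x. ennreal ((X n x - X (r k) x)\<^sup>2) \<partial>M) \<le> ennreal e" by (simp add: ennreal_leI)
      qed
    qed (auto intro!: continuous_intros)
    then show ?thesis by blast
  qed
  obtain N where N: "(\<integral>\<^sup>+x. ennreal ((X N x - Y x)\<^sup>2) \<partial>M) \<le> ennreal 1" using bound[of 1] by auto
  have "in_Lp 2 M (\<lambda>x. X N x - Y x)"
    unfolding in_Lp_2_iff using N by (auto intro!: integrableI_bounded simp: le_less_trans[OF N])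
  from in_Lp_2_diff[OF X[of N] this] have Y: "in_Lp 2 M Y" by simp
  have "(\<lambda>k. \<integral>x. (X k x - Y x)\<^sup>2 \<partial>M) \<longlonglongrightarrow> 0"
  proof (rule LIMSEQ_I)
    fix e :: real assume "e > 0"
    then obtain N where N: "\<And>n. n \<ge> N \<Longrightarrow> (\<integral>\<^sup>+x. ennreal ((X n x - Y x)\<^sup>2) \<partial>M) \<le> ennreal (e / 2)"
      using bound[of "e / 2"] by auto
    have "norm ((\<integral>x. (X n x - Y x)\<^sup>2 \<partial>M) - 0) < e" if "n \<ge> N" for n
    proof -
      have "(\<integral>\<^sup>+x. ennreal ((X n x - Y x)\<^sup>2) \<partial>M) = ennreal (\<integral>x. (X n x - Y x)\<^sup>2 \<partial>M)"
        using in_Lp_2_diff[OF X[of n] Y] by (intro nn_integral_eq_integral) (auto simp: in_Lp_2_iff)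
      then have "(\<integral>x. (X n x - Y x)\<^sup>2 \<partial>M) \<le> e / 2" using N[OF that] \<open>e > 0\<close> by simp
      then show ?thesis using \<open>e > 0\<close> by simp
    qed
    then show "\<exists>N. \<forall>n\<ge>N. norm ((\<integral>x. (X n x - Y x)\<^sup>2 \<partial>M) - 0) < e" by blast
  qed
  then show ?thesis using X Y by (auto simp: Lp_tendsto_2_iff)
qed

lemma AE_eq_if_integral_square_0:
  assumes "in_Lp 2 M f" "in_Lp 2 M g" "(\<integral>x. (f x - g x)\<^sup>2 \<partial>M) = 0"
  shows "AE x in M. f x = g x"
proof -
  have "AE x in M. (f x - g x)\<^sup>2 = 0"
    using in_Lp_2_diff[OF assms(1,2)] assms(3)
    by (subst integral_nonneg_eq_0_iff_AE[symmetric]) (auto simp: in_Lp_2_iff)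
  then show ?thesis by eventually_elim simp
qed

lemma Lp_tendsto_2_AE_subsequence:
  assumes "Lp_tendsto 2 M X Y"
  obtains r :: "nat \<Rightarrow> nat" where "strict_mono r" "AE x in M. (\<lambda>k. X (r k) x) \<longlonglongrightarrow> Y x"
proof -
  note D = Lp_tendsto_2_D[OF assms]
  have dL: "in_Lp 2 M (\<lambda>x. X k x - Y x)" for k by (intro in_Lp_2_diff D)
  have "\<exists>N. \<forall>n\<ge>N. (\<integral>x. (X n x - Y x)\<^sup>2 \<partial>M) < (1/4) ^ k" for k
    using order_tendstoD(2)[OF D(3), of "(1/4) ^ k"] by (auto simp: eventually_sequentially)
  then obtain N where N: "\<And>k n. n \<ge> N k \<Longrightarrow> (\<integral>x. (X n x - Y x)\<^sup>2 \<partial>M) < (1/4) ^ k" by metis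
  define r where "r k = k + (\<Sum>i\<le>k. N i)" for k
  have r: "strict_mono r" unfolding strict_mono_Suc_iff r_def by simp
  have rN: "r k \<ge> N k" for k unfolding r_def using member_le_sum[of k "{..k}" N] by simp
  have "AE x in M. summable (\<lambda>k. \<bar>X (r k) x - Y x\<bar>)"
    by (rule AE_subsequence_summable) (auto intro!: dL less_imp_le[OF N] rN)
  then have "AE x in M. (\<lambda>k. X (r k) x) \<longlonglongrightarrow> Y x"
  proof eventually_elim
    case (elim x)
    from summable_LIMSEQ_zero[OF this] have "(\<lambda>k. X (r k) x - Y x) \<longlonglongrightarrow> 0" by (simp add: tendsto_rabs_zero_iff)
    then show ?case by (simp add: LIM_zero_iff)
  qed
  with r that show ?thesis by blast
qed

text \<open>Pointwise convergence is available along a subsequence only; the assumed bounds and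
  their limit are inherited by it.\<close>

lemma Lp_tendsto_2_Fatou:
  assumes "Lp_tendsto 2 M X Y" "continuous_on UNIV (\<phi> :: real \<Rightarrow> real)"
    and "\<forall>\<^sub>F k in sequentially. (\<integral>\<^sup>+x. ennreal (\<phi> (X k x)) \<partial>M) \<le> ennreal (B k)" and B: "B \<longlonglongrightarrow> b"
  shows "(\<integral>\<^sup>+x. ennreal (\<phi> (Y x)) \<partial>M) \<le> ennreal b"
proof -
  obtain r where r: "strict_mono r" and lim: "AE x in M. (\<lambda>k. X (r k) x) \<longlonglongrightarrow> Y x"
    by (rule Lp_tendsto_2_AE_subsequence[OF assms(1)])
  show ?thesis
  proof (rule nn_integral_Fatou_bound[OF _ lim assms(2)])
    show "X (r k) \<in> borel_measurable M" for k using Lp_tendsto_2_D[OF assms(1)] by (simp add: in_Lp_2_iff)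
    show "\<forall>\<^sub>F k in sequentially. (\<integral>\<^sup>+x. ennreal (\<phi> (X (r k) x)) \<partial>M) \<le> ennreal ((B \<circ> r) k)"
      using eventually_subseq[OF r assms(3)] by simp
    show "(B \<circ> r) \<longlonglongrightarrow> b" by (rule LIMSEQ_subseq_LIMSEQ[OF B r])
  qed
qed

section \<open>Gaussian moments and integration by parts\<close>

text \<open>The moment of order \<open>m\<close> of the centered normal law of variance
  \<open>v\<close>: for even \<open>m\<close> the coefficient is the double factorial (m - 1)!!. At
  \<open>v = 0\<close> it is the moment of the point mass at 0.\<close>

definition gauss_moment :: "nat \<Rightarrow> real \<Rightarrow> real" where
  "gauss_moment m v = (if even m then fact m / (2 ^ (m div 2) * fact (m div 2)) * v ^ (m div 2) else 0)"

lemma gauss_moment_0 [simp]: "gauss_moment 0 v = 1"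
  and gauss_moment_odd: "odd m \<Longrightarrow> gauss_moment m v = 0"
  and gauss_moment_double: "gauss_moment (2 * k) v = fact (2 * k) / (2 ^ k * fact k) * v ^ k"
  by (auto simp: gauss_moment_def)

lemma gauss_coefficient_Suc:
  "(fact (2 * Suc k) / (2 ^ Suc k * fact (Suc k)) :: real) = real (2 * k + 1) * (fact (2 * k) / (2 ^ k * fact k))"
proof -
  have 1: "(fact (2 * Suc k) :: real) = (2 * real (Suc k)) * (real (2 * k + 1) * fact (2 * k))"
    by (simp add: algebra_simps)
  have 2: "(2 ^ Suc k * fact (Suc k) :: real) = (2 * real (Suc k)) * (2 ^ k * fact k)" by simp
  show ?thesis unfolding 1 2 by (subst mult_divide_mult_cancel_left) auto
qed

text \<open>Integration by parts for the normal law. At \<open>m = 0\<close> the truncated index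
  \<open>m - 1\<close> is harmless because of the factor \<open>m\<close>.\<close>

lemma gauss_moment_Suc: "gauss_moment (Suc m) v = real m * v * gauss_moment (m - 1) v"
proof (cases "even m")
  case True
  then show ?thesis by (cases m) (auto simp: gauss_moment_def)
next
  case False
  then obtain k where k: "m = 2 * k + 1" by (elim oddE)
  show ?thesis unfolding k
    using gauss_moment_double[of "Suc k" v, unfolded gauss_coefficient_Suc] gauss_moment_double[of k v]
    by (simp add: mult_ac)
qed

text \<open>A class closed under sums and products, so that every polynomial in the Gaussian
  variables is integrable without a separate estimate.\<close>

definition all_moments :: "'a measure \<Rightarrow> ('a \<Rightarrow> real) \<Rightarrow> bool" where
  "all_moments M X \<longleftrightarrow> X \<in> borel_measurable M \<and> (\<forall>m. integrable M (\<lambda>\<omega>. \<bar>X \<omega>\<bar> ^ m))"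

lemma all_moments_measurable: "all_moments M X \<Longrightarrow> X \<in> borel_measurable M"
  by (simp add: all_moments_def)

lemma all_moments_power_integrable: "all_moments M X \<Longrightarrow> integrable M (\<lambda>\<omega>. X \<omega> ^ m)"
  unfolding all_moments_def
  by (rule Bochner_Integration.integrable_bound[where f="\<lambda>\<omega>. \<bar>X \<omega>\<bar> ^ m"]) (auto simp: power_abs)

lemma all_moments_integrable: "all_moments M X \<Longrightarrow> integrable M X"
  using all_moments_power_integrable[of M X 1] by simp

lemma all_moments_in_Lp_2: "all_moments M X \<Longrightarrow> in_Lp 2 M X"
  using all_moments_power_integrable[of M X 2] by (simp add: in_Lp_2_iff all_moments_measurable)

lemma (in prob_space) all_moments_const: "all_moments M (\<lambda>_. c)"
  by (simp add: all_moments_def)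

lemma all_moments_mult:
  assumes "all_moments M X" "all_moments M Y"
  shows "all_moments M (\<lambda>\<omega>. X \<omega> * Y \<omega>)"
  unfolding all_moments_def
proof (intro conjI allI)
  show "(\<lambda>\<omega>. X \<omega> * Y \<omega>) \<in> borel_measurable M" using assms by (auto simp: all_moments_def)
  fix m
  show "integrable M (\<lambda>\<omega>. \<bar>X \<omega> * Y \<omega>\<bar> ^ m)"
  proof (rule Bochner_Integration.integrable_bound)
    show "integrable M (\<lambda>\<omega>. \<bar>X \<omega>\<bar> ^ (2 * m) + \<bar>Y \<omega>\<bar> ^ (2 * m))"
      using assms by (auto simp: all_moments_def)
    show "(\<lambda>\<omega>. \<bar>X \<omega> * Y \<omega>\<bar> ^ m) \<in> borel_measurable M" using assms by (auto simp: all_moments_def)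
    have "\<bar>a * b\<bar> ^ m \<le> \<bar>a\<bar> ^ (2 * m) + \<bar>b\<bar> ^ (2 * m)" for a b :: real
    proof -
      have "2 * \<bar>a\<bar> ^ m * \<bar>b\<bar> ^ m \<le> (\<bar>a\<bar> ^ m)\<^sup>2 + (\<bar>b\<bar> ^ m)\<^sup>2" by (rule sum_squares_bound)
      moreover have "0 \<le> \<bar>a\<bar> ^ m * \<bar>b\<bar> ^ m" by simp
      ultimately have "\<bar>a\<bar> ^ m * \<bar>b\<bar> ^ m \<le> (\<bar>a\<bar> ^ m)\<^sup>2 + (\<bar>b\<bar> ^ m)\<^sup>2" by linarith
      then show ?thesis by (simp only: abs_mult power_mult_distrib mult.commute[of 2 m] power_mult)
    qed
    then show "AE \<omega> in M. norm (\<bar>X \<omega> * Y \<omega>\<bar> ^ m) \<le> norm (\<bar>X \<omega>\<bar> ^ (2 * m) + \<bar>Y \<omega>\<bar> ^ (2 * m))"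
      by (auto intro!: AE_I2)
  qed
qed

lemma all_moments_add:
  assumes "all_moments M X" "all_moments M Y"
  shows "all_moments M (\<lambda>\<omega>. X \<omega> + Y \<omega>)"
  unfolding all_moments_def
proof (intro conjI allI)
  show "(\<lambda>\<omega>. X \<omega> + Y \<omega>) \<in> borel_measurable M" using assms by (auto simp: all_moments_def)
  fix m
  show "integrable M (\<lambda>\<omega>. \<bar>X \<omega> + Y \<omega>\<bar> ^ m)"
  proof (rule Bochner_Integration.integrable_bound)
    show "integrable M (\<lambda>\<omega>. 2 ^ m * \<bar>X \<omega>\<bar> ^ m + 2 ^ m * \<bar>Y \<omega>\<bar> ^ m)"
      using assms by (auto simp: all_moments_def)
    show "(\<lambda>\<omega>. \<bar>X \<omega> + Y \<omega>\<bar> ^ m) \<in> borel_measurable M" using assms by (auto simp: all_moments_def)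
    have "\<bar>a + b\<bar> ^ m \<le> 2 ^ m * \<bar>a\<bar> ^ m + 2 ^ m * \<bar>b\<bar> ^ m" for a b :: real
    proof -
      have "\<bar>a + b\<bar> \<le> 2 * \<bar>a\<bar> \<or> \<bar>a + b\<bar> \<le> 2 * \<bar>b\<bar>" by linarith
      then have "\<bar>a + b\<bar> ^ m \<le> (2 * \<bar>a\<bar>) ^ m \<or> \<bar>a + b\<bar> ^ m \<le> (2 * \<bar>b\<bar>) ^ m"
        by (meson abs_ge_zero power_mono)
      moreover have "0 \<le> (2 * \<bar>a\<bar>) ^ m" "0 \<le> (2 * \<bar>b\<bar>) ^ m" by auto
      ultimately show ?thesis unfolding power_mult_distrib by linarith
    qed
    then show "AE \<omega> in M. norm (\<bar>X \<omega> + Y \<omega>\<bar> ^ m) \<le> norm (2 ^ m * \<bar>X \<omega>\<bar> ^ m + 2 ^ m * \<bar>Y \<omega>\<bar> ^ m)"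
      by (auto intro!: AE_I2)
  qed
qed

lemma (in prob_space) all_moments_cmult: "all_moments M X \<Longrightarrow> all_moments M (\<lambda>\<omega>. c * X \<omega>)"
  by (rule all_moments_mult[OF all_moments_const])

lemma (in prob_space) all_moments_power: "all_moments M X \<Longrightarrow> all_moments M (\<lambda>\<omega>. X \<omega> ^ n)"
  by (induction n) (auto intro: all_moments_const all_moments_mult)

lemma (in prob_space) all_moments_sum:
  "(\<And>i. i \<in> I \<Longrightarrow> all_moments M (X i)) \<Longrightarrow> all_moments M (\<lambda>\<omega>. \<Sum>i\<in>I. X i \<omega>)"
  by (induction I rule: infinite_finite_induct) (auto intro: all_moments_const all_moments_add)

lemma (in prob_space) all_moments_prod:
  "(\<And>i. i \<in> I \<Longrightarrow> all_moments M (X i)) \<Longrightarrow> all_moments M (\<lambda>\<omega>. \<Prod>i\<in>I. X i \<omega>)"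
  by (induction I rule: infinite_finite_induct) (auto intro: all_moments_const all_moments_mult)

text \<open>Taking the second moment as the parameter covers the degenerate law and the normal laws
  by one formula.\<close>

lemma (in prob_space) centered_gaussian_moment:
  assumes X: "centered_gaussian M X"
  shows "all_moments M X" "expectation (\<lambda>\<omega>. X \<omega> ^ m) = gauss_moment m (expectation (\<lambda>\<omega>. (X \<omega>)\<^sup>2))"
proof -
  have [measurable]: "X \<in> borel_measurable M" using X by (simp add: centered_gaussian_def)
  have "all_moments M X \<and> expectation (\<lambda>\<omega>. X \<omega> ^ m) = gauss_moment m (expectation (\<lambda>\<omega>. (X \<omega>)\<^sup>2))"
  proof (cases "AE \<omega> in M. X \<omega> = 0")
    case True
    have e: "integrable M (\<lambda>\<omega>. f (X \<omega>)) \<and> expectation (\<lambda>\<omega>. f (X \<omega>)) = f 0"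
      if [measurable]: "f \<in> borel_measurable borel" for f :: "real \<Rightarrow> real"
    proof -
      have "AE \<omega> in M. f (X \<omega>) = f 0" using True by eventually_elim simp
      then have "integrable M (\<lambda>\<omega>. f (X \<omega>)) \<longleftrightarrow> integrable M (\<lambda>\<omega>. f 0)"
        "expectation (\<lambda>\<omega>. f (X \<omega>)) = expectation (\<lambda>\<omega>. f 0)"
        by (intro integrable_cong_AE integral_cong_AE; simp)+
      then show ?thesis by (simp add: prob_space)
    qed
    have "all_moments M X" using e[of "\<lambda>x. \<bar>x\<bar> ^ _"] by (simp add: all_moments_def)
    moreover have "expectation (\<lambda>\<omega>. X \<omega> ^ m) = gauss_moment m 0"
      using e[of "\<lambda>x. x ^ m"] by (auto simp: gauss_moment_def power_0_left elim!: evenE)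
    moreover have "expectation (\<lambda>\<omega>. (X \<omega>)\<^sup>2) = 0" using e[of "\<lambda>x. x\<^sup>2"] by simp
    ultimately show ?thesis by simp
  next
    case False
    then obtain \<sigma> where s: "\<sigma> > 0" and D: "distributed M lborel X (normal_density 0 \<sigma>)"
      using X by (auto simp: centered_gaussian_def)
    have "integrable M (\<lambda>\<omega>. \<bar>X \<omega>\<bar> ^ k)" for k
      using integrable_normal_moment_abs[OF s, of 0 k] distributed_integrable[OF D, of "\<lambda>x. \<bar>x\<bar> ^ k"] by simp
    then have 1: "all_moments M X" by (simp add: all_moments_def)
    have int: "expectation (\<lambda>\<omega>. X \<omega> ^ k) = (\<integral>x. normal_density 0 \<sigma> x * x ^ k \<partial>lborel)" for k
      using distributed_integral[OF D, of "\<lambda>x. x ^ k"] by simp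
    have ev: "expectation (\<lambda>\<omega>. X \<omega> ^ (2 * k)) = fact (2 * k) / (2 ^ k * fact k) * (\<sigma>\<^sup>2) ^ k" for k
      unfolding int using integral_normal_moment_even[OF s, of 0 k] s by (simp add: power_divide field_simps)
    have od: "expectation (\<lambda>\<omega>. X \<omega> ^ (2 * k + 1)) = 0" for k
      unfolding int using integral_normal_moment_odd[OF s, of 0 k] by simp
    have v: "expectation (\<lambda>\<omega>. (X \<omega>)\<^sup>2) = \<sigma>\<^sup>2" using ev[of 1] by simp
    have "expectation (\<lambda>\<omega>. X \<omega> ^ m) = gauss_moment m (\<sigma>\<^sup>2)"
      using ev[of "m div 2"] od[of "m div 2"] by (cases "even m") (auto simp: gauss_moment_def elim!: evenE oddE)
    with 1 v show ?thesis by simp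
  qed
  then show "all_moments M X" "expectation (\<lambda>\<omega>. X \<omega> ^ m) = gauss_moment m (expectation (\<lambda>\<omega>. (X \<omega>)\<^sup>2))"
    by auto
qed

text \<open>Only the linear coefficient survives at 0; for \<open>m = 0\<close> it does not occur in
  the sum.\<close>

lemma DERIV_polynomial_at_0:
  fixes a :: "nat \<Rightarrow> real"
  shows "((\<lambda>s. \<Sum>k\<le>m. a k * s ^ k) has_real_derivative (if m = 0 then 0 else a 1)) (at 0)"
proof -
  have "((\<lambda>s. \<Sum>k\<le>m. a k * s ^ k) has_real_derivative (\<Sum>k\<le>m. a k * (real k * 0 ^ (k - 1)))) (at 0)"
    by (auto intro!: derivative_eq_intros sum.cong simp: mult_ac)
  also have "(\<Sum>k\<le>m. a k * (real k * 0 ^ (k - 1))) = (\<Sum>k\<le>m. if k = 1 then a 1 else 0)"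
    by (intro sum.cong refl) (auto simp: power_0_left)
  also have "\<dots> = (if m = 0 then 0 else a 1)" by (simp add: sum.delta)
  finally show ?thesis .
qed

text \<open>By the binomial theorem the expectation is a polynomial in \<open>s\<close>, so the
  derivative is read off its linear coefficient and no domination argument is involved.\<close>

lemma (in prob_space) DERIV_expectation_power_at_0:
  assumes P: "all_moments M P" and Y: "all_moments M Y" and Z: "all_moments M Z"
  shows "((\<lambda>s. expectation (\<lambda>\<omega>. P \<omega> * (Y \<omega> + s * Z \<omega>) ^ m)) has_real_derivative
    real m * expectation (\<lambda>\<omega>. P \<omega> * Z \<omega> * Y \<omega> ^ (m - 1))) (at 0)"
proof -
  have i: "integrable M (\<lambda>\<omega>. P \<omega> * (Z \<omega> ^ k * Y \<omega> ^ l))" for k l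
    by (intro all_moments_integrable all_moments_mult all_moments_power P Y Z)
  have "expectation (\<lambda>\<omega>. P \<omega> * (Y \<omega> + s * Z \<omega>) ^ m)
      = (\<Sum>k\<le>m. (real (m choose k) * expectation (\<lambda>\<omega>. P \<omega> * (Z \<omega> ^ k * Y \<omega> ^ (m - k)))) * s ^ k)" for s
  proof -
    have "P \<omega> * (Y \<omega> + s * Z \<omega>) ^ m
        = (\<Sum>k\<le>m. (real (m choose k) * s ^ k) * (P \<omega> * (Z \<omega> ^ k * Y \<omega> ^ (m - k))))" for \<omega>
      by (simp add: add.commute[of "Y \<omega>"] binomial_ring sum_distrib_left power_mult_distrib mult_ac)
    then have "expectation (\<lambda>\<omega>. P \<omega> * (Y \<omega> + s * Z \<omega>) ^ m)
        = (\<Sum>k\<le>m. (real (m choose k) * s ^ k) * expectation (\<lambda>\<omega>. P \<omega> * (Z \<omega> ^ k * Y \<omega> ^ (m - k))))"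
      using i by simp
    then show ?thesis by (simp add: mult_ac)
  qed
  then show ?thesis
    using DERIV_polynomial_at_0[of "\<lambda>k. real (m choose k) * expectation (\<lambda>\<omega>. P \<omega> * (Z \<omega> ^ k * Y \<omega> ^ (m - k)))" m]
    by (cases "m = 0") (simp_all add: mult.assoc)
qed

definition ip :: "(real \<times> real \<Rightarrow> real) \<Rightarrow> (real \<times> real \<Rightarrow> real) \<Rightarrow> real" where
  "ip g h = (\<integral>x. g x * h x \<partial>quadrant)"

lemma ip_commute: "ip g h = ip h g"
  by (simp add: ip_def mult.commute)

lemma ip_add_right:
  assumes "in_Lp 2 quadrant f" "in_Lp 2 quadrant g" "in_Lp 2 quadrant h"
  shows "ip f (\<lambda>x. g x + s * h x) = ip f g + s * ip f h"
proof -
  have "ip f (\<lambda>x. g x + s * h x) = (\<integral>x. f x * g x + s * (f x * h x) \<partial>quadrant)"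
    by (simp add: ip_def algebra_simps)
  then show ?thesis using assms by (simp add: ip_def in_Lp_2_prod_integrable)
qed

lemma in_Lp_2_axpy:
  "in_Lp 2 M g \<Longrightarrow> in_Lp 2 M h \<Longrightarrow> in_Lp 2 M (\<lambda>x. g x + s * h x)"
  by (intro in_Lp_2_add in_Lp_2_cmult)

locale isonormal_process =
  fixes M :: "'a measure" and W :: "(real \<times> real \<Rightarrow> real) \<Rightarrow> 'a \<Rightarrow> real"
  assumes isonormal: "isonormal M W"

sublocale isonormal_process \<subseteq> prob_space M
  using isonormal by (simp add: isonormal_def)

context isonormal_process
begin

lemma expectation_W_mult:
  "in_Lp 2 quadrant g \<Longrightarrow> in_Lp 2 quadrant h \<Longrightarrow> expectation (\<lambda>\<omega>. W g \<omega> * W h \<omega>) = ip g h"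
  using isonormal by (auto simp: isonormal_def ip_def)

lemma centered_gaussian_W: assumes "in_Lp 2 quadrant h" shows "centered_gaussian M (W h)"
proof -
  have "\<forall>I c. finite I \<and> (\<forall>h\<in>I. in_Lp 2 quadrant h) \<longrightarrow>
      centered_gaussian M (\<lambda>\<omega>. \<Sum>h\<in>I. c h * W h \<omega>)"
    using isonormal by (simp add: isonormal_def)
  from this[rule_format, of "{h}" "\<lambda>_. 1"] show ?thesis using assms by simp
qed

lemma all_moments_W: "in_Lp 2 quadrant h \<Longrightarrow> all_moments M (W h)"
  by (rule centered_gaussian_moment(1)[OF centered_gaussian_W])

lemma expectation_W_power:
  assumes "in_Lp 2 quadrant h"
  shows "expectation (\<lambda>\<omega>. W h \<omega> ^ m) = gauss_moment m (ip h h)"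
  using centered_gaussian_moment(2)[OF centered_gaussian_W[OF assms], of m] expectation_W_mult[OF assms assms]
  by (simp add: power2_eq_square)

text \<open>The covariances make the second moment of the difference of the two sides
  vanish.\<close>

lemma W_linear:
  assumes g: "in_Lp 2 quadrant g" and h: "in_Lp 2 quadrant h"
  shows "AE \<omega> in M. W (\<lambda>x. g x + s * h x) \<omega> = W g \<omega> + s * W h \<omega>"
proof -
  define f where "f = (\<lambda>x. g x + s * h x)"
  have f: "in_Lp 2 quadrant f" unfolding f_def by (rule in_Lp_2_axpy[OF g h])
  have i: "integrable M (\<lambda>\<omega>. W a \<omega> * W b \<omega>)" if "in_Lp 2 quadrant a" "in_Lp 2 quadrant b" for a b
    using that by (intro all_moments_integrable all_moments_mult all_moments_W)
  have ff: "ip f f = ip f g + s * ip f h" "ip g f = ip g g + s * ip g h" "ip h f = ip h g + s * ip h h"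
    unfolding f_def by (intro ip_add_right in_Lp_2_axpy g h)+
  have "expectation (\<lambda>\<omega>. (W f \<omega> - (W g \<omega> + s * W h \<omega>))\<^sup>2)
      = expectation (\<lambda>\<omega>. W f \<omega> * W f \<omega> - 2 * (W f \<omega> * W g \<omega>) - 2 * s * (W f \<omega> * W h \<omega>)
         + W g \<omega> * W g \<omega> + 2 * s * (W g \<omega> * W h \<omega>) + s\<^sup>2 * (W h \<omega> * W h \<omega>))"
    by (simp add: power2_eq_square algebra_simps)
  also have "\<dots> = ip f f - 2 * ip f g - 2 * s * ip f h + ip g g + 2 * s * ip g h + s\<^sup>2 * ip h h"
    using f g h by (simp add: i expectation_W_mult)
  also have "\<dots> = 0"
    using ff ip_commute[of f g] ip_commute[of f h] ip_commute[of h g]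
    by (simp add: power2_eq_square algebra_simps)
  finally have "expectation (\<lambda>\<omega>. (W f \<omega> - (W g \<omega> + s * W h \<omega>))\<^sup>2) = 0" .
  then have "AE \<omega> in M. W f \<omega> = W g \<omega> + s * W h \<omega>"
    by (intro AE_eq_if_integral_square_0 all_moments_in_Lp_2 all_moments_W all_moments_add all_moments_cmult f g h)
  then show ?thesis by (simp add: f_def)
qed

lemma W_zero: "AE \<omega> in M. W (\<lambda>x. 0) \<omega> = 0"
proof -
  have "AE \<omega> in M. W (\<lambda>x. 0) \<omega> = W (\<lambda>x. 0) \<omega> + W (\<lambda>x. 0) \<omega>"
    using W_linear[OF in_Lp_2_zero in_Lp_2_zero, of 1] by simp
  then show ?thesis by eventually_elim simp
qed

lemma W_sum:
  assumes "\<And>i. i \<in> I \<Longrightarrow> in_Lp 2 quadrant (f i)"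
  shows "AE \<omega> in M. W (\<lambda>x. \<Sum>i\<in>I. f i x) \<omega> = (\<Sum>i\<in>I. W (f i) \<omega>)"
  using assms
proof (induction I rule: infinite_finite_induct)
  case (insert i I)
  have "AE \<omega> in M. W (\<lambda>x. f i x + 1 * (\<Sum>i\<in>I. f i x)) \<omega> = W (f i) \<omega> + 1 * W (\<lambda>x. \<Sum>i\<in>I. f i x) \<omega>"
    using insert.prems by (intro W_linear in_Lp_2_sum) auto
  moreover have "AE \<omega> in M. W (\<lambda>x. \<Sum>i\<in>I. f i x) \<omega> = (\<Sum>i\<in>I. W (f i) \<omega>)"
    using insert by auto
  ultimately show ?case
    by eventually_elim (use insert.hyps in simp)
qed (simp_all add: W_zero)

text \<open>The moment of order \<open>l + 1\<close> of \<open>W y + s * W x\<close> is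
  \<open>gauss_moment (Suc l) (v s)\<close>, where \<open>v s\<close> is the variance. Both
  expressions are differentiated at \<open>s = 0\<close>.\<close>

lemma expectation_W_W_power:
  assumes x: "in_Lp 2 quadrant x" and y: "in_Lp 2 quadrant y"
  shows "expectation (\<lambda>\<omega>. W x \<omega> * W y \<omega> ^ l) = real l * ip x y * expectation (\<lambda>\<omega>. W y \<omega> ^ (l - 1))"
proof -
  define v where "v s = ip y y + 2 * s * ip x y + s\<^sup>2 * ip x x" for s
  have v: "ip (\<lambda>z. y z + s * x z) (\<lambda>z. y z + s * x z) = v s" for s
  proof -
    have a: "in_Lp 2 quadrant (\<lambda>z. y z + s * x z)" by (rule in_Lp_2_axpy[OF y x])
    show ?thesis
      using ip_add_right[OF a y x, of s] ip_add_right[OF y y x, of s] ip_add_right[OF x y x, of s]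
        ip_commute[of "\<lambda>z. y z + s * x z" x] ip_commute[of "\<lambda>z. y z + s * x z" y] ip_commute[of y x]
      by (simp add: v_def power2_eq_square algebra_simps)
  qed
  have eq: "expectation (\<lambda>\<omega>. 1 * (W y \<omega> + s * W x \<omega>) ^ Suc l) = gauss_moment (Suc l) (v s)" for s
  proof -
    have "expectation (\<lambda>\<omega>. (W y \<omega> + s * W x \<omega>) ^ Suc l) = expectation (\<lambda>\<omega>. W (\<lambda>z. y z + s * x z) \<omega> ^ Suc l)"
    proof (rule integral_cong_AE)
      show "AE \<omega> in M. (W y \<omega> + s * W x \<omega>) ^ Suc l = W (\<lambda>z. y z + s * x z) \<omega> ^ Suc l"
        using W_linear[OF y x, of s] by eventually_elim simp
    qed (intro all_moments_measurable all_moments_power all_moments_add all_moments_cmult all_moments_W in_Lp_2_axpy x y)+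
    then show ?thesis using expectation_W_power[OF in_Lp_2_axpy[OF y x, of s], of "Suc l"] v by simp
  qed
  have d1: "((\<lambda>s. gauss_moment (Suc l) (v s)) has_real_derivative
      real (Suc l) * expectation (\<lambda>\<omega>. 1 * W x \<omega> * W y \<omega> ^ (Suc l - 1))) (at 0)"
    using DERIV_expectation_power_at_0[OF all_moments_const[of 1] all_moments_W[OF y] all_moments_W[OF x], of "Suc l"]
    unfolding eq .
  have dv: "(v has_real_derivative 2 * ip x y) (at 0)"
    unfolding v_def by (auto intro!: derivative_eq_intros)
  have v0: "v 0 = ip y y" by (simp add: v_def)
  show ?thesis
  \<comment> \<open>For even \<open>l\<close> the moment of odd order vanishes for all
    \<open>s\<close>; on the other side \<open>l - 1\<close> is odd or the factor \<open>l\<close>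
    is 0.\<close>
  proof (cases "even l")
    case True
    then have "gauss_moment (Suc l) (v s) = 0" for s by (simp add: gauss_moment_odd)
    with d1 have "real (Suc l) * expectation (\<lambda>\<omega>. 1 * W x \<omega> * W y \<omega> ^ (Suc l - 1)) = 0"
      using DERIV_unique[OF d1, of 0] by simp
    moreover have "real l * gauss_moment (l - 1) (ip y y) = 0"
      using True by (cases "l = 0") (auto simp: gauss_moment_odd)
    ultimately show ?thesis by (auto simp: expectation_W_power[OF y])
  next
    case False
    then obtain k where k: "l = 2 * k + 1" by (elim oddE)
    define C :: real where "C = fact (2 * Suc k) / (2 ^ Suc k * fact (Suc k))"
    have "gauss_moment (Suc l) = (\<lambda>v. C * v ^ Suc k)"
      using gauss_moment_double[of "Suc k"] by (simp add: k C_def fun_eq_iff)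
    then have "((\<lambda>s. gauss_moment (Suc l) (v s)) has_real_derivative C * (real (Suc k) * (v 0 ^ k * (2 * ip x y)))) (at 0)"
      using DERIV_cmult[OF DERIV_power[OF dv, of "Suc k"], of C] by (simp add: mult_ac)
    from DERIV_unique[OF d1 this]
    have "real (Suc l) * expectation (\<lambda>\<omega>. W x \<omega> * W y \<omega> ^ l) = real (Suc l) * (C * ip y y ^ k * ip x y)"
      unfolding v0 by (simp add: k algebra_simps)
    then have e: "expectation (\<lambda>\<omega>. W x \<omega> * W y \<omega> ^ l) = C * ip y y ^ k * ip x y" by (simp del: of_nat_Suc)
    have "C = real l * (fact (2 * k) / (2 ^ k * fact k))"
      unfolding C_def k by (rule gauss_coefficient_Suc)
    then have "C * ip y y ^ k = real l * gauss_moment (l - 1) (ip y y)"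
      using gauss_moment_double[of k "ip y y"] by (simp add: k)
    then show ?thesis unfolding e expectation_W_power[OF y] by simp
  qed
qed

text \<open>Polarization: the identity for products is obtained from the one for powers by
  differentiating the power of \<open>W y + s * W z\<close> at \<open>s = 0\<close>.\<close>

lemma gaussian_integration_by_parts_power:
  assumes "finite K" "\<And>k. k \<in> K \<Longrightarrow> in_Lp 2 quadrant (z k)"
    and x: "in_Lp 2 quadrant x" and "in_Lp 2 quadrant y"
  shows "expectation (\<lambda>\<omega>. W x \<omega> * (\<Prod>k\<in>K. W (z k) \<omega>) * W y \<omega> ^ l) =
    (\<Sum>k\<in>K. ip x (z k) * expectation (\<lambda>\<omega>. (\<Prod>j\<in>K - {k}. W (z j) \<omega>) * W y \<omega> ^ l)) +
    real l * ip x y * expectation (\<lambda>\<omega>. (\<Prod>k\<in>K. W (z k) \<omega>) * W y \<omega> ^ (l - 1))"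
  using assms(1,2,4)
proof (induction K arbitrary: y l rule: finite_induct)
  case empty
  then show ?case using expectation_W_W_power[OF x, of y l] by simp
next
  case (insert j K)
  note y = insert.prems(2)
  have zj: "in_Lp 2 quadrant (z j)" and zK: "\<And>k. k \<in> K \<Longrightarrow> in_Lp 2 quadrant (z k)" using insert.prems by auto
  define P where "P \<omega> = (\<Prod>k\<in>K. W (z k) \<omega>)" for \<omega>
  define Q where "Q k \<omega> = (\<Prod>j\<in>K - {k}. W (z j) \<omega>)" for k \<omega>
  have P: "all_moments M P" unfolding P_def[abs_def] by (intro all_moments_prod all_moments_W zK)
  have Q: "all_moments M (Q k)" for k unfolding Q_def[abs_def] by (intro all_moments_prod all_moments_W zK) auto
  note am = all_moments_power all_moments_add all_moments_cmult all_moments_W all_moments_mult P Q x y zj in_Lp_2_axpy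
  have repl: "expectation (\<lambda>\<omega>. R \<omega> * W (\<lambda>u. y u + s * z j u) \<omega> ^ n) = expectation (\<lambda>\<omega>. R \<omega> * (W y \<omega> + s * W (z j) \<omega>) ^ n)"
    if R: "all_moments M R" for R s n
  proof (rule integral_cong_AE)
    show "AE \<omega> in M. R \<omega> * W (\<lambda>u. y u + s * z j u) \<omega> ^ n = R \<omega> * (W y \<omega> + s * W (z j) \<omega>) ^ n"
      using W_linear[OF y zj, of s] by eventually_elim simp
  qed (intro all_moments_measurable am R)+
  \<comment> \<open>The exponent is raised to \<open>Suc l\<close> because the derivative in
    \<open>s\<close> releases one factor \<open>W (z j)\<close> and leaves the power
    \<open>l\<close> of the claim.\<close>
  have eq: "expectation (\<lambda>\<omega>. (W x \<omega> * P \<omega>) * (W y \<omega> + s * W (z j) \<omega>) ^ Suc l) =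
     (\<Sum>k\<in>K. ip x (z k) * expectation (\<lambda>\<omega>. Q k \<omega> * (W y \<omega> + s * W (z j) \<omega>) ^ Suc l)) +
      real (Suc l) * (ip x y + s * ip x (z j)) * expectation (\<lambda>\<omega>. P \<omega> * (W y \<omega> + s * W (z j) \<omega>) ^ l)" for s
    using insert.IH[OF zK in_Lp_2_axpy[OF y zj, of s], of "Suc l"]
    unfolding P_def[symmetric] Q_def[symmetric] ip_add_right[OF x y zj]
    by (simp add: repl P Q all_moments_mult all_moments_W x del: power_Suc of_nat_Suc)
  have D1: "((\<lambda>s. expectation (\<lambda>\<omega>. (W x \<omega> * P \<omega>) * (W y \<omega> + s * W (z j) \<omega>) ^ Suc l)) has_real_derivative
      real (Suc l) * expectation (\<lambda>\<omega>. (W x \<omega> * P \<omega>) * W (z j) \<omega> * W y \<omega> ^ l)) (at 0)"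
    using DERIV_expectation_power_at_0[of "\<lambda>\<omega>. W x \<omega> * P \<omega>" "W y" "W (z j)" "Suc l"] by (simp add: am del: power_Suc)
  have DQ: "((\<lambda>s. expectation (\<lambda>\<omega>. Q k \<omega> * (W y \<omega> + s * W (z j) \<omega>) ^ Suc l)) has_real_derivative
      real (Suc l) * expectation (\<lambda>\<omega>. Q k \<omega> * W (z j) \<omega> * W y \<omega> ^ l)) (at 0)" for k
    using DERIV_expectation_power_at_0[of "Q k" "W y" "W (z j)" "Suc l"] by (simp add: am del: power_Suc)
  have DP: "((\<lambda>s. expectation (\<lambda>\<omega>. P \<omega> * (W y \<omega> + s * W (z j) \<omega>) ^ l)) has_real_derivative
      real l * expectation (\<lambda>\<omega>. P \<omega> * W (z j) \<omega> * W y \<omega> ^ (l - 1))) (at 0)"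
    using DERIV_expectation_power_at_0[of P "W y" "W (z j)" l] by (simp add: am)
  have Dl: "((\<lambda>s. real (Suc l) * (ip x y + s * ip x (z j))) has_real_derivative real (Suc l) * ip x (z j)) (at 0)"
    by (auto intro!: derivative_eq_intros)
  have D2: "((\<lambda>s. (\<Sum>k\<in>K. ip x (z k) * expectation (\<lambda>\<omega>. Q k \<omega> * (W y \<omega> + s * W (z j) \<omega>) ^ Suc l)) +
      real (Suc l) * (ip x y + s * ip x (z j)) * expectation (\<lambda>\<omega>. P \<omega> * (W y \<omega> + s * W (z j) \<omega>) ^ l)) has_real_derivative
    (\<Sum>k\<in>K. ip x (z k) * (real (Suc l) * expectation (\<lambda>\<omega>. Q k \<omega> * W (z j) \<omega> * W y \<omega> ^ l))) +
    (real (Suc l) * ip x (z j) * expectation (\<lambda>\<omega>. P \<omega> * (W y \<omega> + 0 * W (z j) \<omega>) ^ l) +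
      real l * expectation (\<lambda>\<omega>. P \<omega> * W (z j) \<omega> * W y \<omega> ^ (l - 1)) * (real (Suc l) * (ip x y + 0 * ip x (z j))))) (at 0)"
    by (intro DERIV_add DERIV_sum DERIV_cmult DERIV_mult DQ DP Dl)
  have "real (Suc l) * expectation (\<lambda>\<omega>. (W x \<omega> * P \<omega>) * W (z j) \<omega> * W y \<omega> ^ l) =
    real (Suc l) * ((\<Sum>k\<in>K. ip x (z k) * expectation (\<lambda>\<omega>. Q k \<omega> * W (z j) \<omega> * W y \<omega> ^ l)) +
    ip x (z j) * expectation (\<lambda>\<omega>. P \<omega> * W y \<omega> ^ l) +
      real l * ip x y * expectation (\<lambda>\<omega>. P \<omega> * W (z j) \<omega> * W y \<omega> ^ (l - 1)))"
    using DERIV_unique[OF D1 D2[folded eq]] by (simp add: sum_distrib_left algebra_simps del: of_nat_Suc)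
  then have main: "expectation (\<lambda>\<omega>. (W x \<omega> * P \<omega>) * W (z j) \<omega> * W y \<omega> ^ l) =
    (\<Sum>k\<in>K. ip x (z k) * expectation (\<lambda>\<omega>. Q k \<omega> * W (z j) \<omega> * W y \<omega> ^ l)) +
    ip x (z j) * expectation (\<lambda>\<omega>. P \<omega> * W y \<omega> ^ l) +
      real l * ip x y * expectation (\<lambda>\<omega>. P \<omega> * W (z j) \<omega> * W y \<omega> ^ (l - 1))"
    by (simp del: of_nat_Suc)
  have p1: "(\<Prod>k\<in>insert j K. W (z k) \<omega>) = P \<omega> * W (z j) \<omega>" for \<omega>
    using insert.hyps by (simp add: P_def mult.commute)
  have p2: "(\<Prod>i\<in>insert j K - {k}. W (z i) \<omega>) = Q k \<omega> * W (z j) \<omega>" if "k \<in> K" for k \<omega>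
  proof -
    have "insert j K - {k} = insert j (K - {k})" using that insert.hyps by auto
    then show ?thesis using insert.hyps by (simp add: Q_def mult.commute)
  qed
  have p3: "insert j K - {j} = K" using insert.hyps by auto
  have "(\<Sum>k\<in>insert j K. ip x (z k) * expectation (\<lambda>\<omega>. (\<Prod>i\<in>insert j K - {k}. W (z i) \<omega>) * W y \<omega> ^ l))
      = ip x (z j) * expectation (\<lambda>\<omega>. P \<omega> * W y \<omega> ^ l) + (\<Sum>k\<in>K. ip x (z k) * expectation (\<lambda>\<omega>. Q k \<omega> * W (z j) \<omega> * W y \<omega> ^ l))"
    using insert.hyps by (simp add: p2 p3 P_def)
  then show ?case unfolding p1 using main by (simp add: mult.assoc)
qed

lemma gaussian_integration_by_parts:
  assumes "finite K" "\<And>k. k \<in> K \<Longrightarrow> in_Lp 2 quadrant (z k)" "in_Lp 2 quadrant x"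
  shows "expectation (\<lambda>\<omega>. W x \<omega> * (\<Prod>k\<in>K. W (z k) \<omega>)) =
    (\<Sum>k\<in>K. ip x (z k) * expectation (\<lambda>\<omega>. \<Prod>j\<in>K - {k}. W (z j) \<omega>))"
  using gaussian_integration_by_parts_power[OF assms assms(3), where l=0] by simp

section \<open>Factorization of moments across orthogonal variables\<close>

text \<open>Polynomials in variables \<open>W z\<close> with \<open>z\<close> orthogonal to
  \<open>x\<close>. They take the place of random variables independent of \<open>W x\<close>:
  expectations of products with powers of \<open>W x\<close> factorize, which is proved by induction
  over this class instead of through joint laws.\<close>

inductive orth_poly :: "(real \<times> real \<Rightarrow> real) \<Rightarrow> ('a \<Rightarrow> real) \<Rightarrow> bool" for x where
  orth_poly_const: "orth_poly x (\<lambda>\<omega>. c)"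
| orth_poly_add: "orth_poly x P \<Longrightarrow> orth_poly x Q \<Longrightarrow> orth_poly x (\<lambda>\<omega>. P \<omega> + Q \<omega>)"
| orth_poly_W: "in_Lp 2 quadrant z \<Longrightarrow> ip x z = 0 \<Longrightarrow> orth_poly x Q \<Longrightarrow> orth_poly x (\<lambda>\<omega>. W z \<omega> * Q \<omega>)"

lemma orth_poly_all_moments: "orth_poly x Q \<Longrightarrow> all_moments M Q"
  by (induction rule: orth_poly.induct) (intro all_moments_const all_moments_add all_moments_mult all_moments_W; assumption)+

lemma orth_poly_cmult: "orth_poly x Q \<Longrightarrow> orth_poly x (\<lambda>\<omega>. c * Q \<omega>)"
proof (induction rule: orth_poly.induct)
  case (orth_poly_add P Q)
  then show ?case using orth_poly.orth_poly_add[of x "\<lambda>\<omega>. c * P \<omega>" "\<lambda>\<omega>. c * Q \<omega>"] by (simp add: algebra_simps)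
next
  case (orth_poly_W z Q)
  then show ?case using orth_poly.orth_poly_W[of z x "\<lambda>\<omega>. c * Q \<omega>"] by (simp add: algebra_simps)
qed (rule orth_poly_const)

lemma orth_poly_mult: "orth_poly x P \<Longrightarrow> orth_poly x Q \<Longrightarrow> orth_poly x (\<lambda>\<omega>. P \<omega> * Q \<omega>)"
proof (induction rule: orth_poly.induct)
  case (orth_poly_add P P')
  then show ?case using orth_poly.orth_poly_add[of x "\<lambda>\<omega>. P \<omega> * Q \<omega>" "\<lambda>\<omega>. P' \<omega> * Q \<omega>"] by (simp add: algebra_simps)
next
  case (orth_poly_W z P)
  then show ?case using orth_poly.orth_poly_W[of z x "\<lambda>\<omega>. P \<omega> * Q \<omega>"] by (simp add: algebra_simps)
qed (rule orth_poly_cmult)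

lemma orth_poly_power: "orth_poly x Q \<Longrightarrow> orth_poly x (\<lambda>\<omega>. Q \<omega> ^ n)"
  by (induction n) (auto intro: orth_poly_const orth_poly_mult)

lemma orth_poly_sum: "(\<And>i. i \<in> I \<Longrightarrow> orth_poly x (Q i)) \<Longrightarrow> orth_poly x (\<lambda>\<omega>. \<Sum>i\<in>I. Q i \<omega>)"
  by (induction I rule: infinite_finite_induct) (auto intro: orth_poly_const orth_poly_add)

lemma orth_poly_prod_W:
  "(\<And>i. i \<in> I \<Longrightarrow> in_Lp 2 quadrant (z i) \<and> ip x (z i) = 0) \<Longrightarrow> orth_poly x (\<lambda>\<omega>. \<Prod>i\<in>I. W (z i) \<omega>)"
  by (induction I rule: infinite_finite_induct) (auto intro: orth_poly_const orth_poly_W)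

text \<open>Integration by parts pairs one factor \<open>W x\<close> only with the remaining factors
  \<open>W x\<close>. The exponent thus drops by 2, as in the recursion of
  \<open>gauss_moment\<close>, and the induction is strong.\<close>

lemma expectation_W_power_monomial:
  assumes x: "in_Lp 2 quadrant x" and "finite K" and z: "\<And>k. k \<in> K \<Longrightarrow> in_Lp 2 quadrant (z k) \<and> ip x (z k) = 0"
  shows "expectation (\<lambda>\<omega>. W x \<omega> ^ j * (\<Prod>k\<in>K. W (z k) \<omega>))
    = gauss_moment j (ip x x) * expectation (\<lambda>\<omega>. \<Prod>k\<in>K. W (z k) \<omega>)"
proof (induction j rule: less_induct)
  case (less j)
  show ?case
  proof (cases j)
    case (Suc l)
    have "expectation (\<lambda>\<omega>. W x \<omega> * (\<Prod>k\<in>K. W (z k) \<omega>) * W x \<omega> ^ l)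
       = real l * ip x x * expectation (\<lambda>\<omega>. (\<Prod>k\<in>K. W (z k) \<omega>) * W x \<omega> ^ (l - 1))"
      using gaussian_integration_by_parts_power[OF assms(2) _ x x, of z l] z by simp
    also have "\<dots> = real l * ip x x * (gauss_moment (l - 1) (ip x x) * expectation (\<lambda>\<omega>. \<Prod>k\<in>K. W (z k) \<omega>))"
      using less.IH[of "l - 1"] Suc by (simp add: mult.commute)
    finally show ?thesis by (simp add: Suc gauss_moment_Suc mult_ac)
  qed simp
qed

lemma expectation_W_power_orth_poly:
  assumes x: "in_Lp 2 quadrant x" and Q: "orth_poly x Q"
  shows "expectation (\<lambda>\<omega>. W x \<omega> ^ j * Q \<omega>) = gauss_moment j (ip x x) * expectation Q"
proof -
  \<comment> \<open>The induction peels factors \<open>W z\<close> off the polynomial and collects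
    them in \<open>zs\<close>, until a monomial remains. A list is used because factors may
    repeat.\<close>
  have "expectation (\<lambda>\<omega>. W x \<omega> ^ j * (Q \<omega> * (\<Prod>k<length zs. W (zs ! k) \<omega>)))
      = gauss_moment j (ip x x) * expectation (\<lambda>\<omega>. Q \<omega> * (\<Prod>k<length zs. W (zs ! k) \<omega>))"
    if "\<And>z. z \<in> set zs \<Longrightarrow> in_Lp 2 quadrant z \<and> ip x z = 0" for zs
    using Q that
  proof (induction arbitrary: zs rule: orth_poly.induct)
    case (orth_poly_const c)
    have "expectation (\<lambda>\<omega>. W x \<omega> ^ j * (\<Prod>k<length zs. W (zs ! k) \<omega>))
      = gauss_moment j (ip x x) * expectation (\<lambda>\<omega>. \<Prod>k<length zs. W (zs ! k) \<omega>)"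
      by (rule expectation_W_power_monomial[OF x]) (auto simp: orth_poly_const)
    then show ?case by (simp add: mult.left_commute[of _ c])
  next
    case (orth_poly_add P Q)
    have R: "all_moments M (\<lambda>\<omega>. \<Prod>k<length zs. W (zs ! k) \<omega>)"
      by (intro all_moments_prod all_moments_W) (use orth_poly_add.prems in auto)
    note am = all_moments_integrable all_moments_mult all_moments_power all_moments_W R x
      orth_poly_add.hyps[THEN orth_poly_all_moments]
    have 1: "integrable M (\<lambda>\<omega>. W x \<omega> ^ j * (P \<omega> * (\<Prod>k<length zs. W (zs ! k) \<omega>)))"
      "integrable M (\<lambda>\<omega>. W x \<omega> ^ j * (Q \<omega> * (\<Prod>k<length zs. W (zs ! k) \<omega>)))"
      "integrable M (\<lambda>\<omega>. P \<omega> * (\<Prod>k<length zs. W (zs ! k) \<omega>))"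
      "integrable M (\<lambda>\<omega>. Q \<omega> * (\<Prod>k<length zs. W (zs ! k) \<omega>))"
      by (intro am)+
    show ?case
      using orth_poly_add.IH(1)[OF orth_poly_add.prems] orth_poly_add.IH(2)[OF orth_poly_add.prems] 1
      by (simp add: distrib_left distrib_right)
  next
    case (orth_poly_W z Q)
    have "expectation (\<lambda>\<omega>. W x \<omega> ^ j * (Q \<omega> * (\<Prod>k<length (z # zs). W ((z # zs) ! k) \<omega>)))
      = gauss_moment j (ip x x) * expectation (\<lambda>\<omega>. Q \<omega> * (\<Prod>k<length (z # zs). W ((z # zs) ! k) \<omega>))"
      by (rule orth_poly_W.IH) (use orth_poly_W in auto)
    then show ?case by (simp add: prod.lessThan_Suc_shift mult_ac del: prod.lessThan_Suc)
  qed
  from this[of "[]"] show ?thesis by simp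
qed

end

section \<open>Isometry for elementary integrals\<close>

lemma space_quadrant: "space quadrant = {0<..} \<times> {0<..}"
  by (simp add: quadrant_def space_restrict_space)

lemma sets_quadrant: "A \<in> sets quadrant \<longleftrightarrow> A \<in> sets borel \<and> A \<subseteq> {0<..} \<times> {0<..}"
proof -
  have "({0<..} \<times> {0<..} :: (real \<times> real) set) \<in> sets borel" by (intro borel_open open_Times) auto
  then show ?thesis by (auto simp: quadrant_def sets_restrict_space_iff)
qed

lemma quadrant_open: "({0<..} \<times> {0<..} :: (real \<times> real) set) \<in> sets borel"
  by (intro borel_open open_Times) auto

global_interpretation quadrant: sigma_finite_measure quadrant
  unfolding quadrant_def
  by (rule sigma_finite_measure_restrict_space) (use quadrant_open lborel.sigma_finite_measure_axioms in auto)

global_interpretation qpow: product_sigma_finite "\<lambda>_::nat. quadrant"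
  by unfold_locales

lemma space_quadrant_pow: "space (quadrant_pow n) = {..<n} \<rightarrow>\<^sub>E space quadrant"
  by (simp add: quadrant_pow_def space_PiM)

lemma measurable_component_quadrant_pow [measurable]:
  "i < n \<Longrightarrow> (\<lambda>x. x i) \<in> quadrant_pow n \<rightarrow>\<^sub>M quadrant"
  unfolding quadrant_pow_def by (rule measurable_component_singleton) simp

lemma emeasure_lborel_line:
  "emeasure lborel {p :: real \<times> real. snd p = c} = 0"
proof -
  have "{p :: real \<times> real. snd p = c} = UNIV \<times> {c}" by auto
  then show ?thesis
    using lborel.emeasure_pair_measure_Times[of UNIV lborel "{c} :: real set"] by (simp add: lborel_prod)
qed

lemma AE_quadrant_snd_neq: "AE p in quadrant. snd p \<noteq> c"
proof -
  have "AE p in lborel. snd (p :: real \<times> real) \<noteq> c"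
  proof (rule AE_I[where N="{p. snd p = c}"])
    have "closed {p :: real \<times> real. snd p = c}" by (intro closed_Collect_eq continuous_intros)
    then show "{p :: real \<times> real. snd p = c} \<in> sets lborel" by (simp add: borel_closed)
  qed (auto simp: emeasure_lborel_line)
  then show ?thesis unfolding quadrant_def by (subst AE_restrict_space_iff) (use quadrant_open in auto)
qed

text \<open>For fixed other points, equality of two times confines the point number \<open>i\<close>
  to a line of constant time, a null set. This is why kernels that vanish on the diagonals can
  approximate all others.\<close>

lemma AE_distinct_times: "AE x in quadrant_pow n. \<forall>i<n. \<forall>j<n. i \<noteq> j \<longrightarrow> snd (x i) \<noteq> snd (x j)"
proof -
  have msnd: "snd \<in> quadrant \<rightarrow>\<^sub>M borel"
    unfolding quadrant_def by (intro measurable_restrict_space1) (simp add: borel_measurable_continuous_onI continuous_on_snd)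
  have one: "AE x in quadrant_pow n. snd (x i) \<noteq> snd (x j)" if ij: "i < n" "j < n" "i \<noteq> j" for i j
  proof -
    have [measurable]: "(\<lambda>x. snd (x k)) \<in> borel_measurable (quadrant_pow n)" if "k < n" for k
      using measurable_compose[OF measurable_component_quadrant_pow[OF that] msnd] .
    let ?S = "{x \<in> space (quadrant_pow n). snd (x i) = snd (x j)}"
    have S: "?S \<in> sets (quadrant_pow n)" using ij by measurable
    have I: "{..<n} = insert i ({..<n} - {i})" using ij by auto
    have N: "quadrant_pow n = PiM (insert i ({..<n} - {i})) (\<lambda>_. quadrant)"
      by (simp only: quadrant_pow_def I[symmetric])
    have Sm: "(indicator ?S :: _ \<Rightarrow> ennreal) \<in> borel_measurable (PiM (insert i ({..<n} - {i})) (\<lambda>_. quadrant))"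
      using S unfolding quadrant_pow_def I[symmetric] by (rule borel_measurable_indicator)
    have "emeasure (quadrant_pow n) ?S = (\<integral>\<^sup>+x. indicator ?S x \<partial>PiM (insert i ({..<n} - {i})) (\<lambda>_. quadrant))"
      unfolding N[symmetric] using S by simp
    also have "\<dots> = (\<integral>\<^sup>+x. (\<integral>\<^sup>+y. indicator ?S (x(i := y)) \<partial>quadrant) \<partial>PiM ({..<n} - {i}) (\<lambda>_. quadrant))"
      by (rule qpow.product_nn_integral_insert[OF _ _ Sm]) auto
    also have "\<dots> = (\<integral>\<^sup>+x. 0 \<partial>PiM ({..<n} - {i}) (\<lambda>_. quadrant))"
    proof (rule nn_integral_cong)
      fix x :: "nat \<Rightarrow> real \<times> real"
      have "(\<integral>\<^sup>+y. indicator ?S (x(i := y)) \<partial>quadrant) = (\<integral>\<^sup>+y. 0 \<partial>quadrant)"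
      proof (rule nn_integral_cong_AE)
        show "AE y in quadrant. indicator ?S (x(i := y)) = (0 :: ennreal)"
          using AE_quadrant_snd_neq[of "snd (x j)"] by eventually_elim (use ij in auto)
      qed
      then show "(\<integral>\<^sup>+y. indicator ?S (x(i := y)) \<partial>quadrant) = 0" by simp
    qed
    finally have "emeasure (quadrant_pow n) ?S = 0" by simp
    then show ?thesis using S by (intro AE_I'[where N="?S"]) auto
  qed
  have "AE x in quadrant_pow n. \<forall>i\<in>{..<n}. \<forall>j\<in>{..<n} - {i}. snd (x i) \<noteq> snd (x j)"
    by (intro AE_finite_allI one) auto
  then show ?thesis by eventually_elim auto
qed

section \<open>Permutations of the variables and the symmetrized inner product\<close>

lemma measurable_permute [measurable]:
  assumes "\<sigma> permutes {..<n}"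
  shows "(\<lambda>x. x \<circ> \<sigma>) \<in> quadrant_pow n \<rightarrow>\<^sub>M quadrant_pow n"
  unfolding quadrant_pow_def comp_def
proof (rule measurable_PiM_single')
  fix i assume "i \<in> {..<n}"
  then have "\<sigma> i \<in> {..<n}" using permutes_in_image[OF assms] by blast
  then show "(\<lambda>x. x (\<sigma> i)) \<in> PiM {..<n} (\<lambda>_. quadrant) \<rightarrow>\<^sub>M quadrant" by measurable
next
  show "(\<lambda>x i. x (\<sigma> i)) \<in> space (PiM {..<n} (\<lambda>_. quadrant)) \<rightarrow> ({..<n} \<rightarrow>\<^sub>E space quadrant)"
    using permutes_in_image[OF assms] permutes_not_in[OF assms]
    by (auto simp: space_PiM PiE_iff extensional_def)
qed

text \<open>The product measure is determined by its values on rectangles, and the preimage of a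
  rectangle is the rectangle with the sides permuted by the inverse, which has the same product of
  measures.\<close>

lemma distr_permute:
  assumes \<sigma>: "\<sigma> permutes {..<n}"
  shows "distr (quadrant_pow n) (quadrant_pow n) (\<lambda>x. x \<circ> \<sigma>) = quadrant_pow n"
proof -
  have "distr (quadrant_pow n) (quadrant_pow n) (\<lambda>x. x \<circ> \<sigma>) = PiM {..<n} (\<lambda>_. quadrant)"
  proof (rule qpow.PiM_eqI)
    fix A :: "nat \<Rightarrow> (real \<times> real) set"
    assume A: "\<And>i. i \<in> {..<n} \<Longrightarrow> A i \<in> sets quadrant"
    have inv: "inv \<sigma> permutes {..<n}" by (rule permutes_inv[OF \<sigma>])
    have Ai: "A (inv \<sigma> i) \<in> sets quadrant" if "i \<in> {..<n}" for i
      using A permutes_in_image[OF inv] that by blast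
    have S: "Pi\<^sub>E {..<n} A \<in> sets (quadrant_pow n)"
      unfolding quadrant_pow_def using A by (intro sets_PiM_I_finite) auto
    have "(\<lambda>x. x \<circ> \<sigma>) -` Pi\<^sub>E {..<n} A \<inter> space (quadrant_pow n) = Pi\<^sub>E {..<n} (\<lambda>i. A (inv \<sigma> i))"
    proof (intro set_eqI iffI)
      fix x assume x: "x \<in> (\<lambda>x. x \<circ> \<sigma>) -` Pi\<^sub>E {..<n} A \<inter> space (quadrant_pow n)"
      have "x i \<in> A (inv \<sigma> i)" if "i < n" for i
      proof -
        have "inv \<sigma> i < n" using permutes_in_image[OF inv, of i] that by simp
        then have "(x \<circ> \<sigma>) (inv \<sigma> i) \<in> A (inv \<sigma> i)" using x by (auto simp: PiE_iff)
        then show ?thesis by (simp add: permutes_inverses[OF \<sigma>])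
      qed
      then show "x \<in> Pi\<^sub>E {..<n} (\<lambda>i. A (inv \<sigma> i))" using x by (auto simp: space_quadrant_pow PiE_iff)
    next
      fix x assume x: "x \<in> Pi\<^sub>E {..<n} (\<lambda>i. A (inv \<sigma> i))"
      have "x (\<sigma> i) \<in> A i" if "i < n" for i
      proof -
        have "\<sigma> i < n" using permutes_in_image[OF \<sigma>, of i] that by simp
        then have "x (\<sigma> i) \<in> A (inv \<sigma> (\<sigma> i))" using x by (auto simp: PiE_iff)
        then show ?thesis by (simp add: permutes_inverses[OF \<sigma>])
      qed
      moreover have "x i \<in> space quadrant" if "i < n" for i
        using x that sets.sets_into_space[OF Ai[of i]] by (auto simp: PiE_iff)
      moreover have "x \<in> extensional {..<n}" using x by (simp add: PiE_iff)
      ultimately show "x \<in> (\<lambda>x. x \<circ> \<sigma>) -` Pi\<^sub>E {..<n} A \<inter> space (quadrant_pow n)"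
        using permutes_not_in[OF \<sigma>] by (auto simp: space_quadrant_pow PiE_iff extensional_def)
    qed
    then have "emeasure (distr (quadrant_pow n) (quadrant_pow n) (\<lambda>x. x \<circ> \<sigma>)) (Pi\<^sub>E {..<n} A)
        = emeasure (quadrant_pow n) (Pi\<^sub>E {..<n} (\<lambda>i. A (inv \<sigma> i)))"
      by (simp add: emeasure_distr[OF measurable_permute[OF \<sigma>] S])
    also have "\<dots> = (\<Prod>i<n. emeasure quadrant (A (inv \<sigma> i)))"
      unfolding quadrant_pow_def using Ai by (intro qpow.emeasure_PiM) auto
    also have "\<dots> = (\<Prod>i<n. emeasure quadrant (A i))"
      using prod.permute[OF inv, of "\<lambda>i. emeasure quadrant (A i)"] by (simp add: comp_def)
    finally show "emeasure (distr (quadrant_pow n) (quadrant_pow n) (\<lambda>x. x \<circ> \<sigma>)) (Pi\<^sub>E {..<n} A)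
      = (\<Prod>i<n. emeasure quadrant (A i))" .
  qed (auto simp: quadrant_pow_def)
  then show ?thesis by (simp add: quadrant_pow_def)
qed

lemma integral_permute:
  fixes f :: "(nat \<Rightarrow> real \<times> real) \<Rightarrow> real"
  assumes \<sigma>: "\<sigma> permutes {..<n}" and f: "f \<in> borel_measurable (quadrant_pow n)"
  shows "(\<integral>x. f (x \<circ> \<sigma>) \<partial>quadrant_pow n) = (\<integral>x. f x \<partial>quadrant_pow n)"
  using integral_distr[OF measurable_permute[OF \<sigma>] f] by (simp add: distr_permute[OF \<sigma>])

lemma in_Lp_2_permute:
  assumes \<sigma>: "\<sigma> permutes {..<n}" and f: "in_Lp 2 (quadrant_pow n) f"
  shows "in_Lp 2 (quadrant_pow n) (\<lambda>x. f (x \<circ> \<sigma>))"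
proof -
  have "integrable (distr (quadrant_pow n) (quadrant_pow n) (\<lambda>x. x \<circ> \<sigma>)) (\<lambda>x. (f x)\<^sup>2)"
    using f by (simp add: distr_permute[OF \<sigma>] in_Lp_2_iff)
  then have "integrable (quadrant_pow n) (\<lambda>x. (f (x \<circ> \<sigma>))\<^sup>2)"
    by (rule integrable_distr[OF measurable_permute[OF \<sigma>]])
  moreover have "(\<lambda>x. f (x \<circ> \<sigma>)) \<in> borel_measurable (quadrant_pow n)"
    using measurable_compose[OF measurable_permute[OF \<sigma>]] f by (auto simp: in_Lp_2_iff)
  ultimately show ?thesis by (simp add: in_Lp_2_iff)
qed

lemma AE_permute:
  assumes \<sigma>: "\<sigma> permutes {..<n}" and "AE x in quadrant_pow n. P x"
  shows "AE x in quadrant_pow n. P (x \<circ> \<sigma>)"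
proof -
  have "AE x in distr (quadrant_pow n) (quadrant_pow n) (\<lambda>x. x \<circ> \<sigma>). P x"
    unfolding distr_permute[OF \<sigma>] by (rule assms(2))
  from AE_distrD[OF measurable_permute[OF \<sigma>] this] show ?thesis .
qed

text \<open>This is n! times the inner product of the symmetrizations, hence the covariance of the
  multiple integrals. It suffices to permute one argument.\<close>

definition perm_form :: "nat \<Rightarrow> ((nat \<Rightarrow> real \<times> real) \<Rightarrow> real) \<Rightarrow> ((nat \<Rightarrow> real \<times> real) \<Rightarrow> real) \<Rightarrow> real" where
  "perm_form n f g = (\<Sum>\<sigma>\<in>{\<sigma>. \<sigma> permutes {..<n}}. \<integral>x. f (x \<circ> \<sigma>) * g x \<partial>quadrant_pow n)"

lemma finite_perms: "finite {\<sigma>. \<sigma> permutes {..<n::nat}}"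
  by (rule finite_permutations) simp

lemma perm_form_add_left:
  assumes "in_Lp 2 (quadrant_pow n) f" "in_Lp 2 (quadrant_pow n) g" "in_Lp 2 (quadrant_pow n) h"
  shows "perm_form n (\<lambda>x. c * f x + g x) h = c * perm_form n f h + perm_form n g h"
proof -
  have "(\<integral>x. (c * f (x \<circ> \<sigma>) + g (x \<circ> \<sigma>)) * h x \<partial>quadrant_pow n)
      = c * (\<integral>x. f (x \<circ> \<sigma>) * h x \<partial>quadrant_pow n) + (\<integral>x. g (x \<circ> \<sigma>) * h x \<partial>quadrant_pow n)"
    if "\<sigma> permutes {..<n}" for \<sigma>
    using in_Lp_2_prod_integrable[OF in_Lp_2_permute[OF that assms(1)] assms(3)]
      in_Lp_2_prod_integrable[OF in_Lp_2_permute[OF that assms(2)] assms(3)]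
    by (simp add: distrib_right mult.assoc)
  then show ?thesis by (simp add: perm_form_def sum.distrib sum_distrib_left)
qed

lemma perm_form_add_right:
  assumes "in_Lp 2 (quadrant_pow n) f" "in_Lp 2 (quadrant_pow n) g" "in_Lp 2 (quadrant_pow n) h"
  shows "perm_form n h (\<lambda>x. c * f x + g x) = c * perm_form n h f + perm_form n h g"
proof -
  have "(\<integral>x. h (x \<circ> \<sigma>) * (c * f x + g x) \<partial>quadrant_pow n)
      = c * (\<integral>x. h (x \<circ> \<sigma>) * f x \<partial>quadrant_pow n) + (\<integral>x. h (x \<circ> \<sigma>) * g x \<partial>quadrant_pow n)"
    if "\<sigma> permutes {..<n}" for \<sigma>
    using in_Lp_2_prod_integrable[OF in_Lp_2_permute[OF that assms(3)] assms(1)]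
      in_Lp_2_prod_integrable[OF in_Lp_2_permute[OF that assms(3)] assms(2)]
    by (simp add: distrib_left mult.left_commute)
  then show ?thesis by (simp add: perm_form_def sum.distrib sum_distrib_left)
qed

lemma perm_form_tendsto:
  assumes "Lp_tendsto 2 (quadrant_pow n) F f" "Lp_tendsto 2 (quadrant_pow n) G g"
  shows "(\<lambda>k. perm_form n (F k) (G k)) \<longlonglongrightarrow> perm_form n f g"
  unfolding perm_form_def
proof (intro tendsto_sum Lp_tendsto_2_inner assms(2))
  fix \<sigma> assume "\<sigma> \<in> {\<sigma>. \<sigma> permutes {..<n}}"
  then have \<sigma>: "\<sigma> permutes {..<n}" by simp
  note F = Lp_tendsto_2_D[OF assms(1)]
  have "(\<integral>x. (F k (x \<circ> \<sigma>) - f (x \<circ> \<sigma>))\<^sup>2 \<partial>quadrant_pow n) = (\<integral>x. (F k x - f x)\<^sup>2 \<partial>quadrant_pow n)" for k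
    by (rule integral_permute[OF \<sigma>]) (use in_Lp_2_diff[OF F(1)[of k] F(2)] in \<open>auto simp: in_Lp_2_iff\<close>)
  then show "Lp_tendsto 2 (quadrant_pow n) (\<lambda>k x. F k (x \<circ> \<sigma>)) (\<lambda>x. f (x \<circ> \<sigma>))"
    using F by (simp add: Lp_tendsto_2_iff in_Lp_2_permute[OF \<sigma>])
qed

text \<open>Cauchy-Schwarz for each of the n! permutations, with equality for symmetric kernels. It
  supplies the continuity by which the integral is extended from elementary kernels.\<close>

lemma perm_form_bound:
  assumes f: "in_Lp 2 (quadrant_pow n) f"
  shows "perm_form n f f \<le> fact n * (\<integral>x. (f x)\<^sup>2 \<partial>quadrant_pow n)"
proof -
  have "(\<integral>x. f (x \<circ> \<sigma>) * f x \<partial>quadrant_pow n) \<le> (\<integral>x. (f x)\<^sup>2 \<partial>quadrant_pow n)" if \<sigma>: "\<sigma> permutes {..<n}" for \<sigma>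
  proof -
    have fm: "(\<lambda>x. (f x)\<^sup>2) \<in> borel_measurable (quadrant_pow n)" using f by (auto simp: in_Lp_2_iff)
    have "(\<integral>x. f (x \<circ> \<sigma>) * f x \<partial>quadrant_pow n)\<^sup>2 \<le> (\<integral>x. (f x)\<^sup>2 \<partial>quadrant_pow n)\<^sup>2"
      using Cauchy_Schwarz_in_Lp_2[OF in_Lp_2_permute[OF \<sigma> f] f] integral_permute[OF \<sigma> fm]
      by (simp add: power2_eq_square)
    then show ?thesis by (rule power2_le_imp_le) simp
  qed
  then have "perm_form n f f \<le> (\<Sum>\<sigma>\<in>{\<sigma>. \<sigma> permutes {..<n}}. \<integral>x. (f x)\<^sup>2 \<partial>quadrant_pow n)"
    unfolding perm_form_def by (intro sum_mono) simp
  also have "\<dots> = fact n * (\<integral>x. (f x)\<^sup>2 \<partial>quadrant_pow n)"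
    by (simp add: card_permutations[of "{..<n}" n])
  finally show ?thesis .
qed

text \<open>The symmetrization without the factor 1 / n!.\<close>

definition perm_sum :: "nat \<Rightarrow> ((nat \<Rightarrow> real \<times> real) \<Rightarrow> real) \<Rightarrow> (nat \<Rightarrow> real \<times> real) \<Rightarrow> real" where
  "perm_sum n f x = (\<Sum>\<sigma>\<in>{\<sigma>. \<sigma> permutes {..<n}}. f (x \<circ> \<sigma>))"

lemma in_Lp_2_perm_sum: "in_Lp 2 (quadrant_pow n) f \<Longrightarrow> in_Lp 2 (quadrant_pow n) (perm_sum n f)"
  unfolding perm_sum_def[abs_def] by (intro in_Lp_2_sum in_Lp_2_permute) auto

lemma perm_sum_permute:
  assumes "\<sigma> permutes {..<n}" shows "perm_sum n f (x \<circ> \<sigma>) = perm_sum n f x"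
  unfolding perm_sum_def
  using setum_permutations_compose_left[OF assms, of "\<lambda>\<tau>. f (x \<circ> \<tau>)"] by (simp add: comp_assoc)

lemma perm_form_eq_perm_sum:
  assumes f: "in_Lp 2 (quadrant_pow n) f" and g: "in_Lp 2 (quadrant_pow n) g"
  shows "perm_form n f g = (\<integral>x. perm_sum n f x * g x \<partial>quadrant_pow n)"
  unfolding perm_form_def perm_sum_def sum_distrib_right
  by (subst Bochner_Integration.integral_sum) (auto intro!: in_Lp_2_prod_integrable in_Lp_2_permute f g)

text \<open>\<open>perm_sum n f\<close> is invariant under permutations, so in its squared norm each
  of the n! summands of one factor contributes the same integral. Hence \<open>perm_form\<close> is
  nonnegative on the diagonal and vanishes there exactly if the symmetrization is null.\<close>

lemma perm_form_perm_sum: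
  assumes f: "in_Lp 2 (quadrant_pow n) f"
  shows "fact n * perm_form n f f = (\<integral>x. (perm_sum n f x)\<^sup>2 \<partial>quadrant_pow n)"
proof -
  note S = in_Lp_2_perm_sum[OF f]
  have "(\<integral>x. (perm_sum n f x)\<^sup>2 \<partial>quadrant_pow n)
      = (\<integral>x. (\<Sum>\<sigma>\<in>{\<sigma>. \<sigma> permutes {..<n}}. perm_sum n f x * f (x \<circ> \<sigma>)) \<partial>quadrant_pow n)"
    unfolding power2_eq_square sum_distrib_left[symmetric] by (simp add: perm_sum_def[of n f])
  also have "\<dots> = (\<Sum>\<sigma>\<in>{\<sigma>. \<sigma> permutes {..<n}}. \<integral>x. perm_sum n f x * f (x \<circ> \<sigma>) \<partial>quadrant_pow n)"
    by (rule Bochner_Integration.integral_sum) (auto intro!: in_Lp_2_prod_integrable in_Lp_2_permute f S)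
  also have "\<dots> = (\<Sum>\<sigma>\<in>{\<sigma>. \<sigma> permutes {..<n}}. perm_form n f f)"
  proof (rule sum.cong[OF refl])
    fix \<sigma> assume "\<sigma> \<in> {\<sigma>. \<sigma> permutes {..<n}}"
    then have \<sigma>: "\<sigma> permutes {..<n}" by simp
    have "(\<integral>x. perm_sum n f x * f (x \<circ> \<sigma>) \<partial>quadrant_pow n)
        = (\<integral>x. perm_sum n f (x \<circ> \<sigma>) * f (x \<circ> \<sigma>) \<partial>quadrant_pow n)" by (simp add: perm_sum_permute[OF \<sigma>])
    also have "\<dots> = (\<integral>x. perm_sum n f x * f x \<partial>quadrant_pow n)"
      by (rule integral_permute[OF \<sigma>]) (use S f in \<open>auto simp: in_Lp_2_iff\<close>)
    finally show "(\<integral>x. perm_sum n f x * f (x \<circ> \<sigma>) \<partial>quadrant_pow n) = perm_form n f f"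
      by (simp add: perm_form_eq_perm_sum[OF f f])
  qed
  finally show ?thesis by (simp add: card_permutations[of "{..<n}" n])
qed

lemma perm_form_eq_0_iff:
  assumes f: "in_Lp 2 (quadrant_pow n) f"
  shows "perm_form n f f = 0 \<longleftrightarrow> (AE x in quadrant_pow n. perm_sum n f x = 0)"
proof -
  have "perm_form n f f = 0 \<longleftrightarrow> (\<integral>x. (perm_sum n f x)\<^sup>2 \<partial>quadrant_pow n) = 0"
    using perm_form_perm_sum[OF f] by (metis fact_nonzero mult_eq_0_iff)
  also have "\<dots> \<longleftrightarrow> (AE x in quadrant_pow n. (perm_sum n f x)\<^sup>2 = 0)"
    using in_Lp_2_perm_sum[OF f] by (intro integral_nonneg_eq_0_iff_AE) (auto simp: in_Lp_2_iff)
  finally show ?thesis by simp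
qed

section \<open>Rectangles and elementary kernels\<close>

definition rect_fun :: "nat \<Rightarrow> (nat \<Rightarrow> (real \<times> real) set) \<Rightarrow> (nat \<Rightarrow> real \<times> real) \<Rightarrow> real" where
  "rect_fun n A x = (\<Prod>i<n. indicator (A i) (x i))"

definition fin_side :: "(real \<times> real) set \<Rightarrow> bool" where
  "fin_side A \<longleftrightarrow> A \<in> sets quadrant \<and> emeasure quadrant A < \<infinity>"

lemma fin_side_Int: "fin_side A \<Longrightarrow> B \<in> sets quadrant \<Longrightarrow> fin_side (A \<inter> B)"
  unfolding fin_side_def by (auto intro: le_less_trans[OF emeasure_mono[of "A \<inter> B" A]])

lemma fin_side_subset: "fin_side A \<Longrightarrow> B \<subseteq> A \<Longrightarrow> B \<in> sets quadrant \<Longrightarrow> fin_side B"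
  using fin_side_Int[of A B] by (simp add: Int_absorb1)

lemma fin_side_integrable: "fin_side A \<Longrightarrow> integrable quadrant (indicator A :: _ \<Rightarrow> real)"
  by (auto simp: fin_side_def)

lemma in_Lp_2_indicator: "fin_side A \<Longrightarrow> in_Lp 2 quadrant (indicator A)"
proof -
  have "(indicator A x :: real)\<^sup>2 = indicator A x" for x by (simp add: indicator_def)
  then show "fin_side A \<Longrightarrow> in_Lp 2 quadrant (indicator A)"
    using fin_side_integrable[of A] by (simp add: in_Lp_2_iff)
qed

lemma ip_indicator: "fin_side A \<Longrightarrow> fin_side B \<Longrightarrow> ip (indicator A) (indicator B) = measure quadrant (A \<inter> B)"
  using sets.sets_into_space[of A quadrant]
  by (auto simp: ip_def fin_side_def indicator_inter_arith[symmetric] Int_absorb1 inf_assoc)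

lemma in_Lp_2_rect_fun:
  assumes "\<And>i. i < n \<Longrightarrow> fin_side (A i)"
  shows "in_Lp 2 (quadrant_pow n) (rect_fun n A)"
proof -
  have "(rect_fun n A x)\<^sup>2 = rect_fun n A x" for x
    unfolding rect_fun_def prod_power_distrib by (intro prod.cong) (auto simp: indicator_def)
  moreover have "integrable (quadrant_pow n) (rect_fun n A)"
    unfolding quadrant_pow_def rect_fun_def[abs_def]
    by (rule qpow.product_integrable_prod) (auto intro!: fin_side_integrable assms)
  ultimately show ?thesis by (simp add: in_Lp_2_iff)
qed

lemma rect_fun_permute_mult:
  assumes "\<sigma> permutes {..<n}"
  shows "rect_fun n A (x \<circ> \<sigma>) * rect_fun n B x = rect_fun n (\<lambda>i. A (inv \<sigma> i) \<inter> B i) x"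
proof -
  have "rect_fun n A (x \<circ> \<sigma>) = (\<Prod>i<n. indicator (A (inv \<sigma> i)) (x i))"
    using prod.permute[OF assms, of "\<lambda>i. indicator (A (inv \<sigma> i)) (x i) :: real"]
    by (simp add: rect_fun_def comp_def permutes_inverses[OF assms])
  then show ?thesis by (simp add: rect_fun_def prod.distrib[symmetric] indicator_inter_arith)
qed

text \<open>Integrals of products over the product space factorize. The result is the permanent of
  the matrix of inner products of the sides, the shape in which Wick's formula delivers the
  covariance.\<close>

lemma perm_form_rect_fun:
  assumes A: "\<And>i. i < n \<Longrightarrow> fin_side (A i)" and B: "\<And>i. i < n \<Longrightarrow> fin_side (B i)"
  shows "perm_form n (rect_fun n A) (rect_fun n B)
    = (\<Sum>\<sigma>\<in>{\<sigma>. \<sigma> permutes {..<n}}. \<Prod>i<n. ip (indicator (A i)) (indicator (B (\<sigma> i))))"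
  unfolding perm_form_def
proof (rule sum.cong[OF refl])
  fix \<sigma> assume "\<sigma> \<in> {\<sigma>. \<sigma> permutes {..<n}}"
  then have \<sigma>: "\<sigma> permutes {..<n}" by simp
  have inv: "inv \<sigma> i < n \<longleftrightarrow> i < n" and s: "\<sigma> i < n \<longleftrightarrow> i < n" for i
    using permutes_in_image[OF permutes_inv[OF \<sigma>], of i] permutes_in_image[OF \<sigma>, of i] by auto
  have "(\<integral>x. rect_fun n A (x \<circ> \<sigma>) * rect_fun n B x \<partial>quadrant_pow n)
      = (\<Prod>i<n. \<integral>y. indicator (A (inv \<sigma> i) \<inter> B i) y \<partial>quadrant)"
    unfolding rect_fun_permute_mult[OF \<sigma>] unfolding quadrant_pow_def rect_fun_def
    by (rule qpow.product_integral_prod) (auto intro!: fin_side_integrable fin_side_Int A simp: inv B[unfolded fin_side_def])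
  also have "\<dots> = (\<Prod>i<n. ip (indicator (A (inv \<sigma> i))) (indicator (B i)))"
    by (intro prod.cong refl) (simp add: ip_def indicator_inter_arith)
  also have "\<dots> = (\<Prod>i<n. ip (indicator (A i)) (indicator (B (\<sigma> i))))"
    using prod.permute[OF \<sigma>, of "\<lambda>i. ip (indicator (A (inv \<sigma> i))) (indicator (B i))"]
    by (simp add: comp_def permutes_inverses[OF \<sigma>])
  finally show "(\<integral>x. rect_fun n A (x \<circ> \<sigma>) * rect_fun n B x \<partial>quadrant_pow n)
      = (\<Prod>i<n. ip (indicator (A i)) (indicator (B (\<sigma> i))))" .
qed

lemma elementary_fun_Nil: "elementary_fun n [] x = 0"
  by (simp add: elementary_fun_def)

lemma elementary_fun_Cons: "elementary_fun n ((c, A) # L) x = c * rect_fun n A x + elementary_fun n L x"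
  by (simp add: elementary_fun_def rect_fun_def)

lemma elementary_fun_append: "elementary_fun n (L @ L') x = elementary_fun n L x + elementary_fun n L' x"
  by (simp add: elementary_fun_def)

lemma elementary_fun_scale:
  "elementary_fun n (map (\<lambda>(c, A). (a * c, A)) L) x = a * elementary_fun n L x"
  by (induction L) (auto simp: elementary_fun_def algebra_simps)

lemma elementary_integral_append:
  "elementary_integral W n (L @ L') x = elementary_integral W n L x + elementary_integral W n L' x"
  by (simp add: elementary_integral_def)

lemma elementary_integral_scale:
  "elementary_integral W n (map (\<lambda>(c, A). (a * c, A)) L) x = a * elementary_integral W n L x"
  by (induction L) (auto simp: elementary_integral_def algebra_simps)

lemma is_elementary_Nil: "is_elementary n []"
  by (simp add: is_elementary_def)

lemma is_elementary_Cons: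
  "is_elementary n ((c, A) # L) \<longleftrightarrow> (\<forall>i<n. fin_side (A i)) \<and> disjoint_family_on A {..<n} \<and> is_elementary n L"
  by (auto simp: is_elementary_def fin_side_def)

lemma is_elementary_append: "is_elementary n (L @ L') \<longleftrightarrow> is_elementary n L \<and> is_elementary n L'"
  by (auto simp: is_elementary_def)

lemma is_elementary_scale: "is_elementary n L \<Longrightarrow> is_elementary n (map (\<lambda>(c, A). (a * c, A)) L)"
  by (auto simp: is_elementary_def)

lemma in_Lp_2_elementary_fun: "is_elementary n L \<Longrightarrow> in_Lp 2 (quadrant_pow n) (elementary_fun n L)"
proof (induction L)
  case Nil
  then show ?case by (simp add: elementary_fun_Nil[abs_def] in_Lp_2_zero)
next
  case (Cons a L)
  obtain c A where a: "a = (c, A)" by (cases a)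
  have "in_Lp 2 (quadrant_pow n) (\<lambda>x. c * rect_fun n A x + elementary_fun n L x)"
    using Cons a by (intro in_Lp_2_add in_Lp_2_cmult in_Lp_2_rect_fun) (auto simp: is_elementary_Cons)
  then show ?case by (simp add: a elementary_fun_Cons[abs_def])
qed

section \<open>Permanents, Wick's formula and the isometry\<close>

text \<open>Extensionality outside \<open>I\<close> makes the set finite and lets every bijection
  from \<open>I\<close> to \<open>J\<close> be counted once.\<close>

definition bijs :: "'i set \<Rightarrow> 'i set \<Rightarrow> ('i \<Rightarrow> 'i) set" where
  "bijs I J = {\<pi> \<in> I \<rightarrow>\<^sub>E J. bij_betw \<pi> I J}"

text \<open>Expansion of a permanent along the row \<open>i0\<close>: a bijection amounts to the
  image \<open>j\<close> of \<open>i0\<close> together with its restriction to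
  \<open>I\<close>.\<close>

lemma sum_bijs_insert:
  fixes c :: "'i \<Rightarrow> 'i \<Rightarrow> real"
  assumes "finite I" "finite J" "i0 \<notin> I"
  shows "(\<Sum>\<pi>\<in>bijs (insert i0 I) J. \<Prod>i\<in>insert i0 I. c i (\<pi> i))
    = (\<Sum>j\<in>J. c i0 j * (\<Sum>\<pi>\<in>bijs I (J - {j}). \<Prod>i\<in>I. c i (\<pi> i)))"
proof -
  have fin: "finite (bijs I K)" if "finite K" for K
    unfolding bijs_def by (rule finite_subset[OF _ finite_PiE[of I "\<lambda>_. K"]]) (use that assms in auto)
  have "(\<Sum>j\<in>J. c i0 j * (\<Sum>\<pi>\<in>bijs I (J - {j}). \<Prod>i\<in>I. c i (\<pi> i)))
      = (\<Sum>(j, \<pi>)\<in>Sigma J (\<lambda>j. bijs I (J - {j})). c i0 j * (\<Prod>i\<in>I. c i (\<pi> i)))"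
    unfolding sum_distrib_left by (rule sum.Sigma) (use assms fin in auto)
  also have "\<dots> = (\<Sum>\<pi>\<in>bijs (insert i0 I) J. \<Prod>i\<in>insert i0 I. c i (\<pi> i))"
  proof (rule sum.reindex_bij_witness[where i="\<lambda>\<pi>. (\<pi> i0, \<pi>(i0 := undefined))" and j="\<lambda>(j, \<pi>). \<pi>(i0 := j)"])
    fix p assume p: "p \<in> Sigma J (\<lambda>j. bijs I (J - {j}))"
    obtain j \<pi> where jp: "p = (j, \<pi>)" by (cases p)
    have j: "j \<in> J" and \<pi>: "\<pi> \<in> I \<rightarrow>\<^sub>E (J - {j})" "bij_betw \<pi> I (J - {j})" using p by (auto simp: jp bijs_def)
    have u: "\<pi> i0 = undefined" using \<pi>(1) assms(3) by (auto simp: PiE_iff extensional_def)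
    then show "(((case p of (j, \<pi>) \<Rightarrow> \<pi>(i0 := j)) i0, (case p of (j, \<pi>) \<Rightarrow> \<pi>(i0 := j))(i0 := undefined))) = p"
      by (auto simp: jp)
    have "bij_betw (\<pi>(i0 := j)) I (J - {j})"
      by (rule bij_betw_cong[THEN iffD1, OF _ \<pi>(2)]) (use assms(3) in auto)
    then have "bij_betw (\<pi>(i0 := j)) (I \<union> {i0}) ((J - {j}) \<union> {j})"
      by (rule bij_betw_combine) (auto simp: bij_betw_def)
    moreover have "(J - {j}) \<union> {j} = J" using j by auto
    ultimately show "(case p of (j, \<pi>) \<Rightarrow> \<pi>(i0 := j)) \<in> bijs (insert i0 I) J"
      using \<pi>(1) j by (auto simp: jp bijs_def PiE_iff extensional_def)
    show "(\<Prod>i\<in>insert i0 I. c i ((case p of (j, \<pi>) \<Rightarrow> \<pi>(i0 := j)) i)) = (case p of (j, \<pi>) \<Rightarrow> c i0 j * (\<Prod>i\<in>I. c i (\<pi> i)))"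
      using assms by (auto simp: jp intro!: arg_cong2[where f="(*)"] prod.cong)
  next
    fix \<pi> assume "\<pi> \<in> bijs (insert i0 I) J"
    then have \<pi>: "\<pi> \<in> insert i0 I \<rightarrow>\<^sub>E J" "bij_betw \<pi> (insert i0 I) J" by (auto simp: bijs_def)
    show "(case (\<pi> i0, \<pi>(i0 := undefined)) of (j, \<pi>) \<Rightarrow> \<pi>(i0 := j)) = \<pi>" by simp
    have "bij_betw \<pi> I (J - {\<pi> i0})"
      using bij_betw_DiffI[OF \<pi>(2) bij_betw_singletonI[of \<pi> i0 "\<pi> i0"]] \<pi>(1) assms(3) by (auto simp: PiE_iff)
    then have "bij_betw (\<pi>(i0 := undefined)) I (J - {\<pi> i0})"
      by (rule bij_betw_cong[THEN iffD1, rotated]) (use assms(3) in auto)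
    then show "(\<pi> i0, \<pi>(i0 := undefined)) \<in> Sigma J (\<lambda>j. bijs I (J - {j}))"
      using \<pi>(1) assms(3) unfolding bijs_def bij_betw_def by (auto simp: PiE_iff extensional_def)
  qed
  finally show ?thesis by simp
qed

text \<open>The two encodings differ only outside \<open>{..<n}\<close>: \<open>undefined\<close> on
  one side, the identity on the other.\<close>

lemma sum_bijs_permutes:
  "(\<Sum>\<pi>\<in>bijs {..<n} {..<n}. \<Prod>i<n. c i (\<pi> i)) = (\<Sum>\<sigma>\<in>{\<sigma>. \<sigma> permutes {..<n::nat}}. \<Prod>i<n. c i (\<sigma> i) :: real)"
proof (rule sum.reindex_bij_witness[where j="\<lambda>\<pi> i. if i < n then \<pi> i else i" and i="\<lambda>\<sigma>. restrict \<sigma> {..<n}"])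
  fix \<pi> assume "\<pi> \<in> bijs {..<n} {..<n}"
  then have \<pi>: "\<pi> \<in> {..<n} \<rightarrow>\<^sub>E {..<n}" "bij_betw \<pi> {..<n} {..<n}" by (auto simp: bijs_def)
  show "restrict (\<lambda>i. if i < n then \<pi> i else i) {..<n} = \<pi>"
    using \<pi>(1) by (auto simp: fun_eq_iff PiE_iff extensional_def)
  show "(\<lambda>i. if i < n then \<pi> i else i) \<in> {\<sigma>. \<sigma> permutes {..<n}}"
    unfolding mem_Collect_eq
  proof (rule bij_imp_permutes)
    show "bij_betw (\<lambda>i. if i < n then \<pi> i else i) {..<n} {..<n}"
      by (rule bij_betw_cong[THEN iffD1, OF _ \<pi>(2)]) simp
  qed simp
  show "(\<Prod>i<n. c i (if i < n then \<pi> i else i)) = (\<Prod>i<n. c i (\<pi> i))" by (intro prod.cong) auto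
next
  fix \<sigma> assume "\<sigma> \<in> {\<sigma>. \<sigma> permutes {..<n}}"
  then have \<sigma>: "\<sigma> permutes {..<n}" by simp
  show "(\<lambda>i. if i < n then restrict \<sigma> {..<n} i else i) = \<sigma>"
    using permutes_not_in[OF \<sigma>] by (auto simp: fun_eq_iff)
  show "restrict \<sigma> {..<n} \<in> bijs {..<n} {..<n}"
    using permutes_imp_bij[OF \<sigma>] permutes_in_image[OF \<sigma>] unfolding bijs_def
    by (auto intro!: bij_betw_cong[THEN iffD1, of "{..<n}" \<sigma>])
qed

context isonormal_process
begin

text \<open>Wick's formula for two orthogonal families. Integration by parts on
  \<open>W (a i0)\<close> leaves only pairings with the second family, and the induction turns them
  into complete pairings between the two. If \<open>I\<close> is empty and \<open>J\<close> is not,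
  integration by parts inside \<open>J\<close> gives 0.\<close>

lemma expectation_prod_W_prod_W:
  assumes "finite I" "finite J"
    and "\<And>i. i \<in> I \<Longrightarrow> in_Lp 2 quadrant (a i)" "\<And>j. j \<in> J \<Longrightarrow> in_Lp 2 quadrant (b j)"
    and "\<And>i j. i \<in> I \<Longrightarrow> j \<in> I \<Longrightarrow> i \<noteq> j \<Longrightarrow> ip (a i) (a j) = 0"
    and "\<And>i j. i \<in> J \<Longrightarrow> j \<in> J \<Longrightarrow> i \<noteq> j \<Longrightarrow> ip (b i) (b j) = 0"
  shows "expectation (\<lambda>\<omega>. (\<Prod>i\<in>I. W (a i) \<omega>) * (\<Prod>j\<in>J. W (b j) \<omega>))
    = (\<Sum>\<pi>\<in>bijs I J. \<Prod>i\<in>I. ip (a i) (b (\<pi> i)))"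
  using assms
proof (induction I arbitrary: J rule: finite_induct)
  case empty
  show ?case
  proof (cases "J = {}")
    case True
    have "bijs {} ({} :: 'b set) = {\<lambda>_. undefined}" by (auto simp: bijs_def bij_betw_def)
    then show ?thesis using True by (simp add: prob_space)
  next
    case False
    then obtain j where j: "j \<in> J" by blast
    have "expectation (\<lambda>\<omega>. \<Prod>j\<in>J. W (b j) \<omega>) = expectation (\<lambda>\<omega>. W (b j) \<omega> * (\<Prod>j\<in>J - {j}. W (b j) \<omega>))"
      using j empty(1) by (simp add: prod.remove)
    also have "\<dots> = (\<Sum>k\<in>J - {j}. ip (b j) (b k) * expectation (\<lambda>\<omega>. \<Prod>i\<in>J - {j} - {k}. W (b i) \<omega>))"
      by (rule gaussian_integration_by_parts) (use empty j in auto)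
    also have "\<dots> = 0" using empty(5) j by (intro sum.neutral) auto
    finally have "expectation (\<lambda>\<omega>. \<Prod>j\<in>J. W (b j) \<omega>) = 0" .
    moreover have "bijs {} J = {}" using False by (auto simp: bijs_def bij_betw_def)
    ultimately show ?thesis by simp
  qed
next
  case (insert i0 I)
  \<comment> \<open>The disjoint sum merges the two families into one, as integration by parts
    requires, and keeps equal indices apart.\<close>
  define z where "z = case_sum a b"
  have "expectation (\<lambda>\<omega>. (\<Prod>i\<in>insert i0 I. W (a i) \<omega>) * (\<Prod>j\<in>J. W (b j) \<omega>))
      = expectation (\<lambda>\<omega>. W (a i0) \<omega> * (\<Prod>k\<in>I <+> J. W (z k) \<omega>))"
    using insert.hyps insert.prems(1) by (simp add: prod.Plus z_def mult.assoc)
  also have "\<dots> = (\<Sum>k\<in>I <+> J. ip (a i0) (z k) * expectation (\<lambda>\<omega>. \<Prod>l\<in>I <+> J - {k}. W (z l) \<omega>))"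
    by (rule gaussian_integration_by_parts) (use insert.hyps(1) insert.prems(1-3) in \<open>auto simp: z_def\<close>)
  also have "\<dots> = (\<Sum>i\<in>I. ip (a i0) (a i) * expectation (\<lambda>\<omega>. \<Prod>l\<in>I <+> J - {Inl i}. W (z l) \<omega>))
      + (\<Sum>j\<in>J. ip (a i0) (b j) * expectation (\<lambda>\<omega>. \<Prod>l\<in>I <+> J - {Inr j}. W (z l) \<omega>))"
    using insert.hyps insert.prems(1) by (simp add: sum.Plus z_def)
  also have "(\<Sum>i\<in>I. ip (a i0) (a i) * expectation (\<lambda>\<omega>. \<Prod>l\<in>I <+> J - {Inl i}. W (z l) \<omega>)) = 0"
    using insert.prems(4) insert.hyps by (intro sum.neutral) auto
  also have "(\<Sum>j\<in>J. ip (a i0) (b j) * expectation (\<lambda>\<omega>. \<Prod>l\<in>I <+> J - {Inr j}. W (z l) \<omega>))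
      = (\<Sum>j\<in>J. ip (a i0) (b j) * (\<Sum>\<pi>\<in>bijs I (J - {j}). \<Prod>i\<in>I. ip (a i) (b (\<pi> i))))"
  proof (intro sum.cong refl arg_cong2[where f="(*)"])
    fix j assume j: "j \<in> J"
    have "I <+> J - {Inr j} = I <+> (J - {j})" by auto
    then have "expectation (\<lambda>\<omega>. \<Prod>l\<in>I <+> J - {Inr j}. W (z l) \<omega>)
        = expectation (\<lambda>\<omega>. (\<Prod>i\<in>I. W (a i) \<omega>) * (\<Prod>j\<in>J - {j}. W (b j) \<omega>))"
      using insert.hyps insert.prems(1) by (simp add: prod.Plus z_def)
    also have "\<dots> = (\<Sum>\<pi>\<in>bijs I (J - {j}). \<Prod>i\<in>I. ip (a i) (b (\<pi> i)))"
      by (rule insert.IH) (use insert.prems in auto)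
    finally show "expectation (\<lambda>\<omega>. \<Prod>l\<in>I <+> J - {Inr j}. W (z l) \<omega>) = (\<Sum>\<pi>\<in>bijs I (J - {j}). \<Prod>i\<in>I. ip (a i) (b (\<pi> i)))" .
  qed
  finally show ?case
    using sum_bijs_insert[OF insert.hyps(1) insert.prems(1) insert.hyps(2), of "\<lambda>i j. ip (a i) (b j)"] by simp
qed

definition rect_rv :: "nat \<Rightarrow> (nat \<Rightarrow> (real \<times> real) set) \<Rightarrow> 'a \<Rightarrow> real" where
  "rect_rv n A \<omega> = (\<Prod>i<n. W (indicator (A i)) \<omega>)"

lemma all_moments_rect_rv: "(\<And>i. i < n \<Longrightarrow> fin_side (A i)) \<Longrightarrow> all_moments M (rect_rv n A)"
  unfolding rect_rv_def[abs_def] by (intro all_moments_prod all_moments_W in_Lp_2_indicator) auto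

lemma elementary_integral_Nil: "elementary_integral W n [] \<omega> = 0"
  by (simp add: elementary_integral_def)

lemma elementary_integral_Cons:
  "elementary_integral W n ((c, A) # L) \<omega> = c * rect_rv n A \<omega> + elementary_integral W n L \<omega>"
  by (simp add: elementary_integral_def rect_rv_def)

lemma all_moments_elementary_integral: "is_elementary n L \<Longrightarrow> all_moments M (elementary_integral W n L)"
proof (induction L)
  case Nil
  then show ?case by (simp add: elementary_integral_Nil[abs_def] all_moments_const)
next
  case (Cons a L)
  obtain c A where a: "a = (c, A)" by (cases a)
  have "all_moments M (\<lambda>x. c * rect_rv n A x + elementary_integral W n L x)"
    using Cons a by (intro all_moments_add all_moments_cmult all_moments_rect_rv) (auto simp: is_elementary_Cons)
  then show ?case by (simp add: a elementary_integral_Cons[abs_def])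
qed

text \<open>Disjoint sides are orthogonal, so Wick's formula applies. Index sets of different size
  admit no bijection, which makes integrals of different orders orthogonal.\<close>

lemma expectation_rect_rv_mult:
  assumes A: "\<And>i. i < n \<Longrightarrow> fin_side (A i)" "disjoint_family_on A {..<n}"
    and B: "\<And>i. i < m \<Longrightarrow> fin_side (B i)" "disjoint_family_on B {..<m}"
  shows "expectation (\<lambda>\<omega>. rect_rv n A \<omega> * rect_rv m B \<omega>)
    = (if n = m then perm_form n (rect_fun n A) (rect_fun n B) else 0)"
proof -
  have "expectation (\<lambda>\<omega>. rect_rv n A \<omega> * rect_rv m B \<omega>)
      = (\<Sum>\<pi>\<in>bijs {..<n} {..<m}. \<Prod>i<n. ip (indicator (A i)) (indicator (B (\<pi> i))))"
    unfolding rect_rv_def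
  proof (rule expectation_prod_W_prod_W)
    fix i j assume "i \<in> {..<n}" "j \<in> {..<n}" "i \<noteq> j"
    moreover from this have "A i \<inter> A j = {}" using A(2) by (auto simp: disjoint_family_on_def)
    ultimately show "ip (indicator (A i)) (indicator (A j)) = 0" using A(1) by (simp add: ip_indicator)
  next
    fix i j assume "i \<in> {..<m}" "j \<in> {..<m}" "i \<noteq> j"
    moreover from this have "B i \<inter> B j = {}" using B(2) by (auto simp: disjoint_family_on_def)
    ultimately show "ip (indicator (B i)) (indicator (B j)) = 0" using B(1) by (simp add: ip_indicator)
  qed (use A(1) B(1) in_Lp_2_indicator in auto)
  also have "\<dots> = (if n = m then perm_form n (rect_fun n A) (rect_fun n B) else 0)"
  proof (cases "n = m")
    case True
    have "(\<Sum>\<pi>\<in>bijs {..<n} {..<n}. \<Prod>i<n. ip (indicator (A i)) (indicator (B (\<pi> i))))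
        = perm_form n (rect_fun n A) (rect_fun n B)"
      unfolding sum_bijs_permutes[of "\<lambda>i j. ip (indicator (A i)) (indicator (B j))" n]
      by (rule perm_form_rect_fun[symmetric]) (use A(1) B(1) True in auto)
    then show ?thesis using True by simp
  next
    case False
    have "\<pi> \<notin> bijs {..<n} {..<m}" for \<pi>
    proof
      assume "\<pi> \<in> bijs {..<n} {..<m}"
      then have "bij_betw \<pi> {..<n} {..<m}" by (simp add: bijs_def)
      from bij_betw_same_card[OF this] False show "False" by simp
    qed
    then have "bijs {..<n} {..<m} = {}" by blast
    then show ?thesis using False by simp
  qed
  finally show ?thesis .
qed

lemma perm_form_zero: "perm_form n f (\<lambda>x. 0) = 0" "perm_form n (\<lambda>x. 0) f = 0"
  by (simp_all add: perm_form_def)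

lemma expectation_elementary_integral_mult:
  assumes L: "is_elementary n L" and K: "is_elementary m K"
  shows "expectation (\<lambda>\<omega>. elementary_integral W n L \<omega> * elementary_integral W m K \<omega>)
    = (if n = m then perm_form n (elementary_fun n L) (elementary_fun n K) else 0)"
proof -
  have 1: "expectation (\<lambda>\<omega>. rect_rv n A \<omega> * elementary_integral W m K \<omega>)
      = (if n = m then perm_form n (rect_fun n A) (elementary_fun n K) else 0)"
    if A: "\<forall>i<n. fin_side (A i)" "disjoint_family_on A {..<n}" for A
    using K
  proof (induction K)
    case Nil
    then show ?case by (simp add: elementary_integral_Nil elementary_fun_Nil[abs_def] perm_form_zero)
  next
    case (Cons a K)
    obtain c B where a: "a = (c, B)" by (cases a)
    have B: "\<forall>i<m. fin_side (B i)" "disjoint_family_on B {..<m}" and K: "is_elementary m K"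
      using Cons.prems by (auto simp: a is_elementary_Cons)
    have i: "integrable M (\<lambda>\<omega>. rect_rv n A \<omega> * rect_rv m B \<omega>)"
      "integrable M (\<lambda>\<omega>. rect_rv n A \<omega> * elementary_integral W m K \<omega>)"
      by (intro all_moments_integrable all_moments_mult all_moments_rect_rv all_moments_elementary_integral;
          use A B K in simp)+
    have "expectation (\<lambda>\<omega>. rect_rv n A \<omega> * elementary_integral W m (a # K) \<omega>)
       = expectation (\<lambda>\<omega>. c * (rect_rv n A \<omega> * rect_rv m B \<omega>) + rect_rv n A \<omega> * elementary_integral W m K \<omega>)"
      by (simp add: a elementary_integral_Cons algebra_simps)
    also have "\<dots> = c * expectation (\<lambda>\<omega>. rect_rv n A \<omega> * rect_rv m B \<omega>)
        + expectation (\<lambda>\<omega>. rect_rv n A \<omega> * elementary_integral W m K \<omega>)"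
      using i by simp
    finally show ?case
      using Cons.IH[OF K] expectation_rect_rv_mult[of n A m B] A B K
      by (auto simp: a elementary_fun_Cons[abs_def] perm_form_add_right in_Lp_2_rect_fun in_Lp_2_elementary_fun)
  qed
  show ?thesis using L
  proof (induction L)
    case Nil
    then show ?case by (simp add: elementary_integral_Nil elementary_fun_Nil[abs_def] perm_form_zero)
  next
    case (Cons a L)
    obtain c A where a: "a = (c, A)" by (cases a)
    have A: "\<forall>i<n. fin_side (A i)" "disjoint_family_on A {..<n}" and L: "is_elementary n L"
      using Cons.prems by (auto simp: a is_elementary_Cons)
    have i: "integrable M (\<lambda>\<omega>. rect_rv n A \<omega> * elementary_integral W m K \<omega>)"
      "integrable M (\<lambda>\<omega>. elementary_integral W n L \<omega> * elementary_integral W m K \<omega>)"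
      by (intro all_moments_integrable all_moments_mult all_moments_rect_rv all_moments_elementary_integral;
          use A L K in simp)+
    have "expectation (\<lambda>\<omega>. elementary_integral W n (a # L) \<omega> * elementary_integral W m K \<omega>)
       = expectation (\<lambda>\<omega>. c * (rect_rv n A \<omega> * elementary_integral W m K \<omega>)
          + elementary_integral W n L \<omega> * elementary_integral W m K \<omega>)"
      by (simp add: a elementary_integral_Cons algebra_simps)
    also have "\<dots> = c * expectation (\<lambda>\<omega>. rect_rv n A \<omega> * elementary_integral W m K \<omega>)
        + expectation (\<lambda>\<omega>. elementary_integral W n L \<omega> * elementary_integral W m K \<omega>)"
      using i by simp
    finally show ?case
      using Cons.IH[OF L] 1[OF A] A L K
      by (auto simp: a elementary_fun_Cons[abs_def] perm_form_add_left in_Lp_2_rect_fun in_Lp_2_elementary_fun)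
  qed
qed

end

section \<open>Multiple integrals of square integrable kernels\<close>

text \<open>Density is phrased by distances, which makes closure under limits in the square mean
  immediate; sequences are recovered when the integral is built.\<close>

definition approximable :: "nat \<Rightarrow> ((nat \<Rightarrow> real \<times> real) \<Rightarrow> real) \<Rightarrow> bool" where
  "approximable n f \<longleftrightarrow> in_Lp 2 (quadrant_pow n) f \<and>
     (\<forall>e>0. \<exists>L. is_elementary n L \<and> (\<integral>x. (elementary_fun n L x - f x)\<^sup>2 \<partial>quadrant_pow n) < e)"

lemma approximable_Lp_tendsto:
  assumes "approximable n f"
  shows "\<exists>L. (\<forall>k. is_elementary n (L k)) \<and> Lp_tendsto 2 (quadrant_pow n) (\<lambda>k. elementary_fun n (L k)) f"
  by (rule Lp_tendsto_2_closure) (use assms in \<open>auto simp: approximable_def intro: in_Lp_2_elementary_fun\<close>)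

lemma approximable_elementary: "is_elementary n L \<Longrightarrow> approximable n (elementary_fun n L)"
  unfolding approximable_def by (auto intro!: in_Lp_2_elementary_fun exI[of _ L])

lemma approximable_limit:
  assumes X: "\<And>k. approximable n (X k)" and lim: "Lp_tendsto 2 (quadrant_pow n) X f"
  shows "approximable n f"
  unfolding approximable_def
proof (intro conjI allI impI)
  note D = Lp_tendsto_2_D[OF lim]
  show "in_Lp 2 (quadrant_pow n) f" by (rule D)
  fix e :: real assume "e > 0"
  then have "e / 4 > 0" by simp
  from order_tendstoD(2)[OF D(3) this] obtain k where k: "(\<integral>x. (X k x - f x)\<^sup>2 \<partial>quadrant_pow n) < e / 4"
    by (auto simp: eventually_sequentially)
  from X[of k] \<open>e / 4 > 0\<close> obtain L where L: "is_elementary n L"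
    "(\<integral>x. (elementary_fun n L x - X k x)\<^sup>2 \<partial>quadrant_pow n) < e / 4"
    unfolding approximable_def by blast
  have "(\<integral>x. (elementary_fun n L x - f x)\<^sup>2 \<partial>quadrant_pow n) < e"
    using in_Lp_2_norm_triangle[OF in_Lp_2_elementary_fun[OF L(1)] D(1)[of k] D(2)] k L(2) by simp
  then show "\<exists>L. is_elementary n L \<and> (\<integral>x. (elementary_fun n L x - f x)\<^sup>2 \<partial>quadrant_pow n) < e"
    using L(1) by blast
qed

lemma approximable_axpy:
  assumes "approximable n f" "approximable n g"
  shows "approximable n (\<lambda>x. a * f x + g x)"
proof -
  obtain L K where L: "\<And>k. is_elementary n (L k)" "Lp_tendsto 2 (quadrant_pow n) (\<lambda>k. elementary_fun n (L k)) f"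
    and K: "\<And>k. is_elementary n (K k)" "Lp_tendsto 2 (quadrant_pow n) (\<lambda>k. elementary_fun n (K k)) g"
    using approximable_Lp_tendsto[OF assms(1)] approximable_Lp_tendsto[OF assms(2)] by blast
  let ?J = "\<lambda>k. map (\<lambda>(c, A). (a * c, A)) (L k) @ K k"
  show ?thesis
  proof (rule approximable_limit[where X="\<lambda>k. elementary_fun n (?J k)"])
    show "approximable n (elementary_fun n (?J k))" for k
      by (intro approximable_elementary) (simp add: is_elementary_append is_elementary_scale L K)
    show "Lp_tendsto 2 (quadrant_pow n) (\<lambda>k. elementary_fun n (?J k)) (\<lambda>x. a * f x + g x)"
      unfolding elementary_fun_append[abs_def] elementary_fun_scale
      by (intro Lp_tendsto_2_add Lp_tendsto_2_cmult L K)
  qed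
qed

lemma approximable_zero: "approximable n (\<lambda>x. 0)"
  using approximable_elementary[OF is_elementary_Nil] by (simp add: elementary_fun_Nil[abs_def])

lemma approximable_add: "approximable n f \<Longrightarrow> approximable n g \<Longrightarrow> approximable n (\<lambda>x. f x + g x)"
  using approximable_axpy[of n f g 1] by simp

lemma approximable_cmult: "approximable n f \<Longrightarrow> approximable n (\<lambda>x. a * f x)"
  using approximable_axpy[of n f "\<lambda>x. 0" a] approximable_zero by simp

lemma approximable_sum:
  "(\<And>i. i \<in> I \<Longrightarrow> approximable n (f i)) \<Longrightarrow> approximable n (\<lambda>x. \<Sum>i\<in>I. f i x)"
  by (induction I rule: infinite_finite_induct) (auto intro: approximable_zero approximable_add)

lemma approximable_cong:
  assumes f: "approximable n f" and eq: "\<And>x. x \<in> space (quadrant_pow n) \<Longrightarrow> f x = g x"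
  shows "approximable n g"
proof (rule approximable_limit[where X="\<lambda>_. f"])
  have L: "in_Lp 2 (quadrant_pow n) f" using f by (simp add: approximable_def)
  then have g: "g \<in> borel_measurable (quadrant_pow n)"
    using measurable_cong[of "quadrant_pow n" f g borel] eq by (simp add: in_Lp_2_iff)
  show "Lp_tendsto 2 (quadrant_pow n) (\<lambda>_. f) g"
    by (rule Lp_tendsto_2_cong_AE[OF Lp_tendsto_2_const[OF L]])
      (use L g eq in \<open>auto simp: in_Lp_2_iff\<close>)
qed (rule f)

section \<open>Density of the elementary kernels\<close>

text \<open>As soon as \<open>2 ^ k * \<bar>a - b\<bar> > 1\<close>, the scaled numbers have
  different integer parts.\<close>

lemma eventually_distinct_dyadic_cells:
  fixes a b :: real
  assumes "0 < a" "0 < b" "a \<noteq> b"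
  shows "\<forall>\<^sub>F k in sequentially. nat \<lfloor>2 ^ k * a\<rfloor> \<noteq> nat \<lfloor>2 ^ k * b\<rfloor>"
proof -
  have *: "\<forall>\<^sub>F k in sequentially. nat \<lfloor>2 ^ k * a\<rfloor> \<noteq> nat \<lfloor>2 ^ k * b\<rfloor>" if ab: "0 < a" "a < b" for a b :: real
  proof -
    obtain N where N: "1 / (b - a) < 2 ^ N" using real_arch_pow[of 2 "1 / (b - a)"] by auto
    have "nat \<lfloor>2 ^ k * a\<rfloor> \<noteq> nat \<lfloor>2 ^ k * b\<rfloor>" if "k \<ge> N" for k
    proof -
      have "1 / (b - a) < 2 ^ k" by (rule less_le_trans[OF N]) (use that in simp)
      then have "1 + 2 ^ k * a < 2 ^ k * b" using ab by (simp add: field_simps)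
      then have "\<lfloor>2 ^ k * a\<rfloor> < \<lfloor>2 ^ k * b\<rfloor>" by linarith
      moreover have "0 \<le> \<lfloor>2 ^ k * a\<rfloor>" using ab by simp
      ultimately show ?thesis by linarith
    qed
    then show ?thesis by (auto simp: eventually_sequentially)
  qed
  show ?thesis
  proof (cases "a < b")
    case True
    then show ?thesis using *[of a b] assms by simp
  next
    case False
    then show ?thesis using *[of b a] assms by (simp add: eq_commute)
  qed
qed

definition corner_box :: "real \<Rightarrow> (real \<times> real) set" where
  "corner_box R = {0<..R} \<times> {0<..R}"

lemma fin_side_box: "fin_side (corner_box R)"
proof -
  have b: "corner_box R \<in> sets borel"
    unfolding corner_box_def borel_prod[symmetric] by (intro pair_measureI) auto
  have "emeasure quadrant (corner_box R) = emeasure lborel (corner_box R)"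
    unfolding quadrant_def by (rule emeasure_restrict_space) (use quadrant_open in \<open>auto simp: corner_box_def\<close>)
  also have "\<dots> < \<infinity>"
    unfolding corner_box_def by (intro emeasure_bounded_finite bounded_Times) (auto intro: bounded_subset[OF bounded_cbox[of 0 R]])
  finally show ?thesis using b by (auto simp: fin_side_def sets_quadrant corner_box_def)
qed

text \<open>Only time is subdivided: almost every point of the product has pairwise distinct times,
  so time slabs suffice to separate the variables.\<close>

definition cell :: "nat \<Rightarrow> real \<times> real \<Rightarrow> nat" where
  "cell k p = nat \<lfloor>2 ^ k * snd p\<rfloor>"

lemma sets_cell: "{p \<in> space quadrant. cell k p = l} \<in> sets quadrant"
proof -
  have [measurable]: "snd \<in> quadrant \<rightarrow>\<^sub>M borel"
    unfolding quadrant_def by (intro measurable_restrict_space1) (simp add: borel_measurable_continuous_onI continuous_on_snd)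
  have [measurable]: "cell k \<in> quadrant \<rightarrow>\<^sub>M count_space UNIV" unfolding cell_def by measurable
  show ?thesis by measurable
qed

lemma rect_fun_cases:
  "rect_fun n A x = (if \<forall>i<n. x i \<in> A i then 1 else 0)"
  unfolding rect_fun_def by (induction n) (auto simp: less_Suc_eq)

text \<open>The rectangle is cut into products of time slabs of width \<open>1 / 2 ^ k\<close>, and
  the products with a repeated slab are dropped, so that the remaining ones have disjoint sides.
  What is dropped disappears eventually at every point with distinct times, and the rectangle itself
  dominates.\<close>

lemma approximable_rect_fun:
  assumes A: "\<And>i. i < n \<Longrightarrow> A i \<in> sets quadrant" and AR: "\<And>i. i < n \<Longrightarrow> A i \<subseteq> corner_box R"
  shows "approximable n (rect_fun n A)"
proof -
  define C where "C k l = {p \<in> space quadrant. cell k p = l}" for k l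
  \<comment> \<open>The index of the last slab that can meet the box; it keeps the choices of slabs
    finite in number.\<close>
  define m where "m k = nat \<lfloor>2 ^ k * R\<rfloor>" for k
  define F where "F k = {\<phi> \<in> {..<n} \<rightarrow>\<^sub>E {..m k}. inj_on \<phi> {..<n}}" for k
  define h where "h k x = (\<Sum>\<phi>\<in>F k. rect_fun n (\<lambda>i. A i \<inter> C k (\<phi> i)) x)" for k x
  have finF: "finite (F k)" for k
    unfolding F_def by (rule finite_subset[OF _ finite_PiE[of "{..<n}" "\<lambda>_. {..m k}"]]) auto
  have Afin: "fin_side (A i)" if "i < n" for i
    by (rule fin_side_subset[OF fin_side_box AR[OF that] A[OF that]])
  have approx: "approximable n (h k)" for k
  proof -
    obtain ps where ps: "set ps = F k" "distinct ps" using finite_distinct_list[OF finF] by blast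
    let ?L = "map (\<lambda>\<phi>. (1 :: real, \<lambda>i. A i \<inter> C k (\<phi> i))) ps"
    have el: "is_elementary n ?L"
      unfolding is_elementary_def
    proof (safe)
      fix c B assume "(c, B) \<in> set ?L"
      then obtain \<phi> where \<phi>: "\<phi> \<in> F k" and B: "B = (\<lambda>i. A i \<inter> C k (\<phi> i))" using ps by auto
      show "B i \<in> sets quadrant" "emeasure quadrant (B i) < \<infinity>" if "i < n" for i
        using fin_side_Int[OF Afin[OF that] sets_cell[of k "\<phi> i"]] by (auto simp: B C_def fin_side_def)
      show "disjoint_family_on B {..<n}"
        using \<phi> by (auto simp: disjoint_family_on_def B C_def F_def inj_on_def)
    qed
    have "elementary_fun n ?L x = h k x" for x
    proof -
      have "elementary_fun n ?L x = (\<Sum>\<phi>\<leftarrow>ps. rect_fun n (\<lambda>i. A i \<inter> C k (\<phi> i)) x)"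
        by (simp add: elementary_fun_def rect_fun_def comp_def)
      then show ?thesis using ps by (simp add: h_def sum_list_distinct_conv_sum_set)
    qed
    then have "elementary_fun n ?L = h k" by auto
    with approximable_elementary[OF el] show ?thesis by simp
  qed
  \<comment> \<open>At a point of the rectangle only one choice of slabs counts, namely
    \<open>\<psi>\<close>, that of its own coordinates. It belongs to \<open>F k\<close> exactly if
    these slabs are distinct.\<close>
  have hx: "h k x = (if inj_on (\<lambda>i. cell k (x i)) {..<n} then rect_fun n A x else 0)"
    if x: "x \<in> space (quadrant_pow n)" for k x
  proof (cases "\<forall>i<n. x i \<in> A i")
    case False
    then have "rect_fun n A x = 0" "rect_fun n (\<lambda>i. A i \<inter> C k (\<phi> i)) x = 0" for \<phi>
      by (auto simp: rect_fun_cases)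
    then show ?thesis by (simp add: h_def)
  next
    case True
    define \<psi> where "\<psi> = restrict (\<lambda>i. cell k (x i)) {..<n}"
    have "rect_fun n (\<lambda>i. A i \<inter> C k (\<phi> i)) x = (if \<phi> = \<psi> then 1 else 0)" if "\<phi> \<in> F k" for \<phi>
    proof -
      have "(\<forall>i<n. x i \<in> C k (\<phi> i)) \<longleftrightarrow> (\<forall>i<n. \<phi> i = cell k (x i))"
        using x by (auto simp: C_def space_quadrant_pow PiE_iff)
      also have "\<dots> \<longleftrightarrow> \<phi> = \<psi>"
        using that by (auto simp: F_def \<psi>_def fun_eq_iff PiE_iff extensional_def)
      finally show ?thesis using True by (auto simp: rect_fun_cases)
    qed
    then have "h k x = (\<Sum>\<phi>\<in>F k. if \<phi> = \<psi> then 1 else 0)" by (simp add: h_def)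
    also have "\<dots> = (if \<psi> \<in> F k then 1 else 0)" using finF by simp
    also have "\<psi> \<in> F k \<longleftrightarrow> inj_on (\<lambda>i. cell k (x i)) {..<n}"
    proof -
      have "cell k (x i) \<le> m k" if "i < n" for i
      proof -
        have "x i \<in> corner_box R" using True AR that by blast
        then have "2 ^ k * snd (x i) \<le> 2 ^ k * R" by (auto simp: corner_box_def)
        then show ?thesis unfolding cell_def m_def by (intro nat_mono floor_mono)
      qed
      moreover have "inj_on \<psi> {..<n} \<longleftrightarrow> inj_on (\<lambda>i. cell k (x i)) {..<n}"
        unfolding \<psi>_def by (rule inj_on_restrict_eq)
      ultimately show ?thesis by (auto simp: F_def \<psi>_def)
    qed
    finally show ?thesis using True by (simp add: rect_fun_cases)
  qed
  have "Lp_tendsto 2 (quadrant_pow n) h (rect_fun n A)"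
  proof (rule Lp_tendsto_2_dominated)
    show "h k \<in> borel_measurable (quadrant_pow n)" for k
      using approx[of k] by (simp add: approximable_def in_Lp_2_iff)
    show "in_Lp 2 (quadrant_pow n) (rect_fun n A)" "in_Lp 2 (quadrant_pow n) (rect_fun n A)"
      by (intro in_Lp_2_rect_fun Afin; simp)+
    show "AE x in quadrant_pow n. \<bar>h k x\<bar> \<le> \<bar>rect_fun n A x\<bar>" for k
      by (rule AE_I2) (simp add: hx)
    show "AE x in quadrant_pow n. (\<lambda>k. h k x) \<longlonglongrightarrow> rect_fun n A x"
      using AE_distinct_times[of n] AE_space
    proof eventually_elim
      case (elim x)
      have "\<forall>\<^sub>F k in sequentially. \<forall>i\<in>{..<n}. \<forall>j\<in>{..<n} - {i}. cell k (x i) \<noteq> cell k (x j)"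
      proof (intro eventually_ball_finite ballI)
        fix i j assume ij: "i \<in> {..<n}" "j \<in> {..<n} - {i}"
        have "x i \<in> space quadrant" "x j \<in> space quadrant" using elim(2) ij by (auto simp: space_quadrant_pow PiE_iff)
        then have "0 < snd (x i)" "0 < snd (x j)" by (auto simp: space_quadrant)
        moreover have "snd (x i) \<noteq> snd (x j)" using elim(1) ij by auto
        ultimately show "\<forall>\<^sub>F k in sequentially. cell k (x i) \<noteq> cell k (x j)"
          unfolding cell_def by (rule eventually_distinct_dyadic_cells)
      qed auto
      then have "\<forall>\<^sub>F k in sequentially. h k x = rect_fun n A x"
      proof eventually_elim
        case (elim k)
        then have "inj_on (\<lambda>i. cell k (x i)) {..<n}" by (auto simp: inj_on_def)
        then show ?case using hx[OF \<open>x \<in> space (quadrant_pow n)\<close>] by simp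
      qed
      then show ?case by (rule tendsto_eventually)
    qed
  qed
  then show ?thesis by (rule approximable_limit[OF approx])
qed

definition box_pow :: "nat \<Rightarrow> real \<Rightarrow> (nat \<Rightarrow> real \<times> real) set" where
  "box_pow n R = {..<n} \<rightarrow>\<^sub>E corner_box R"

lemma sets_box_pow: "box_pow n R \<in> sets (quadrant_pow n)"
  unfolding box_pow_def quadrant_pow_def
  using fin_side_box[of R] by (intro sets_PiM_I_finite) (auto simp: fin_side_def)

text \<open>Dynkin's argument on the generating rectangles. The fixed box keeps all sets of finite
  measure, so that complements and countable disjoint unions stay square integrable.\<close>

lemma approximable_indicator:
  assumes "E \<in> sets (quadrant_pow n)"
  shows "approximable n (indicator (E \<inter> box_pow n R))"
proof -
  let ?G = "prod_algebra {..<n} (\<lambda>_. quadrant)"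
  let ?O = "{..<n} \<rightarrow>\<^sub>E space quadrant"
  have sub: "box_pow n R \<subseteq> ?O"
    unfolding box_pow_def using sets.sets_into_space[of "corner_box R" quadrant] fin_side_box[of R]
    by (intro PiE_mono) (auto simp: fin_side_def)
  have corner_box: "approximable n (indicator (box_pow n R))"
  proof (rule approximable_cong[OF approximable_rect_fun[of n "\<lambda>_. corner_box R" R]])
    show "rect_fun n (\<lambda>_. corner_box R) x = indicator (box_pow n R) x" if "x \<in> space (quadrant_pow n)" for x
      using that by (auto simp: rect_fun_cases box_pow_def space_quadrant_pow PiE_iff indicator_def)
  qed (use fin_side_box[of R] in \<open>auto simp: fin_side_def\<close>)
  then have boxL: "in_Lp 2 (quadrant_pow n) (indicator (box_pow n R))" by (simp add: approximable_def)
  have sets: "sigma_sets ?O ?G = sets (quadrant_pow n)" by (simp add: quadrant_pow_def sets_PiM)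
  have "E \<in> sigma_sets ?O ?G" using assms sets by simp
  from Int_stable_prod_algebra prod_algebra_sets_into_space this show ?thesis
  proof (induction E rule: sigma_sets_induct_disjoint)
    case (basic E)
    then obtain X where X: "E = Pi\<^sub>E {..<n} X" "\<And>i. i < n \<Longrightarrow> X i \<in> sets quadrant"
      by (auto simp: prod_algebra_eq_finite Pi_iff)
    show ?case
    proof (rule approximable_cong[OF approximable_rect_fun[of n "\<lambda>i. X i \<inter> corner_box R" R]])
      show "rect_fun n (\<lambda>i. X i \<inter> corner_box R) x = indicator (E \<inter> box_pow n R) x" if "x \<in> space (quadrant_pow n)" for x
        using that by (auto simp: X(1) rect_fun_cases box_pow_def space_quadrant_pow PiE_iff indicator_def)
    qed (use X(2) fin_side_box[of R] in \<open>auto simp: fin_side_def\<close>)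
  next
    case empty
    then show ?case using approximable_zero by (simp add: indicator_def[abs_def])
  next
    case (compl E)
    have "approximable n (\<lambda>x. (-1) * indicator (E \<inter> box_pow n R) x + indicator (box_pow n R) x)"
      by (intro approximable_axpy corner_box compl(2))
    then show ?case by (rule approximable_cong) (use sub in \<open>auto simp: indicator_def\<close>)
  next
    case (union E)
    let ?E = "\<Union>i. E i"
    have m: "E i \<in> sets (quadrant_pow n)" for i using union(2) unfolding sets by auto
    show ?case
    proof (rule approximable_limit[where X="\<lambda>k x. \<Sum>i<k. indicator (E i \<inter> box_pow n R) x"])
      show "approximable n (\<lambda>x. \<Sum>i<k. indicator (E i \<inter> box_pow n R) x)" for k
        by (intro approximable_sum union(3))
      have s: "(\<Sum>i<k. indicator (E i \<inter> box_pow n R) x) = (indicator ((\<Union>i<k. E i) \<inter> box_pow n R) x :: real)" for k x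
      proof -
        have "disjoint_family_on (\<lambda>i. E i \<inter> box_pow n R) {..<k}"
          using union(1) by (auto simp: disjoint_family_on_def)
        then have "indicator (\<Union>i<k. E i \<inter> box_pow n R) x = (\<Sum>i<k. indicator (E i \<inter> box_pow n R) x :: real)"
          by (intro indicator_UN_disjoint) auto
        then show ?thesis by simp
      qed
      show "Lp_tendsto 2 (quadrant_pow n) (\<lambda>k x. \<Sum>i<k. indicator (E i \<inter> box_pow n R) x) (indicator (?E \<inter> box_pow n R))"
        unfolding s
      proof (rule Lp_tendsto_2_dominated[OF _ _ boxL])
        show "(\<lambda>x. indicator ((\<Union>i<k. E i) \<inter> box_pow n R) x :: real) \<in> borel_measurable (quadrant_pow n)" for k
          using m sets_box_pow by (intro borel_measurable_indicator sets.Int sets.finite_UN) auto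
        have "(indicator (?E \<inter> box_pow n R) :: _ \<Rightarrow> real) \<in> borel_measurable (quadrant_pow n)"
          using m sets_box_pow by (intro borel_measurable_indicator sets.Int sets.countable_UN) auto
        then show "in_Lp 2 (quadrant_pow n) (indicator (?E \<inter> box_pow n R))"
          by (rule in_Lp_2_bound[OF boxL]) (auto simp: indicator_def)
        show "AE x in quadrant_pow n. \<bar>indicator ((\<Union>i<k. E i) \<inter> box_pow n R) x\<bar> \<le> \<bar>indicator (box_pow n R) x :: real\<bar>" for k
          by (auto simp: indicator_def)
        show "AE x in quadrant_pow n. (\<lambda>k. indicator ((\<Union>i<k. E i) \<inter> box_pow n R) x :: real) \<longlonglongrightarrow> indicator (?E \<inter> box_pow n R) x"
        proof (rule AE_I2)
          fix x
          show "(\<lambda>k. indicator ((\<Union>i<k. E i) \<inter> box_pow n R) x :: real) \<longlonglongrightarrow> indicator (?E \<inter> box_pow n R) x"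
          proof (cases "x \<in> ?E")
            case True
            then obtain i where "x \<in> E i" by blast
            then have "\<forall>k\<ge>Suc i. (indicator ((\<Union>i<k. E i) \<inter> box_pow n R) x :: real) = indicator (?E \<inter> box_pow n R) x"
              by (auto simp: indicator_def Suc_le_eq)
            then show ?thesis by (intro tendsto_eventually) (auto simp: eventually_sequentially)
          next
            case False
            then have "(indicator ((\<Union>i<k. E i) \<inter> box_pow n R) x :: real) = indicator (?E \<inter> box_pow n R) x" for k
              by (auto simp: indicator_def)
            then show ?thesis by simp
          qed
        qed
      qed
    qed
  qed
qed

text \<open>Simple functions dominated by \<open>2 * \<bar>f x\<bar>\<close> converge pointwise to
  \<open>f\<close>; cutting them to growing boxes makes their level sets accessible to
  \<open>approximable_indicator\<close>.\<close>

theorem approximable_in_Lp_2: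
  assumes f: "in_Lp 2 (quadrant_pow n) f"
  shows "approximable n f"
proof -
  have fm: "f \<in> borel_measurable (quadrant_pow n)" using f by (simp add: in_Lp_2_iff)
  from borel_measurable_implies_sequence_metric[OF fm, of 0] obtain F
    where "\<forall>i. simple_function (quadrant_pow n) (F i)"
      "\<forall>x\<in>space (quadrant_pow n). (\<lambda>i. F i x) \<longlonglongrightarrow> f x"
      "\<forall>i. \<forall>x\<in>space (quadrant_pow n). dist (F i x) 0 \<le> 2 * dist (f x) 0" by blast
  then have F: "\<And>i. simple_function (quadrant_pow n) (F i)"
      "\<And>x. x \<in> space (quadrant_pow n) \<Longrightarrow> (\<lambda>i. F i x) \<longlonglongrightarrow> f x"
      "\<And>i x. x \<in> space (quadrant_pow n) \<Longrightarrow> \<bar>F i x\<bar> \<le> 2 * \<bar>f x\<bar>"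
    by (auto simp: dist_real_def)
  let ?X = "\<lambda>i x. F i x * indicator (box_pow n (real i)) x"
  show ?thesis
  proof (rule approximable_limit[where X="?X"])
    fix i
    let ?S = "\<lambda>y. F i -` {y} \<inter> space (quadrant_pow n)"
    have fin: "finite (F i ` space (quadrant_pow n))" and S: "?S y \<in> sets (quadrant_pow n)" for y
      using simple_functionD[OF F(1)[of i]] by auto
    have "approximable n (\<lambda>x. \<Sum>y\<in>F i ` space (quadrant_pow n). y * indicator (?S y \<inter> box_pow n (real i)) x)"
      by (intro approximable_sum approximable_cmult approximable_indicator S)
    then show "approximable n (?X i)"
    proof (rule approximable_cong)
      fix x assume x: "x \<in> space (quadrant_pow n)"
      have "(\<Sum>y\<in>F i ` space (quadrant_pow n). y * indicator (?S y \<inter> box_pow n (real i)) x)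
          = (\<Sum>y\<in>F i ` space (quadrant_pow n). if y = F i x then F i x * indicator (box_pow n (real i)) x else 0)"
        using x by (intro sum.cong refl) (auto simp: indicator_def)
      also have "\<dots> = ?X i x" using x fin by (simp add: sum.delta)
      finally show "(\<Sum>y\<in>F i ` space (quadrant_pow n). y * indicator (?S y \<inter> box_pow n (real i)) x) = ?X i x" .
    qed
  next
    show "Lp_tendsto 2 (quadrant_pow n) ?X f"
    proof (rule Lp_tendsto_2_dominated[OF _ f in_Lp_2_cmult[OF f, of 2]])
      show "?X k \<in> borel_measurable (quadrant_pow n)" for k
        using borel_measurable_simple_function[OF F(1)[of k]] sets_box_pow[of n "real k"] by auto
      show "AE x in quadrant_pow n. \<bar>?X k x\<bar> \<le> \<bar>2 * f x\<bar>" for k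
        using F(3)[of _ k] by (auto simp: indicator_def abs_mult)
      show "AE x in quadrant_pow n. (\<lambda>k. ?X k x) \<longlonglongrightarrow> f x"
      proof (rule AE_I2)
        fix x assume x: "x \<in> space (quadrant_pow n)"
        \<comment> \<open>\<open>m\<close> bounds all coordinates of the point, so that the box of
          side \<open>k\<close> contains it as soon as \<open>k \<ge> m\<close>.\<close>
        define m where "m = (\<Sum>i<n. \<bar>fst (x i)\<bar> + \<bar>snd (x i)\<bar>)"
        have "\<forall>\<^sub>F k in sequentially. F k x = ?X k x"
          unfolding eventually_sequentially
        proof (intro exI allI impI)
          fix k assume k: "nat \<lceil>m\<rceil> \<le> k"
          have "x i \<in> corner_box (real k)" if i: "i < n" for i
          proof -
            have "\<bar>fst (x i)\<bar> + \<bar>snd (x i)\<bar> \<le> m"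
              unfolding m_def by (rule member_le_sum[of i "{..<n}" "\<lambda>i. \<bar>fst (x i)\<bar> + \<bar>snd (x i)\<bar>"]) (use i in auto)
            also have "m \<le> real k" using k by linarith
            finally have le: "\<bar>fst (x i)\<bar> + \<bar>snd (x i)\<bar> \<le> real k" .
            have "x i \<in> space quadrant" using x i by (auto simp: space_quadrant_pow PiE_iff)
            then show ?thesis using le by (auto simp: space_quadrant corner_box_def mem_Times_iff)
          qed
          then have "x \<in> box_pow n (real k)" using x by (auto simp: box_pow_def space_quadrant_pow PiE_iff)
          then show "F k x = ?X k x" by simp
        qed
        then show "(\<lambda>k. ?X k x) \<longlonglongrightarrow> f x" by (rule Lim_transform_eventually[OF F(2)[OF x]])
      qed
    qed
  qed
qed

section \<open>Isometry, uniqueness and existence of the multiple integral\<close>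

context isonormal_process
begin

lemma has_wiener_integral_in_Lp_2:
  assumes "has_wiener_integral M W n f X"
  shows "in_Lp 2 (quadrant_pow n) f" "in_Lp 2 M X"
  using assms by (auto simp: has_wiener_integral_def dest: Lp_tendsto_2_D)

lemma wiener_integral_inner:
  assumes "has_wiener_integral M W n f X" "has_wiener_integral M W m g Y"
  shows "expectation (\<lambda>\<omega>. X \<omega> * Y \<omega>) = (if n = m then perm_form n f g else 0)"
proof -
  obtain L K where L: "\<And>k. is_elementary n (L k)" "Lp_tendsto 2 (quadrant_pow n) (\<lambda>k. elementary_fun n (L k)) f"
      "Lp_tendsto 2 M (\<lambda>k. elementary_integral W n (L k)) X"
    and K: "\<And>k. is_elementary m (K k)" "Lp_tendsto 2 (quadrant_pow m) (\<lambda>k. elementary_fun m (K k)) g"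
      "Lp_tendsto 2 M (\<lambda>k. elementary_integral W m (K k)) Y"
    using assms unfolding has_wiener_integral_def by blast
  have 1: "(\<lambda>k. expectation (\<lambda>\<omega>. elementary_integral W n (L k) \<omega> * elementary_integral W m (K k) \<omega>))
      \<longlonglongrightarrow> expectation (\<lambda>\<omega>. X \<omega> * Y \<omega>)"
    by (rule Lp_tendsto_2_inner[OF L(3) K(3)])
  show ?thesis
  proof (cases "n = m")
    case True
    have "(\<lambda>k. perm_form n (elementary_fun n (L k)) (elementary_fun n (K k))) \<longlonglongrightarrow> expectation (\<lambda>\<omega>. X \<omega> * Y \<omega>)"
      using 1 unfolding expectation_elementary_integral_mult[OF L(1) K(1)] using True by simp
    moreover have "(\<lambda>k. perm_form n (elementary_fun n (L k)) (elementary_fun n (K k))) \<longlonglongrightarrow> perm_form n f g"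
      using K(2) True by (intro perm_form_tendsto L(2)) simp
    ultimately show ?thesis using True LIMSEQ_unique by auto
  next
    case False
    have "(\<lambda>k. 0) \<longlonglongrightarrow> expectation (\<lambda>\<omega>. X \<omega> * Y \<omega>)"
      using 1 False by (simp add: expectation_elementary_integral_mult L(1) K(1))
    then show ?thesis using False by (simp add: LIMSEQ_const_iff)
  qed
qed

lemma wiener_integral_norm_bound:
  assumes "has_wiener_integral M W n f X"
  shows "expectation (\<lambda>\<omega>. (X \<omega>)\<^sup>2) \<le> fact n * (\<integral>x. (f x)\<^sup>2 \<partial>quadrant_pow n)"
  using wiener_integral_inner[OF assms assms] perm_form_bound[OF has_wiener_integral_in_Lp_2(1)[OF assms]]
  by (simp add: power2_eq_square)

lemma has_wiener_integral_axpy: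
  assumes "has_wiener_integral M W n f X" "has_wiener_integral M W n g Y"
  shows "has_wiener_integral M W n (\<lambda>x. a * f x + g x) (\<lambda>\<omega>. a * X \<omega> + Y \<omega>)"
proof -
  obtain L K where L: "\<And>k. is_elementary n (L k)" "Lp_tendsto 2 (quadrant_pow n) (\<lambda>k. elementary_fun n (L k)) f"
      "Lp_tendsto 2 M (\<lambda>k. elementary_integral W n (L k)) X"
    and K: "\<And>k. is_elementary n (K k)" "Lp_tendsto 2 (quadrant_pow n) (\<lambda>k. elementary_fun n (K k)) g"
      "Lp_tendsto 2 M (\<lambda>k. elementary_integral W n (K k)) Y"
    using assms unfolding has_wiener_integral_def by blast
  let ?J = "\<lambda>k. map (\<lambda>(c, A). (a * c, A)) (L k) @ K k"
  have "is_elementary n (?J k)" for k by (simp add: is_elementary_append is_elementary_scale L K)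
  moreover have "Lp_tendsto 2 (quadrant_pow n) (\<lambda>k. elementary_fun n (?J k)) (\<lambda>x. a * f x + g x)"
    unfolding elementary_fun_append[abs_def] elementary_fun_scale
    by (intro Lp_tendsto_2_add Lp_tendsto_2_cmult L K)
  moreover have "Lp_tendsto 2 M (\<lambda>k. elementary_integral W n (?J k)) (\<lambda>\<omega>. a * X \<omega> + Y \<omega>)"
    unfolding elementary_integral_append[abs_def] elementary_integral_scale
    by (intro Lp_tendsto_2_add Lp_tendsto_2_cmult L K)
  ultimately show ?thesis unfolding has_wiener_integral_def by (intro exI[of _ ?J]) auto
qed

lemma has_wiener_integral_diff:
  assumes "has_wiener_integral M W n f X" "has_wiener_integral M W n g Y"
  shows "has_wiener_integral M W n (\<lambda>x. f x - g x) (\<lambda>\<omega>. X \<omega> - Y \<omega>)"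
  using has_wiener_integral_axpy[OF assms(2,1), of "-1"] by simp

lemma has_wiener_integral_zero: "has_wiener_integral M W n (\<lambda>x. 0) (\<lambda>\<omega>. 0)"
  unfolding has_wiener_integral_def
  by (rule exI[of _ "\<lambda>k. []"])
    (simp add: is_elementary_Nil elementary_fun_Nil[abs_def] elementary_integral_Nil[abs_def]
      Lp_tendsto_2_const in_Lp_2_zero)

lemma has_wiener_integral_cmult:
  "has_wiener_integral M W n f X \<Longrightarrow> has_wiener_integral M W n (\<lambda>x. a * f x) (\<lambda>\<omega>. a * X \<omega>)"
  using has_wiener_integral_axpy[OF _ has_wiener_integral_zero, of n f X a] by simp

text \<open>The difference of the kernels has norm 0, hence so has the difference of the integrals.
  In particular the choice inside \<open>wiener_integral\<close> is immaterial up to null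
  sets.\<close>

lemma wiener_integral_AE_unique:
  assumes X: "has_wiener_integral M W n f X" and Y: "has_wiener_integral M W n g Y"
    and eq: "AE x in quadrant_pow n. f x = g x"
  shows "AE \<omega> in M. X \<omega> = Y \<omega>"
proof -
  note XL = has_wiener_integral_in_Lp_2[OF X] and YL = has_wiener_integral_in_Lp_2[OF Y]
  have "(\<integral>x. (f x - g x)\<^sup>2 \<partial>quadrant_pow n) = (\<integral>x. 0 \<partial>quadrant_pow n)"
  proof (rule integral_cong_AE)
    show "(\<lambda>x. (f x - g x)\<^sup>2) \<in> borel_measurable (quadrant_pow n)"
      using in_Lp_2_diff[OF XL(1) YL(1)] by (auto simp: in_Lp_2_iff)
    show "AE x in quadrant_pow n. (f x - g x)\<^sup>2 = 0" using eq by eventually_elim simp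
  qed simp
  then have "expectation (\<lambda>\<omega>. (X \<omega> - Y \<omega>)\<^sup>2) \<le> 0"
    using wiener_integral_norm_bound[OF has_wiener_integral_diff[OF X Y]] by simp
  then have "expectation (\<lambda>\<omega>. (X \<omega> - Y \<omega>)\<^sup>2) = 0" by (intro antisym) simp_all
  then show ?thesis by (rule AE_eq_if_integral_square_0[OF XL(2) YL(2)])
qed

text \<open>The norm bound sends a Cauchy sequence of elementary kernels to a Cauchy sequence of
  random variables, and completeness supplies the limit. The radius \<open>e / fact n\<close>
  compensates the factorial in that bound.\<close>

theorem has_wiener_integral_exists:
  assumes "in_Lp 2 (quadrant_pow n) f"
  shows "\<exists>X. has_wiener_integral M W n f X"
proof -
  obtain L where L: "\<And>k. is_elementary n (L k)" "Lp_tendsto 2 (quadrant_pow n) (\<lambda>k. elementary_fun n (L k)) f"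
    using approximable_Lp_tendsto[OF approximable_in_Lp_2[OF assms]] by blast
  let ?I = "\<lambda>k. elementary_integral W n (L k)"
  have IL: "in_Lp 2 M (?I k)" for k
    by (intro all_moments_in_Lp_2 all_moments_elementary_integral L)
  have simple: "has_wiener_integral M W n (elementary_fun n (L k)) (?I k)" for k
    unfolding has_wiener_integral_def
    by (intro exI[of _ "\<lambda>_. L k"]) (simp add: L Lp_tendsto_2_const IL in_Lp_2_elementary_fun)
  have "\<exists>X. Lp_tendsto 2 M ?I X"
  proof (rule L2_complete[OF IL])
    fix e :: real assume "e > 0"
    then have "e / fact n > 0" by simp
    from Lp_tendsto_2_Cauchy[OF L(2) this] obtain N where
      N: "\<And>i j. i \<ge> N \<Longrightarrow> j \<ge> N \<Longrightarrow> (\<integral>x. (elementary_fun n (L i) x - elementary_fun n (L j) x)\<^sup>2 \<partial>quadrant_pow n) < e / fact n"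
      by blast
    have "expectation (\<lambda>\<omega>. (?I i \<omega> - ?I j \<omega>)\<^sup>2) < e" if "i \<ge> N" "j \<ge> N" for i j
    proof -
      have "expectation (\<lambda>\<omega>. (?I i \<omega> - ?I j \<omega>)\<^sup>2)
          \<le> fact n * (\<integral>x. (elementary_fun n (L i) x - elementary_fun n (L j) x)\<^sup>2 \<partial>quadrant_pow n)"
        by (rule wiener_integral_norm_bound[OF has_wiener_integral_diff[OF simple simple]])
      also have "\<dots> < fact n * (e / fact n)" using N[OF that] by (intro mult_strict_left_mono) auto
      finally show ?thesis by simp
    qed
    then show "\<exists>N. \<forall>i\<ge>N. \<forall>j\<ge>N. expectation (\<lambda>\<omega>. (?I i \<omega> - ?I j \<omega>)\<^sup>2) < e" by blast
  qed
  then show ?thesis unfolding has_wiener_integral_def using L by blast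
qed

lemma has_wiener_integral_wiener_integral:
  "in_Lp 2 (quadrant_pow n) f \<Longrightarrow> has_wiener_integral M W n f (wiener_integral M W n f)"
  unfolding wiener_integral_def by (rule someI_ex[OF has_wiener_integral_exists])

end

section \<open>Sections of kernels in the last variable\<close>

lemma nn_integral_quadrant_pow_Suc:
  assumes "f \<in> borel_measurable (quadrant_pow (Suc n))"
  shows "(\<integral>\<^sup>+z. f z \<partial>quadrant_pow (Suc n)) = (\<integral>\<^sup>+x. (\<integral>\<^sup>+y. f (y(n := x)) \<partial>quadrant_pow n) \<partial>quadrant)"
  using qpow.product_nn_integral_insert_rev[of "{..<n}" n f] assms
  by (simp add: quadrant_pow_def lessThan_Suc)

lemma measurable_fun_upd_quadrant_pow [measurable]:
  assumes "x \<in> space quadrant"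
  shows "(\<lambda>y. y(n := x)) \<in> quadrant_pow n \<rightarrow>\<^sub>M quadrant_pow (Suc n)"
  unfolding quadrant_pow_def lessThan_Suc
  by (rule measurable_fun_upd[where J="{..<n}"]) (use assms in auto)

lemma AE_in_Lp_2_section:
  assumes g: "in_Lp 2 (quadrant_pow (Suc n)) g"
  shows "AE x in quadrant. in_Lp 2 (quadrant_pow n) (\<lambda>y. g (y(n := x)))"
proof -
  have gm[measurable]: "g \<in> borel_measurable (quadrant_pow (Suc n))" using g by (simp add: in_Lp_2_iff)
  have m: "(\<lambda>x. \<integral>\<^sup>+y. ennreal ((g (y(n := x)))\<^sup>2) \<partial>quadrant_pow n) \<in> borel_measurable quadrant"
  proof -
    interpret fp: finite_product_sigma_finite "\<lambda>_. quadrant" "{..<n}" by standard simp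
    interpret qn: sigma_finite_measure "quadrant_pow n"
      unfolding quadrant_pow_def by (rule fp.sigma_finite_measure_axioms)
    have "(\<lambda>(x, y). y(n := x)) \<in> quadrant \<Otimes>\<^sub>M quadrant_pow n \<rightarrow>\<^sub>M quadrant_pow (Suc n)"
      unfolding quadrant_pow_def lessThan_Suc split_beta'
      by (rule measurable_fun_upd[where J="{..<n}"]) auto
    from measurable_compose[OF this, of "\<lambda>z. ennreal ((g z)\<^sup>2)" borel]
    have "(\<lambda>(x, y). ennreal ((g (y(n := x)))\<^sup>2)) \<in> borel_measurable (quadrant \<Otimes>\<^sub>M quadrant_pow n)"
      by (simp add: split_beta')
    then show ?thesis by (rule qn.borel_measurable_nn_integral)
  qed
  have "(\<integral>\<^sup>+x. (\<integral>\<^sup>+y. ennreal ((g (y(n := x)))\<^sup>2) \<partial>quadrant_pow n) \<partial>quadrant)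
      = (\<integral>\<^sup>+z. ennreal ((g z)\<^sup>2) \<partial>quadrant_pow (Suc n))"
    by (rule nn_integral_quadrant_pow_Suc[symmetric]) simp
  also have "\<dots> \<noteq> \<infinity>"
    using g by (auto simp: in_Lp_2_iff nn_integral_eq_integral)
  finally have "AE x in quadrant. (\<integral>\<^sup>+y. ennreal ((g (y(n := x)))\<^sup>2) \<partial>quadrant_pow n) \<noteq> \<infinity>"
    by (rule nn_integral_PInf_AE[OF m])
  then show ?thesis using AE_space
  proof eventually_elim
    case (elim x)
    have [measurable]: "(\<lambda>y. g (y(n := x))) \<in> borel_measurable (quadrant_pow n)"
      by (rule measurable_compose[OF measurable_fun_upd_quadrant_pow[OF elim(2)] gm])
    show ?case unfolding in_Lp_2_iff
      using elim(1) by (auto intro!: integrableI_bounded simp: less_top)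
  qed
qed

text \<open>The hypothesis says that the sum over the permutations fixing \<open>n\<close> vanishes.
  Composing these with arbitrary permutations of all \<open>n + 1\<close> variables yields every
  permutation exactly n! times.\<close>

lemma perm_sum_section_AE_0:
  assumes g: "in_Lp 2 (quadrant_pow (Suc n)) g"
    and 0: "AE x in quadrant. AE y in quadrant_pow n. perm_sum n (\<lambda>y. g (y(n := x))) y = 0"
  shows "AE z in quadrant_pow (Suc n). perm_sum (Suc n) g z = 0"
proof -
  define G where "G z = (\<Sum>\<sigma>\<in>{\<sigma>. \<sigma> permutes {..<n}}. g (z \<circ> \<sigma>))" for z
  have P: "\<sigma> permutes {..<Suc n}" if "\<sigma> permutes {..<n}" for \<sigma>
    by (rule permutes_subset[OF that]) auto
  have GL: "in_Lp 2 (quadrant_pow (Suc n)) G"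
    unfolding G_def[abs_def] by (intro in_Lp_2_sum in_Lp_2_permute[OF _ g]) (auto intro: P)
  then have [measurable]: "G \<in> borel_measurable (quadrant_pow (Suc n))" by (simp add: in_Lp_2_iff)
  have Gsec: "G (y(n := x)) = perm_sum n (\<lambda>y. g (y(n := x))) y" for x y
    unfolding G_def perm_sum_def
  proof (rule sum.cong[OF refl])
    fix \<sigma> assume "\<sigma> \<in> {\<sigma>. \<sigma> permutes {..<n}}"
    then have \<sigma>: "\<sigma> permutes {..<n}" by simp
    have "y(n := x) \<circ> \<sigma> = (y \<circ> \<sigma>)(n := x)"
    proof
      fix i
      have "\<sigma> i = n \<longleftrightarrow> i = n"
        using permutes_not_in[OF \<sigma>, of n] permutes_inj[OF \<sigma>] by (auto simp: inj_def)
      then show "(y(n := x) \<circ> \<sigma>) i = ((y \<circ> \<sigma>)(n := x)) i" by simp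
    qed
    then show "g (y(n := x) \<circ> \<sigma>) = g ((y \<circ> \<sigma>)(n := x))" by simp
  qed
  have "(\<integral>\<^sup>+z. ennreal \<bar>G z\<bar> \<partial>quadrant_pow (Suc n)) = (\<integral>\<^sup>+x. (\<integral>\<^sup>+y. ennreal \<bar>G (y(n := x))\<bar> \<partial>quadrant_pow n) \<partial>quadrant)"
    by (rule nn_integral_quadrant_pow_Suc) simp
  also have "\<dots> = (\<integral>\<^sup>+x. 0 \<partial>quadrant)"
  proof (rule nn_integral_cong_AE)
    show "AE x in quadrant. (\<integral>\<^sup>+y. ennreal \<bar>G (y(n := x))\<bar> \<partial>quadrant_pow n) = 0"
      using 0
    proof eventually_elim
      case (elim x)
      then have "(\<integral>\<^sup>+y. ennreal \<bar>G (y(n := x))\<bar> \<partial>quadrant_pow n) = (\<integral>\<^sup>+y. 0 \<partial>quadrant_pow n)"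
        by (intro nn_integral_cong_AE) (auto simp: Gsec)
      then show ?case by simp
    qed
  qed
  finally have "(\<integral>\<^sup>+z. ennreal \<bar>G z\<bar> \<partial>quadrant_pow (Suc n)) = 0" by simp
  then have G0: "AE z in quadrant_pow (Suc n). G z = 0"
    by (subst (asm) nn_integral_0_iff_AE) auto
  have "AE z in quadrant_pow (Suc n). \<forall>\<tau>\<in>{\<tau>. \<tau> permutes {..<Suc n}}. G (z \<circ> \<tau>) = 0"
    by (intro AE_finite_allI finite_perms AE_permute[OF _ G0]) auto
  then show ?thesis
  proof eventually_elim
    case (elim z)
    have "fact n * perm_sum (Suc n) g z = (\<Sum>\<sigma>\<in>{\<sigma>. \<sigma> permutes {..<n}}. perm_sum (Suc n) g z)"
      by (simp add: card_permutations[of "{..<n}" n])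
    also have "\<dots> = (\<Sum>\<sigma>\<in>{\<sigma>. \<sigma> permutes {..<n}}. \<Sum>\<tau>\<in>{\<tau>. \<tau> permutes {..<Suc n}}. g (z \<circ> \<tau> \<circ> \<sigma>))"
    proof (rule sum.cong[OF refl])
      fix \<sigma> assume "\<sigma> \<in> {\<sigma>. \<sigma> permutes {..<n}}"
      then have "\<sigma> permutes {..<Suc n}" using P by simp
      from sum_permutations_compose_right[OF this, of "\<lambda>\<tau>. g (z \<circ> \<tau>)"]
      show "perm_sum (Suc n) g z = (\<Sum>\<tau>\<in>{\<tau>. \<tau> permutes {..<Suc n}}. g (z \<circ> \<tau> \<circ> \<sigma>))"
        by (simp add: perm_sum_def comp_assoc)
    qed
    also have "\<dots> = (\<Sum>\<tau>\<in>{\<tau>. \<tau> permutes {..<Suc n}}. G (z \<circ> \<tau>))"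
      unfolding G_def by (rule sum.swap)
    also have "\<dots> = 0" using elim by (intro sum.neutral) auto
    finally show ?case by simp
  qed
qed

context isonormal_process
begin

lemma wiener_integral_AE_0_iff:
  assumes "has_wiener_integral M W n f X"
  shows "(AE \<omega> in M. X \<omega> = 0) \<longleftrightarrow> (AE x in quadrant_pow n. perm_sum n f x = 0)"
proof -
  note L = has_wiener_integral_in_Lp_2[OF assms]
  have "(AE \<omega> in M. X \<omega> = 0) \<longleftrightarrow> (AE \<omega> in M. (X \<omega>)\<^sup>2 = 0)" by simp
  also have "\<dots> \<longleftrightarrow> expectation (\<lambda>\<omega>. (X \<omega>)\<^sup>2) = 0"
    using L(2) by (intro integral_nonneg_eq_0_iff_AE[symmetric]) (auto simp: in_Lp_2_iff)
  also have "\<dots> \<longleftrightarrow> perm_form n f f = 0"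
    using wiener_integral_inner[OF assms assms] by (simp add: power2_eq_square)
  finally show ?thesis using perm_form_eq_0_iff[OF L(1)] by simp
qed

text \<open>A null integral means a null symmetrization, and symmetrizing the first \<open>n\<close>
  variables is part of symmetrizing all of them. This lifts an identity between integrands of order
  \<open>n\<close> to one between their Skorohod integrals.\<close>

lemma wiener_integral_section_AE_0:
  assumes Y: "has_wiener_integral M W (Suc n) g Y"
    and 0: "AE x in quadrant. \<exists>X. has_wiener_integral M W n (\<lambda>y. g (y(n := x))) X \<and> (AE \<omega> in M. X \<omega> = 0)"
  shows "AE \<omega> in M. Y \<omega> = 0"
proof -
  note L = has_wiener_integral_in_Lp_2[OF Y]
  have "AE x in quadrant. AE y in quadrant_pow n. perm_sum n (\<lambda>y. g (y(n := x))) y = 0"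
    using 0 by eventually_elim (use wiener_integral_AE_0_iff in blast)
  from perm_sum_section_AE_0[OF L(1) this] show ?thesis using wiener_integral_AE_0_iff[OF Y] by simp
qed

end

section \<open>Hypercontractivity\<close>

lemma choose_Suc_times: "Suc j * (n choose Suc j) = (n - j) * (n choose j)"
  by (simp only: binomial_absorption binomial_absorb_comp)

text \<open>The two sides are compared through the ratios of consecutive terms in \<open>j\<close>:
  \<open>(k - j) * (2 * k - 2 * j - 1) / (j + 1)\<close> on the left,
  \<open>(k - j) * (2 * k - 1) / (j + 1)\<close> on the right.\<close>

lemma choose_gauss_moment_le:
  assumes "j \<le> k" "k \<ge> 1"
  shows "real (2 * k choose (2 * j)) * gauss_moment (2 * j) 1 \<le> real (k choose j) * real (2 * k - 1) ^ j"
  using assms(1)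
proof (induction j)
  case 0
  then show ?case by simp
next
  case (Suc j)
  define a where "a j = real (2 * k choose (2 * j)) * gauss_moment (2 * j) 1" for j
  define b where "b j = real (k choose j) * real (2 * k - 1) ^ j" for j
  have IH: "a j \<le> b j" using Suc unfolding a_def b_def by simp
  have b: "real (Suc j) * b (Suc j) = real (k - j) * b j * real (2 * k - 1)"
  proof -
    have "real (Suc j) * real (k choose Suc j) = real (k - j) * real (k choose j)"
      by (simp only: of_nat_mult[symmetric] choose_Suc_times)
    then show ?thesis by (simp add: b_def mult_ac)
  qed
  have a: "real (Suc j) * a (Suc j) = real (k - j) * a j * real (2 * k - 2 * j - 1)"
  proof -
    have 1: "real (2 * j + 2) * real (2 * k choose (2 * j + 2)) = real (2 * k - (2 * j + 1)) * real (2 * k choose (2 * j + 1))"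
      using choose_Suc_times[of "2 * j + 1" "2 * k"] by (simp only: of_nat_mult[symmetric]) simp
    have 2: "real (2 * j + 1) * real (2 * k choose (2 * j + 1)) = real (2 * k - 2 * j) * real (2 * k choose (2 * j))"
      using choose_Suc_times[of "2 * j" "2 * k"] by (simp only: of_nat_mult[symmetric]) simp
    have g: "gauss_moment (2 * j + 2) 1 = real (2 * j + 1) * gauss_moment (2 * j) 1"
      using gauss_moment_Suc[of "2 * j + 1" 1] by simp
    have "2 * (real (Suc j) * a (Suc j)) = (real (2 * j + 2) * real (2 * k choose (2 * j + 2))) * gauss_moment (2 * j + 2) 1"
      by (simp add: a_def)
    also have "\<dots> = real (2 * k - (2 * j + 1)) * (real (2 * j + 1) * real (2 * k choose (2 * j + 1))) * gauss_moment (2 * j) 1"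
      unfolding 1 g by (simp add: mult_ac)
    also have "\<dots> = real (2 * k - (2 * j + 1)) * real (2 * k - 2 * j) * a j"
      unfolding 2 by (simp add: a_def mult_ac)
    also have "real (2 * k - 2 * j) = 2 * real (k - j)" using Suc.prems by (simp add: of_nat_diff)
    finally show ?thesis by (simp add: mult_ac)
  qed
  have "a j \<ge> 0" "b j \<ge> 0" by (simp_all add: a_def b_def gauss_moment_def)
  have "real (Suc j) * a (Suc j) \<le> real (Suc j) * b (Suc j)"
    unfolding a b by (intro mult_mono mult_left_mono IH) (use \<open>a j \<ge> 0\<close> \<open>b j \<ge> 0\<close> in auto)
  then have "a (Suc j) \<le> b (Suc j)" by (simp del: of_nat_Suc)
  then show ?case by (simp add: a_def b_def)
qed

lemma sum_even_index:
  fixes f :: "nat \<Rightarrow> real"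
  assumes "\<And>j. odd j \<Longrightarrow> f j = 0"
  shows "(\<Sum>j\<le>2 * k. f j) = (\<Sum>j\<le>k. f (2 * j))"
  by (induction k) (auto simp: assms)

text \<open>Young's inequality with the weights \<open>j / k\<close> and \<open>(k - j) / k\<close>,
  multiplied by \<open>k\<close>.\<close>

lemma weighted_AM_GM_nat:
  fixes x y :: real
  assumes "0 \<le> x" "0 \<le> y" "j \<le> k"
  shows "real k * (x ^ j * y ^ (k - j)) \<le> real j * x ^ k + real (k - j) * y ^ k"
proof (cases "k = 0 \<or> x = 0 \<or> y = 0")
  case True
  then show ?thesis using assms by (auto simp: power_0_left)
next
  case False
  then have pos: "x > 0" "y > 0" "k > 0" using assms by auto
  have "(x ^ k) powr (real j / real k) * (y ^ k) powr (real (k - j) / real k)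
      \<le> (real j / real k) * x ^ k + (real (k - j) / real k) * y ^ k"
    by (rule Youngs_inequality_0) (use pos assms(3) in \<open>auto simp: of_nat_diff field_simps\<close>)
  also have "(x ^ k) powr (real j / real k) = x ^ j"
    using pos by (simp add: powr_realpow[symmetric] powr_powr)
  also have "(y ^ k) powr (real (k - j) / real k) = y ^ (k - j)"
    using pos by (simp add: powr_realpow[symmetric] powr_powr)
  finally show ?thesis using pos by (simp add: field_simps)
qed

text \<open>Hoelder's inequality with exponents \<open>k / j\<close> and \<open>k / (k - j)\<close>.
  Once the variables are normalized, it is the weighted mean inequality under the
  expectation.\<close>

lemma expectation_power_mult_bound:
  fixes A B :: real
  assumes X: "all_moments M X" and Y: "all_moments M Y" and "A \<ge> 0" "B \<ge> 0"
    and nn: "\<And>\<omega>. 0 \<le> X \<omega>" "\<And>\<omega>. 0 \<le> Y \<omega>"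
    and EX: "(\<integral>\<omega>. X \<omega> ^ k \<partial>M) \<le> A ^ k" and EY: "(\<integral>\<omega>. Y \<omega> ^ k \<partial>M) \<le> B ^ k"
    and j: "j \<le> k" and M: "prob_space M"
  shows "(\<integral>\<omega>. X \<omega> ^ j * Y \<omega> ^ (k - j) \<partial>M) \<le> A ^ j * B ^ (k - j)"
proof (cases "k = 0")
  case True
  then show ?thesis using EX j by simp
next
  case False
  then have k: "real k > 0" by simp
  interpret prob_space M by fact
  have iXY: "integrable M (\<lambda>\<omega>. X \<omega> ^ j * Y \<omega> ^ (k - j))"
    by (intro all_moments_integrable all_moments_mult all_moments_power X Y)
  have iX: "integrable M (\<lambda>\<omega>. X \<omega> ^ k)" and iY: "integrable M (\<lambda>\<omega>. Y \<omega> ^ k)"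
    by (intro all_moments_integrable all_moments_power X Y)+
  have pos: "expectation (\<lambda>\<omega>. X \<omega> ^ j * Y \<omega> ^ (k - j)) \<le> a ^ j * b ^ (k - j)"
    if ab: "a > 0" "b > 0" "A \<le> a" "B \<le> b" for a b
  proof -
    have "real k * expectation (\<lambda>\<omega>. X \<omega> ^ j * Y \<omega> ^ (k - j)) / (a ^ j * b ^ (k - j))
      = expectation (\<lambda>\<omega>. real k * ((X \<omega> / a) ^ j * (Y \<omega> / b) ^ (k - j)))"
      by (simp add: power_divide)
    also have "\<dots> \<le> expectation (\<lambda>\<omega>. real j * (X \<omega> / a) ^ k + real (k - j) * (Y \<omega> / b) ^ k)"
    proof (rule integral_mono)
      show "integrable M (\<lambda>\<omega>. real k * ((X \<omega> / a) ^ j * (Y \<omega> / b) ^ (k - j)))"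
        using iXY by (simp add: power_divide)
      show "integrable M (\<lambda>\<omega>. real j * (X \<omega> / a) ^ k + real (k - j) * (Y \<omega> / b) ^ k)"
        using iX iY by (simp add: power_divide)
      show "real k * ((X \<omega> / a) ^ j * (Y \<omega> / b) ^ (k - j)) \<le> real j * (X \<omega> / a) ^ k + real (k - j) * (Y \<omega> / b) ^ k" for \<omega>
        by (rule weighted_AM_GM_nat) (use nn ab j in auto)
    qed
    also have "\<dots> = real j * (expectation (\<lambda>\<omega>. X \<omega> ^ k) / a ^ k) + real (k - j) * (expectation (\<lambda>\<omega>. Y \<omega> ^ k) / b ^ k)"
      using iX iY by (simp add: power_divide)
    also have "\<dots> \<le> real j * 1 + real (k - j) * 1"
    proof (intro add_mono mult_left_mono)
      have "A ^ k \<le> a ^ k" "B ^ k \<le> b ^ k" using ab assms(3,4) by (auto intro: power_mono)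
      then show "expectation (\<lambda>\<omega>. X \<omega> ^ k) / a ^ k \<le> 1" "expectation (\<lambda>\<omega>. Y \<omega> ^ k) / b ^ k \<le> 1"
        using EX EY ab by auto
    qed auto
    also have "\<dots> = real k" using j by simp
    finally have "real k * expectation (\<lambda>\<omega>. X \<omega> ^ j * Y \<omega> ^ (k - j)) \<le> real k * (a ^ j * b ^ (k - j))"
      using ab by (simp add: pos_divide_le_eq)
    then show ?thesis using k by simp
  qed
  \<comment> \<open>\<open>A\<close> or \<open>B\<close> may be 0, so the normalization divides by
    \<open>A + e\<close> and \<open>B + e\<close>, and \<open>e\<close> tends to 0.\<close>
  have "((\<lambda>e. (A + e) ^ j * (B + e) ^ (k - j)) \<longlongrightarrow> (A + 0) ^ j * (B + 0) ^ (k - j)) (at_right 0)"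
    by (intro tendsto_intros)
  then have "((\<lambda>e. (A + e) ^ j * (B + e) ^ (k - j)) \<longlongrightarrow> A ^ j * B ^ (k - j)) (at_right 0)" by simp
  then show ?thesis
  proof (rule tendsto_lowerbound)
    show "\<forall>\<^sub>F e in at_right 0. expectation (\<lambda>\<omega>. X \<omega> ^ j * Y \<omega> ^ (k - j)) \<le> (A + e) ^ j * (B + e) ^ (k - j)"
      using eventually_at_right_less[of 0] by eventually_elim (rule pos; use assms(3,4) in simp)
  qed simp
qed

section \<open>Multilinear polynomials in orthogonal Gaussian variables\<close>

context isonormal_process
begin

text \<open>A homogeneous polynomial of degree \<open>n\<close> without repeated variables, with one
  coefficient for each set of variables. It is affine in every single variable, which drives the
  induction on their number.\<close>

definition multilinear :: "('i \<Rightarrow> real \<times> real \<Rightarrow> real) \<Rightarrow> 'i set \<Rightarrow> nat \<Rightarrow> ('i set \<Rightarrow> real) \<Rightarrow> 'a \<Rightarrow> real" where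
  "multilinear h K n a \<omega> = (\<Sum>T\<in>{T. T \<subseteq> K \<and> card T = n}. a T * (\<Prod>i\<in>T. W (h i) \<omega>))"

lemma multilinear_0: "finite K \<Longrightarrow> multilinear h K 0 a \<omega> = a {}"
proof -
  assume "finite K"
  then have "{T. T \<subseteq> K \<and> card T = 0} = {{}}" by (auto dest: finite_subset)
  then show ?thesis by (simp add: multilinear_def)
qed

lemma multilinear_insert:
  assumes "finite K" "b \<notin> K"
  shows "multilinear h (insert b K) (Suc m) a \<omega>
    = multilinear h K (Suc m) a \<omega> + W (h b) \<omega> * multilinear h K m (\<lambda>T. a (insert b T)) \<omega>"
proof -
  let ?S = "\<lambda>n. {T. T \<subseteq> K \<and> card T = n}"
  have fin: "finite (?S n)" for n using assms(1) by simp
  have bT: "b \<notin> T" "finite T" if "T \<subseteq> K" for T using that assms finite_subset by auto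
  have split: "{T. T \<subseteq> insert b K \<and> card T = Suc m} = ?S (Suc m) \<union> insert b ` ?S m"
  proof (intro set_eqI iffI)
    fix T assume T: "T \<in> {T. T \<subseteq> insert b K \<and> card T = Suc m}"
    show "T \<in> ?S (Suc m) \<union> insert b ` ?S m"
    proof (cases "b \<in> T")
      case True
      then have "T = insert b (T - {b})" "T - {b} \<in> ?S m" using T by (auto simp: card_Diff_singleton)
      then show ?thesis by blast
    next
      case False
      then show ?thesis using T by auto
    qed
  next
    fix T assume "T \<in> ?S (Suc m) \<union> insert b ` ?S m"
    then show "T \<in> {T. T \<subseteq> insert b K \<and> card T = Suc m}" using bT by auto
  qed
  have inj: "inj_on (insert b) (?S m)"
    using bT by (intro inj_onI) (metis (no_types, lifting) insert_ident mem_Collect_eq)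
  have "multilinear h (insert b K) (Suc m) a \<omega>
      = multilinear h K (Suc m) a \<omega> + (\<Sum>T\<in>insert b ` ?S m. a T * (\<Prod>i\<in>T. W (h i) \<omega>))"
    unfolding multilinear_def split using fin assms(2) by (subst sum.union_disjoint) auto
  also have "(\<Sum>T\<in>insert b ` ?S m. a T * (\<Prod>i\<in>T. W (h i) \<omega>))
      = (\<Sum>T\<in>?S m. a (insert b T) * (W (h b) \<omega> * (\<Prod>i\<in>T. W (h i) \<omega>)))"
    unfolding sum.reindex[OF inj] using bT by (intro sum.cong) auto
  also have "\<dots> = W (h b) \<omega> * multilinear h K m (\<lambda>T. a (insert b T)) \<omega>"
    by (simp add: multilinear_def sum_distrib_left mult_ac)
  finally show ?thesis .
qed

lemma orth_poly_multilinear: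
  assumes "\<And>i. i \<in> K \<Longrightarrow> in_Lp 2 quadrant (h i) \<and> ip x (h i) = 0"
  shows "orth_poly x (multilinear h K n a)"
  unfolding multilinear_def[abs_def]
  by (intro orth_poly_sum orth_poly_cmult orth_poly_prod_W) (use assms in auto)

lemma all_moments_multilinear:
  assumes "\<And>i. i \<in> K \<Longrightarrow> in_Lp 2 quadrant (h i)"
  shows "all_moments M (multilinear h K n a)"
  unfolding multilinear_def[abs_def]
  by (intro all_moments_sum all_moments_cmult all_moments_prod all_moments_W) (use assms in auto)

text \<open>The induction of Bonami and Beckner on the number of variables. The constant comes from
  \<open>(2k choose 2j) (2j - 1)!! \<le> (k choose j) (2k - 1)^j\<close>.\<close>

theorem multilinear_hypercontractive:
  assumes "finite K" "k \<ge> 1" "\<And>i. i \<in> K \<Longrightarrow> in_Lp 2 quadrant (h i)"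
    and "\<And>i j. i \<in> K \<Longrightarrow> j \<in> K \<Longrightarrow> i \<noteq> j \<Longrightarrow> ip (h i) (h j) = 0"
  shows "expectation (\<lambda>\<omega>. multilinear h K n a \<omega> ^ (2 * k))
    \<le> (real (2 * k - 1) ^ n * expectation (\<lambda>\<omega>. (multilinear h K n a \<omega>)\<^sup>2)) ^ k"
  using assms(1,3,4)
proof (induction K arbitrary: n a rule: finite_induct)
  case empty
  show ?case
  proof (cases n)
    case 0
    then show ?thesis by (simp add: multilinear_0 prob_space power_mult)
  next
    case (Suc m)
    then have "multilinear h {} n a \<omega> = 0" for \<omega>
      unfolding multilinear_def by (intro sum.neutral) auto
    then show ?thesis using assms(2) by (simp add: power_0_left)
  qed
next
  case (insert b K)
  show ?case
  proof (cases n)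
    case 0
    then show ?thesis using insert.hyps by (simp add: multilinear_0 prob_space power_mult)
  next
    case (Suc m)
    \<comment> \<open>\<open>H\<close> and \<open>g\<close> are the coefficients of the polynomial
      as an affine function of \<open>W (h b)\<close>. They contain only the other variables and
      have degrees \<open>m + 1\<close> and \<open>m\<close>.\<close>
    define H where "H = multilinear h K (Suc m) a"
    define g where "g = multilinear h K m (\<lambda>T. a (insert b T))"
    define v where "v = ip (h b) (h b)"
    define c where "c = real (2 * k - 1)"
    have c: "c \<ge> 0" by (simp add: c_def)
    have v: "v \<ge> 0" by (simp add: v_def ip_def)
    have hb: "in_Lp 2 quadrant (h b)" using insert.prems by simp
    have hK: "in_Lp 2 quadrant (h i) \<and> ip (h b) (h i) = 0" if "i \<in> K" for i
    proof -
      have "b \<noteq> i" using that insert.hyps by auto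
      then show ?thesis using insert.prems(1)[of i] insert.prems(2)[of b i] that by simp
    qed
    have oH: "orth_poly (h b) H" and og: "orth_poly (h b) g"
      unfolding H_def g_def by (intro orth_poly_multilinear hK; assumption)+
    note aH = orth_poly_all_moments[OF oH] and ag = orth_poly_all_moments[OF og]
    have eq: "multilinear h (insert b K) n a \<omega> = H \<omega> + W (h b) \<omega> * g \<omega>" for \<omega>
      using multilinear_insert[OF insert.hyps] by (simp add: Suc H_def g_def)
    have moment: "expectation (\<lambda>\<omega>. (H \<omega> + W (h b) \<omega> * g \<omega>) ^ (2 * l))
        = (\<Sum>j\<le>l. real (2 * l choose (2 * j)) * gauss_moment (2 * j) v * expectation (\<lambda>\<omega>. (g \<omega>) ^ (2 * j) * (H \<omega>) ^ (2 * l - 2 * j)))" for l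
    proof -
      have "expectation (\<lambda>\<omega>. (H \<omega> + W (h b) \<omega> * g \<omega>) ^ (2 * l))
          = expectation (\<lambda>\<omega>. \<Sum>j\<le>2 * l. real (2 * l choose j) * (W (h b) \<omega> ^ j * (g \<omega> ^ j * H \<omega> ^ (2 * l - j))))"
        by (simp add: add.commute[of "H _"] binomial_ring power_mult_distrib mult_ac)
      also have "\<dots> = (\<Sum>j\<le>2 * l. real (2 * l choose j) * expectation (\<lambda>\<omega>. W (h b) \<omega> ^ j * (g \<omega> ^ j * H \<omega> ^ (2 * l - j))))"
      proof -
        have "integrable M (\<lambda>\<omega>. W (h b) \<omega> ^ j * (g \<omega> ^ j * H \<omega> ^ (2 * l - j)))" for j
          by (intro all_moments_integrable all_moments_mult all_moments_power aH ag all_moments_W hb)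
        then show ?thesis by simp
      qed
      also have "\<dots> = (\<Sum>j\<le>2 * l. real (2 * l choose j) * (gauss_moment j v * expectation (\<lambda>\<omega>. g \<omega> ^ j * H \<omega> ^ (2 * l - j))))"
        unfolding v_def
        by (intro sum.cong refl arg_cong2[where f="(*)"] expectation_W_power_orth_poly hb orth_poly_mult orth_poly_power oH og)
      also have "\<dots> = (\<Sum>j\<le>l. real (2 * l choose (2 * j)) * (gauss_moment (2 * j) v * expectation (\<lambda>\<omega>. g \<omega> ^ (2 * j) * H \<omega> ^ (2 * l - 2 * j))))"
        by (rule sum_even_index) (simp add: gauss_moment_odd)
      finally show ?thesis by (simp add: mult.assoc)
    qed
    \<comment> \<open>\<open>A\<close> and \<open>B\<close> come from the induction hypothesis; the
      exponents of \<open>c\<close> are the degrees of \<open>g\<close> and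
      \<open>H\<close>.\<close>
    define A where "A = c ^ m * expectation (\<lambda>\<omega>. (g \<omega>)\<^sup>2)"
    define B where "B = c ^ Suc m * expectation (\<lambda>\<omega>. (H \<omega>)\<^sup>2)"
    have A: "A \<ge> 0" and B: "B \<ge> 0" using c by (auto simp: A_def B_def)
    have IHg: "expectation (\<lambda>\<omega>. g \<omega> ^ (2 * k)) \<le> A ^ k"
      unfolding A_def c_def g_def by (rule insert.IH) (use insert.prems in auto)
    have IHH: "expectation (\<lambda>\<omega>. H \<omega> ^ (2 * k)) \<le> B ^ k"
      unfolding B_def c_def H_def by (rule insert.IH) (use insert.prems in auto)
    \<comment> \<open>Hoelder's inequality for the squares of \<open>g\<close> and \<open>H\<close>
      separates the two, after which the sum over \<open>j\<close> is again a binomial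
      expansion.\<close>
    have mixed: "expectation (\<lambda>\<omega>. g \<omega> ^ (2 * j) * H \<omega> ^ (2 * k - 2 * j)) \<le> A ^ j * B ^ (k - j)" if "j \<le> k" for j
    proof -
      have "expectation (\<lambda>\<omega>. ((g \<omega>)\<^sup>2) ^ j * ((H \<omega>)\<^sup>2) ^ (k - j)) \<le> A ^ j * B ^ (k - j)"
        by (rule expectation_power_mult_bound[OF _ _ A B _ _ _ _ that prob_space_axioms])
          (use IHg IHH in \<open>auto simp: power_mult intro!: all_moments_power aH ag\<close>)
      then show ?thesis by (simp add: power_mult[symmetric] diff_mult_distrib2)
    qed
    have gm: "gauss_moment (2 * j) v = v ^ j * gauss_moment (2 * j) 1" for j
      by (simp add: gauss_moment_double)
    have "expectation (\<lambda>\<omega>. multilinear h (insert b K) n a \<omega> ^ (2 * k))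
        \<le> (\<Sum>j\<le>k. (real (k choose j) * c ^ j) * v ^ j * (A ^ j * B ^ (k - j)))"
      unfolding eq moment
    proof (rule sum_mono)
      fix j assume "j \<in> {..k}"
      then have j: "j \<le> k" by simp
      have "real (2 * k choose (2 * j)) * gauss_moment (2 * j) v = (real (2 * k choose (2 * j)) * gauss_moment (2 * j) 1) * v ^ j"
        by (simp add: gm)
      also have "\<dots> \<le> (real (k choose j) * c ^ j) * v ^ j"
        unfolding c_def by (intro mult_right_mono choose_gauss_moment_le j assms(2)) (simp add: v)
      finally have 1: "real (2 * k choose (2 * j)) * gauss_moment (2 * j) v \<le> (real (k choose j) * c ^ j) * v ^ j" .
      show "real (2 * k choose (2 * j)) * gauss_moment (2 * j) v * expectation (\<lambda>\<omega>. g \<omega> ^ (2 * j) * H \<omega> ^ (2 * k - 2 * j))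
          \<le> (real (k choose j) * c ^ j) * v ^ j * (A ^ j * B ^ (k - j))"
      proof (rule mult_mono[OF 1 mixed[OF j]])
        have "0 \<le> g \<omega> ^ (2 * j) * H \<omega> ^ (2 * k - 2 * j)" for \<omega>
          by (intro mult_nonneg_nonneg zero_le_even_power) auto
        then show "0 \<le> expectation (\<lambda>\<omega>. g \<omega> ^ (2 * j) * H \<omega> ^ (2 * k - 2 * j))" by simp
      qed (use c v in auto)
    qed
    also have "\<dots> = (c * v * A + B) ^ k"
      by (simp add: binomial_ring power_mult_distrib mult_ac)
    \<comment> \<open>The factor \<open>c\<close> contributed by the moments of
      \<open>W (h b)\<close> raises \<open>c ^ m\<close> in \<open>A\<close> to
      \<open>c ^ n\<close>, in agreement with \<open>B\<close>.\<close>
    also have "c * v * A + B = c ^ n * expectation (\<lambda>\<omega>. (multilinear h (insert b K) n a \<omega>)\<^sup>2)"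
    proof -
      have "expectation (\<lambda>\<omega>. (multilinear h (insert b K) n a \<omega>)\<^sup>2)
          = expectation (\<lambda>\<omega>. (H \<omega>)\<^sup>2) + v * expectation (\<lambda>\<omega>. (g \<omega>)\<^sup>2)"
        using moment[of 1] unfolding eq by (simp add: gauss_moment_def)
      then show ?thesis by (simp add: A_def B_def Suc algebra_simps)
    qed
    finally show ?thesis by (simp add: c_def)
  qed
qed

end

section \<open>Refinement of elementary kernels to disjoint sets\<close>

text \<open>The atoms of the finite algebra generated by \<open>\<F>\<close>, restricted to the
  union of \<open>\<F>\<close> to keep their measure finite; the atom of the empty subfamily is
  empty.\<close>

definition atom :: "(real \<times> real) set set \<Rightarrow> (real \<times> real) set set \<Rightarrow> (real \<times> real) set" where
  "atom \<F> S = {x \<in> \<Union>\<F>. {A \<in> \<F>. x \<in> A} = S}"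

lemma fin_side_atom:
  assumes "finite \<F>" "\<And>A. A \<in> \<F> \<Longrightarrow> fin_side A" "S \<subseteq> \<F>"
  shows "fin_side (atom \<F> S)"
proof -
  have sets: "\<And>A. A \<in> \<F> \<Longrightarrow> A \<in> sets quadrant" using assms(2) by (simp add: fin_side_def)
  have U: "\<Union>\<F> \<in> sets quadrant" using assms(1) sets by (intro sets.finite_Union) auto
  have "emeasure quadrant (\<Union>\<F>) \<le> (\<Sum>A\<in>\<F>. emeasure quadrant A)"
    using emeasure_subadditive_finite[of \<F> "\<lambda>A. A" quadrant] assms(1) sets by auto
  also have "\<dots> < \<infinity>" using assms(1,2) by (auto simp: fin_side_def less_top[symmetric])
  finally have fU: "fin_side (\<Union>\<F>)" using U by (simp add: fin_side_def)
  have "{x \<in> \<Union>\<F>. {A \<in> \<F>. x \<in> A} = S} = \<Union>\<F> \<inter> {x \<in> space quadrant. \<forall>A\<in>\<F>. x \<in> A \<longleftrightarrow> A \<in> S}"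
    using assms(3) sets.sets_into_space[OF U] by auto
  moreover have "{x \<in> space quadrant. \<forall>A\<in>\<F>. x \<in> A \<longleftrightarrow> A \<in> S} \<in> sets quadrant"
    using assms(1) sets by measurable
  ultimately show ?thesis unfolding atom_def using fin_side_Int[OF fU] by simp
qed

lemma atom_disjoint: "S \<noteq> S' \<Longrightarrow> atom \<F> S \<inter> atom \<F> S' = {}"
  by (auto simp: atom_def)

lemma indicator_eq_sum_atoms:
  assumes "finite \<F>" "A \<in> \<F>"
  shows "(indicator A x :: real) = (\<Sum>S\<in>{S. S \<subseteq> \<F> \<and> A \<in> S}. indicator (atom \<F> S) x)"
proof (cases "x \<in> \<Union>\<F>")
  case True
  have "(\<Sum>S\<in>{S. S \<subseteq> \<F> \<and> A \<in> S}. indicator (atom \<F> S) x :: real)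
      = (\<Sum>S\<in>{S. S \<subseteq> \<F> \<and> A \<in> S}. if S = {A \<in> \<F>. x \<in> A} then 1 else 0)"
    using True by (intro sum.cong) (auto simp: atom_def indicator_def)
  also have "\<dots> = indicator A x" using assms by (auto simp: indicator_def)
  finally show ?thesis by simp
next
  case False
  then show ?thesis using assms(2) by (auto simp: atom_def indicator_def)
qed

context isonormal_process
begin

text \<open>The sides of one rectangle are disjoint, but those of different summands may overlap.
  Writing each side as a union of atoms and expanding the products leaves monomials in pairwise
  orthogonal variables. A monomial with a repeated atom vanishes, since this atom would lie in two
  disjoint sides; here it matters that elementary kernels avoid the diagonals.\<close>

lemma elementary_integral_multilinear:
  assumes L: "is_elementary n L"
  obtains K :: "(real \<times> real) set set set" and h a where
    "finite K" "\<And>i. i \<in> K \<Longrightarrow> in_Lp 2 quadrant (h i)"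
    "\<And>i j. i \<in> K \<Longrightarrow> j \<in> K \<Longrightarrow> i \<noteq> j \<Longrightarrow> ip (h i) (h j) = 0"
    "AE \<omega> in M. elementary_integral W n L \<omega> = multilinear h K n a \<omega>"
proof -
  define \<F> where "\<F> = (\<Union>(c, A)\<in>set L. A ` {..<n})"
  have finF: "finite \<F>" by (auto simp: \<F>_def)
  have Fside: "fin_side A" if "A \<in> \<F>" for A
    using that L by (auto simp: \<F>_def is_elementary_def fin_side_def split: prod.splits)
  define h :: "(real \<times> real) set set \<Rightarrow> real \<times> real \<Rightarrow> real" where "h S = indicator (atom \<F> S)" for S
  have hL: "in_Lp 2 quadrant (h S)" if "S \<in> Pow \<F>" for S
    unfolding h_def by (intro in_Lp_2_indicator fin_side_atom finF Fside) (use that in auto)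
  have orth: "ip (h S) (h S') = 0" if "S \<in> Pow \<F>" "S' \<in> Pow \<F>" "S \<noteq> S'" for S S'
    using that atom_disjoint[OF that(3), of \<F>] fin_side_atom[OF finF Fside] unfolding h_def
    by (subst ip_indicator) auto
  define ml where "ml X \<longleftrightarrow> (\<exists>a. AE \<omega> in M. X \<omega> = multilinear h (Pow \<F>) n a \<omega>)" for X
  have ml_add: "ml (\<lambda>\<omega>. X \<omega> + Y \<omega>)" if XY: "ml X" "ml Y" for X Y
  proof -
    obtain a b where ab: "AE \<omega> in M. X \<omega> = multilinear h (Pow \<F>) n a \<omega>" "AE \<omega> in M. Y \<omega> = multilinear h (Pow \<F>) n b \<omega>"
      using XY by (auto simp: ml_def)
    have "AE \<omega> in M. X \<omega> + Y \<omega> = multilinear h (Pow \<F>) n (\<lambda>T. a T + b T) \<omega>"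
      using ab by eventually_elim (simp add: multilinear_def distrib_right sum.distrib)
    then show ?thesis unfolding ml_def by (intro exI[of _ "\<lambda>T. a T + b T"])
  qed
  have ml_cmult: "ml (\<lambda>\<omega>. c * X \<omega>)" if XY: "ml X" for X c
  proof -
    obtain a where a: "AE \<omega> in M. X \<omega> = multilinear h (Pow \<F>) n a \<omega>" using XY by (auto simp: ml_def)
    have "AE \<omega> in M. c * X \<omega> = multilinear h (Pow \<F>) n (\<lambda>T. c * a T) \<omega>"
      using a by eventually_elim (simp add: multilinear_def sum_distrib_left mult.assoc)
    then show ?thesis unfolding ml_def by (intro exI[of _ "\<lambda>T. c * a T"])
  qed
  have ml_0: "ml (\<lambda>\<omega>. 0)" unfolding ml_def by (rule exI[of _ "\<lambda>T. 0"]) (simp add: multilinear_def)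
  have ml_sum: "ml (\<lambda>\<omega>. \<Sum>i\<in>I. X i \<omega>)" if "finite I" "\<And>i. i \<in> I \<Longrightarrow> ml (X i)" for I :: "(nat \<Rightarrow> (real \<times> real) set set) set" and X
    using that by (induction I rule: finite_induct) (auto intro: ml_0 ml_add)
  have ml_cong: "ml X" if XY: "ml Y" "AE \<omega> in M. X \<omega> = Y \<omega>" for X Y
  proof -
    obtain a where a: "AE \<omega> in M. Y \<omega> = multilinear h (Pow \<F>) n a \<omega>" using XY by (auto simp: ml_def)
    have "AE \<omega> in M. X \<omega> = multilinear h (Pow \<F>) n a \<omega>" using a XY(2) by eventually_elim simp
    then show ?thesis unfolding ml_def by (intro exI[of _ a])
  qed
  have ml_mono: "ml (\<lambda>\<omega>. \<Prod>i\<in>T. W (h i) \<omega>)" if T: "T \<subseteq> Pow \<F>" "card T = n" for T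
  proof -
    have "multilinear h (Pow \<F>) n (\<lambda>U. if U = T then 1 else 0) \<omega> = (\<Prod>i\<in>T. W (h i) \<omega>)" for \<omega>
    proof -
      have "multilinear h (Pow \<F>) n (\<lambda>U. if U = T then 1 else 0) \<omega>
          = (\<Sum>U\<in>{U. U \<subseteq> Pow \<F> \<and> card U = n}. if U = T then \<Prod>i\<in>T. W (h i) \<omega> else 0)"
        unfolding multilinear_def by (intro sum.cong) auto
      also have "\<dots> = (\<Prod>i\<in>T. W (h i) \<omega>)" using T finF by (simp add: sum.delta)
      finally show ?thesis .
    qed
    then show ?thesis unfolding ml_def by (intro exI[of _ "\<lambda>U. if U = T then 1 else 0"]) simp
  qed
  have rect: "ml (rect_rv n A)" if A: "\<And>i. i < n \<Longrightarrow> A i \<in> \<F>" and dis: "disjoint_family_on A {..<n}" for A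
  proof -
    define KA where "KA i = {S. S \<subseteq> \<F> \<and> A i \<in> S}" for i
    have finKA: "finite (KA i)" for i unfolding KA_def using finF by simp
    have Wsum: "AE \<omega> in M. W (indicator (A i)) \<omega> = (\<Sum>S\<in>KA i. W (h S) \<omega>)" if i: "i < n" for i
    proof -
      have "indicator (A i) = (\<lambda>x. \<Sum>S\<in>KA i. h S x)"
        unfolding h_def KA_def using indicator_eq_sum_atoms[OF finF A[OF i]] by (intro ext)
      moreover have "AE \<omega> in M. W (\<lambda>x. \<Sum>S\<in>KA i. h S x) \<omega> = (\<Sum>S\<in>KA i. W (h S) \<omega>)"
        by (rule W_sum) (auto simp: KA_def intro: hL)
      ultimately show ?thesis by simp
    qed
    have "AE \<omega> in M. \<forall>i\<in>{..<n}. W (indicator (A i)) \<omega> = (\<Sum>S\<in>KA i. W (h S) \<omega>)"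
      by (intro AE_finite_allI Wsum) auto
    \<comment> \<open>The product of sums is distributed; \<open>\<phi>\<close> chooses an atom
      inside every side.\<close>
    then have "AE \<omega> in M. rect_rv n A \<omega> = (\<Sum>\<phi>\<in>Pi\<^sub>E {..<n} KA. \<Prod>i<n. W (h (\<phi> i)) \<omega>)"
    proof eventually_elim
      case (elim \<omega>)
      then have "rect_rv n A \<omega> = (\<Prod>i<n. \<Sum>S\<in>KA i. W (h S) \<omega>)" by (simp add: rect_rv_def)
      also have "\<dots> = (\<Sum>\<phi>\<in>Pi\<^sub>E {..<n} KA. \<Prod>i<n. W (h (\<phi> i)) \<omega>)"
        by (rule prod_sum_PiE) (auto intro: finKA)
      finally show ?case .
    qed
    moreover have "ml (\<lambda>\<omega>. \<Sum>\<phi>\<in>Pi\<^sub>E {..<n} KA. \<Prod>i<n. W (h (\<phi> i)) \<omega>)"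
    proof (rule ml_sum)
      show "finite (Pi\<^sub>E {..<n} KA)" by (intro finite_PiE finKA) simp
      fix \<phi> assume \<phi>: "\<phi> \<in> Pi\<^sub>E {..<n} KA"
      show "ml (\<lambda>\<omega>. \<Prod>i<n. W (h (\<phi> i)) \<omega>)"
      proof (cases "inj_on \<phi> {..<n}")
        case True
        have "ml (\<lambda>\<omega>. \<Prod>S\<in>\<phi> ` {..<n}. W (h S) \<omega>)"
          by (rule ml_mono) (use \<phi> card_image[OF True] in \<open>auto simp: KA_def PiE_iff\<close>)
        then show ?thesis by (simp add: prod.reindex[OF True])
      next
        case False
        then obtain i j where ij: "i < n" "j < n" "i \<noteq> j" "\<phi> i = \<phi> j" by (auto simp: inj_on_def)
        then have "A i \<in> \<phi> i" "A j \<in> \<phi> i" using \<phi> by (auto simp: KA_def PiE_iff)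
        moreover have "A i \<inter> A j = {}" using dis ij by (auto simp: disjoint_family_on_def)
        ultimately have "atom \<F> (\<phi> i) = {}" by (auto simp: atom_def)
        then have "h (\<phi> i) = (\<lambda>x. 0)" by (auto simp: h_def)
        then have "AE \<omega> in M. W (h (\<phi> i)) \<omega> = 0" using W_zero by simp
        then have "AE \<omega> in M. (\<Prod>i<n. W (h (\<phi> i)) \<omega>) = 0"
          by eventually_elim (use ij in \<open>auto intro: prod_zero\<close>)
        then show ?thesis by (rule ml_cong[OF ml_0])
      qed
    qed
    ultimately show ?thesis by (rule ml_cong[rotated])
  qed
  have "ml (elementary_integral W n L')" if "set L' \<subseteq> set L" for L'
    using that
  proof (induction L')
    case Nil
    then show ?case using ml_0 by (simp add: elementary_integral_Nil[abs_def])
  next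
    case (Cons x L')
    obtain c A where x: "x = (c, A)" by (cases x)
    then have cA: "(c, A) \<in> set L" using Cons.prems by simp
    have "ml (rect_rv n A)"
    proof (rule rect)
      show "A i \<in> \<F>" if "i < n" for i using cA that by (force simp: \<F>_def)
      show "disjoint_family_on A {..<n}" using cA L by (auto simp: is_elementary_def)
    qed
    then have "ml (\<lambda>\<omega>. c * rect_rv n A \<omega> + elementary_integral W n L' \<omega>)"
      by (intro ml_add ml_cmult Cons.IH) (use Cons.prems in auto)
    then show ?case by (simp add: x elementary_integral_Cons[abs_def])
  qed
  then have "ml (elementary_integral W n L)" by simp
  then obtain a where "AE \<omega> in M. elementary_integral W n L \<omega> = multilinear h (Pow \<F>) n a \<omega>" by (auto simp: ml_def)
  then show ?thesis using that[of "Pow \<F>" h a] hL orth finF by simp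
qed

lemma elementary_integral_hypercontractive:
  assumes L: "is_elementary n L" and k: "k \<ge> 1"
  shows "expectation (\<lambda>\<omega>. elementary_integral W n L \<omega> ^ (2 * k))
    \<le> (real (2 * k - 1) ^ n * expectation (\<lambda>\<omega>. (elementary_integral W n L \<omega>)\<^sup>2)) ^ k"
proof -
  obtain K :: "(real \<times> real) set set set" and h a where K: "finite K" "\<And>i. i \<in> K \<Longrightarrow> in_Lp 2 quadrant (h i)"
    "\<And>i j. i \<in> K \<Longrightarrow> j \<in> K \<Longrightarrow> i \<noteq> j \<Longrightarrow> ip (h i) (h j) = 0"
    and eq: "AE \<omega> in M. elementary_integral W n L \<omega> = multilinear h K n a \<omega>"
    using elementary_integral_multilinear[OF L] by blast
  note am = all_moments_elementary_integral[OF L] all_moments_multilinear[of K h n a, OF K(2)]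
  have "expectation (\<lambda>\<omega>. elementary_integral W n L \<omega> ^ m) = expectation (\<lambda>\<omega>. multilinear h K n a \<omega> ^ m)" for m
  proof (rule integral_cong_AE)
    show "AE \<omega> in M. elementary_integral W n L \<omega> ^ m = multilinear h K n a \<omega> ^ m"
      using eq by eventually_elim simp
  qed (use am in \<open>auto intro: all_moments_measurable all_moments_power\<close>)
  then show ?thesis using multilinear_hypercontractive[OF K(1) k K(2,3), where n=n and a=a] by simp
qed

text \<open>Fatou's lemma along the elementary approximants, whose bounds converge because their
  second moments do.\<close>

theorem wiener_integral_hypercontractive:
  assumes X: "has_wiener_integral M W n f X" and k: "k \<ge> 1"
  shows "integrable M (\<lambda>\<omega>. X \<omega> ^ (2 * k))"
    and "expectation (\<lambda>\<omega>. X \<omega> ^ (2 * k)) \<le> (real (2 * k - 1) ^ n * expectation (\<lambda>\<omega>. (X \<omega>)\<^sup>2)) ^ k"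
proof -
  obtain L where L: "\<And>k. is_elementary n (L k)" "Lp_tendsto 2 M (\<lambda>k. elementary_integral W n (L k)) X"
    using X unfolding has_wiener_integral_def by blast
  have Xm[measurable]: "X \<in> borel_measurable M" using Lp_tendsto_2_D(2)[OF L(2)] by (simp add: in_Lp_2_iff)
  define b where "b = (real (2 * k - 1) ^ n * expectation (\<lambda>\<omega>. (X \<omega>)\<^sup>2)) ^ k"
  have b0: "b \<ge> 0" by (simp add: b_def)
  have nn: "0 \<le> x ^ (2 * k)" for x :: real by (simp add: zero_le_even_power)
  have "(\<integral>\<^sup>+\<omega>. ennreal (X \<omega> ^ (2 * k)) \<partial>M) \<le> ennreal b"
  proof (rule Lp_tendsto_2_Fatou[OF L(2)])
    show "continuous_on UNIV (\<lambda>x :: real. x ^ (2 * k))" by (intro continuous_intros)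
    show "\<forall>\<^sub>F l in sequentially. (\<integral>\<^sup>+\<omega>. ennreal (elementary_integral W n (L l) \<omega> ^ (2 * k)) \<partial>M)
        \<le> ennreal ((real (2 * k - 1) ^ n * expectation (\<lambda>\<omega>. elementary_integral W n (L l) \<omega> * elementary_integral W n (L l) \<omega>)) ^ k)"
    proof (intro always_eventually allI)
      fix l
      have "(\<integral>\<^sup>+\<omega>. ennreal (elementary_integral W n (L l) \<omega> ^ (2 * k)) \<partial>M)
          = ennreal (expectation (\<lambda>\<omega>. elementary_integral W n (L l) \<omega> ^ (2 * k)))"
        using nn by (intro nn_integral_eq_integral all_moments_power_integrable all_moments_elementary_integral L) auto
      then show "(\<integral>\<^sup>+\<omega>. ennreal (elementary_integral W n (L l) \<omega> ^ (2 * k)) \<partial>M)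
        \<le> ennreal ((real (2 * k - 1) ^ n * expectation (\<lambda>\<omega>. elementary_integral W n (L l) \<omega> * elementary_integral W n (L l) \<omega>)) ^ k)"
        using elementary_integral_hypercontractive[OF L(1)[of l] k] by (simp add: ennreal_leI power2_eq_square)
    qed
    show "(\<lambda>l. (real (2 * k - 1) ^ n * expectation (\<lambda>\<omega>. elementary_integral W n (L l) \<omega> * elementary_integral W n (L l) \<omega>)) ^ k) \<longlonglongrightarrow> b"
      unfolding b_def power2_eq_square by (intro tendsto_power tendsto_mult tendsto_const Lp_tendsto_2_inner L)
  qed
  then have le: "(\<integral>\<^sup>+\<omega>. ennreal (X \<omega> ^ (2 * k)) \<partial>M) \<le> ennreal b" .
  then show i: "integrable M (\<lambda>\<omega>. X \<omega> ^ (2 * k))"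
    using nn by (intro integrableI_bounded) (auto simp: le_less_trans[OF le])
  have "expectation (\<lambda>\<omega>. X \<omega> ^ (2 * k)) \<le> b"
    using le b0 nn nn_integral_eq_integral[OF i] by simp
  then show "expectation (\<lambda>\<omega>. X \<omega> ^ (2 * k)) \<le> (real (2 * k - 1) ^ n * expectation (\<lambda>\<omega>. (X \<omega>)\<^sup>2)) ^ k"
    unfolding b_def .
qed

end

section \<open>The heat kernel and the chaos kernels\<close>

text \<open>The inequality \<open>1 + x \<le> exp x\<close> is too weak for the bound on the Poisson
  mode. The exponent \<open>u\<close> is such that already \<open>1 + u + u\<^sup>2 / 2\<close>
  exceeds \<open>1 + 1 / k\<close>, namely by \<open>1 / (2 * D\<^sup>2)\<close> with
  \<open>D = 2 * k * (k + 1)\<close>.\<close>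

lemma one_plus_inverse_le_exp:
  assumes "k \<ge> 1"
  shows "1 + 1 / real k \<le> exp (1 / real k - 1 / (2 * real k * (real k + 1)))"
proof -
  define u where "u = 1 / real k - 1 / (2 * real k * (real k + 1))"
  define c where "c = real k"
  have c: "c \<ge> 1" using assms by (simp add: c_def)
  define D where "D = 2 * c * (c + 1)"
  have D: "D > 0" using c by (simp add: D_def)
  have cD: "1 / c * D = 2 * c + 2" using c by (simp add: D_def)
  have "u = 1 / c - 1 / D" by (simp add: u_def c_def D_def)
  then have uD: "u * D = 2 * c + 1" using cD D by (simp add: left_diff_distrib)
  have "0 < 2 * c + 1" using c by simp
  then have u0: "u \<ge> 0" using uD D by (metis less_imp_le zero_less_mult_pos2)
  have "(u + u\<^sup>2 / 2 - 1 / c) * (2 * D\<^sup>2) = 2 * D * (u * D) + (u * D)\<^sup>2 - 2 * D * (1 / c * D)"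
    by (simp only: power2_eq_square) (simp add: algebra_simps)
  also have "\<dots> = 1" unfolding uD cD by (simp add: D_def power2_eq_square algebra_simps)
  finally have "0 \<le> u + u\<^sup>2 / 2 - 1 / c" using D by (smt (verit) mult_nonneg_nonneg mult_neg_pos zero_less_power)
  then have "1 + 1 / c \<le> 1 + u + u\<^sup>2 / 2" by simp
  also have "\<dots> \<le> exp u" by (rule exp_lower_Taylor_quadratic[OF u0])
  finally show ?thesis by (simp add: u_def c_def)
qed

text \<open>The correction in the exponent of \<open>one_plus_inverse_le_exp\<close> leaves a factor
  \<open>exp (- 1 / (k + 1))\<close>, which pays for the ratio \<open>(k + 2) / (k + 1)\<close>.
  This is the induction step for the Poisson mode.\<close>

lemma Suc_power_le_exp_2:
  "real (Suc k) ^ (2 * k) * real (k + 2) \<le> exp 2 * (real k ^ (2 * k) * real (k + 1))"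
proof (cases "k = 0")
  case True
  have "(2 :: real) \<le> exp 2" using exp_ge_add_one_self[of 2] by linarith
  then show ?thesis using True by simp
next
  case False
  define c where "c = real k"
  have c: "c \<ge> 1" using False by (simp add: c_def)
  have "(1 + 1 / c) ^ (2 * k) \<le> exp (1 / c - 1 / (2 * c * (c + 1))) ^ (2 * k)"
    using one_plus_inverse_le_exp[of k] False c by (intro power_mono) (auto simp: c_def)
  also have "\<dots> = exp (2 * c * (1 / c - 1 / (2 * c * (c + 1))))"
    by (subst exp_of_nat_mult[symmetric]) (simp add: c_def)
  also have "2 * c * (1 / c - 1 / (2 * c * (c + 1))) = 2 - 1 / (c + 1)"
    using c by (simp add: right_diff_distrib)
  finally have 1: "(1 + 1 / c) ^ (2 * k) \<le> exp (2 - 1 / (c + 1))" .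
  have 2: "(c + 2) / (c + 1) \<le> exp (1 / (c + 1))"
    using exp_ge_add_one_self[of "1 / (c + 1)"] c by (simp add: field_simps)
  have "(1 + 1 / c) ^ (2 * k) * ((c + 2) / (c + 1)) \<le> exp (2 - 1 / (c + 1)) * exp (1 / (c + 1))"
    by (intro mult_mono 1 2) (use c in auto)
  also have "\<dots> = exp 2" by (simp add: exp_add[symmetric])
  finally have "(1 + 1 / c) ^ (2 * k) * ((c + 2) / (c + 1)) * (c ^ (2 * k) * (c + 1)) \<le> exp 2 * (c ^ (2 * k) * (c + 1))"
    using c by (intro mult_right_mono) auto
  moreover have "(1 + 1 / c) ^ (2 * k) * c ^ (2 * k) = (c + 1) ^ (2 * k)"
    using c by (simp add: power_mult_distrib[symmetric] field_simps)
  moreover have "A * ((c + 2) / (c + 1)) * (B * (c + 1)) = (A * B) * (c + 2)" for A B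
  proof -
    have "A * ((c + 2) / (c + 1)) * (B * (c + 1)) = (A * B) * ((c + 2) / (c + 1) * (c + 1))"
      by (simp only: mult_ac)
    also have "(c + 2) / (c + 1) * (c + 1) = c + 2" using c by simp
    finally show ?thesis .
  qed
  ultimately have "(c + 1) ^ (2 * k) * (c + 2) \<le> exp 2 * (c ^ (2 * k) * (c + 1))"
    by simp
  then show ?thesis by (simp add: c_def add.commute)
qed

text \<open>A form of Stirling's bound that holds for every \<open>k\<close>, where
  \<open>0 ^ 0 = 1\<close> covers \<open>k = 0\<close>. The square replaces the root of
  \<open>k + 1\<close> by an integer power, which suits the induction.\<close>

lemma poisson_mode_bound: "(real k ^ k * exp (- real k) / fact k)\<^sup>2 * real (k + 1) \<le> 1"
proof (induction k)
  case 0
  then show ?case by simp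
next
  case (Suc k)
  define c where "c = real (Suc k)"
  define e where "e = exp (- real k)"
  define F where "F = (fact k :: real)"
  have pos: "c > 0" "F > 0" by (simp_all add: c_def F_def)
  have "exp (- c) = e * exp (- 1)" by (simp add: c_def e_def exp_add[symmetric])
  then have "(c ^ Suc k * exp (- c) / fact (Suc k))\<^sup>2 * real (Suc k + 1) = ((c * (c ^ k * (e * exp (- 1)))) / (c * F))\<^sup>2 * real (k + 2)"
    by (simp add: c_def F_def mult.assoc)
  also have "\<dots> = (c ^ k * (e * exp (- 1)) / F)\<^sup>2 * real (k + 2)" using pos by simp
  also have "\<dots> = (c ^ k * c ^ k * real (k + 2)) * (e\<^sup>2 * (exp (- 1))\<^sup>2 / F\<^sup>2)"
    by (simp add: power2_eq_square mult_ac)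
  also have "c ^ k * c ^ k = c ^ (2 * k)" by (simp add: mult_2 power_add)
  also have "(exp (- 1))\<^sup>2 = exp (- 2 :: real)" by (simp add: power2_eq_square exp_add[symmetric])
  also have "(c ^ (2 * k) * real (k + 2)) * (e\<^sup>2 * exp (- 2) / F\<^sup>2)
      \<le> (exp 2 * (real k ^ (2 * k) * real (k + 1))) * (e\<^sup>2 * exp (- 2) / F\<^sup>2)"
    unfolding c_def by (intro mult_right_mono Suc_power_le_exp_2) auto
  also have "\<dots> = (exp 2 * exp (- 2)) * ((real k ^ (2 * k) * real (k + 1)) * (e\<^sup>2 / F\<^sup>2))"
    by (simp only: times_divide_eq_right times_divide_eq_left mult_ac)
  also have "exp 2 * exp (- 2) = (1 :: real)" by (simp add: exp_add[symmetric])
  also have "1 * ((real k ^ (2 * k) * real (k + 1)) * (e\<^sup>2 / F\<^sup>2)) = (real k ^ k * exp (- real k) / fact k)\<^sup>2 * real (k + 1)"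
    by (simp add: e_def F_def power_mult_distrib power_divide power_even_eq)
  also have "\<dots> \<le> 1" by (rule Suc.IH)
  finally show ?case unfolding c_def .
qed

text \<open>The weight is largest at \<open>y = k\<close>, by \<open>x \<le> exp (x - 1)\<close> for
  \<open>x = y / k\<close>, and there the bound for the mode applies.\<close>

lemma poisson_weight_bound:
  assumes "y \<ge> 0"
  shows "y ^ k * exp (- y) / fact k \<le> 1 / sqrt (real (k + 1))"
proof -
  have "y ^ k * exp (- y) \<le> real k ^ k * exp (- real k)"
  proof (cases "k = 0")
    case True
    then show ?thesis using assms by simp
  next
    case False
    have "y / real k \<le> exp (y / real k - 1)" using exp_ge_add_one_self[of "y / real k - 1"] by simp
    then have "(y / real k) ^ k \<le> exp (y / real k - 1) ^ k" using assms by (intro power_mono) auto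
    also have "\<dots> = exp (real k * (y / real k - 1))" by (rule exp_of_nat_mult[symmetric])
    also have "real k * (y / real k - 1) = y - real k" using False by (simp add: field_simps)
    finally have "y ^ k \<le> exp (y - real k) * real k ^ k" using False by (simp add: power_divide pos_divide_le_eq)
    then have "y ^ k * exp (- y) \<le> exp (y - real k) * real k ^ k * exp (- y)" by (intro mult_right_mono) auto
    also have "\<dots> = real k ^ k * exp (- real k)" by (simp add: exp_diff exp_minus field_simps)
    finally show ?thesis .
  qed
  then have "y ^ k * exp (- y) / fact k \<le> real k ^ k * exp (- real k) / fact k" by (intro divide_right_mono) auto
  also have "\<dots> = sqrt ((real k ^ k * exp (- real k) / fact k)\<^sup>2)" by simp
  also have "\<dots> \<le> sqrt (1 / real (k + 1))"
    using poisson_mode_bound[of k] by (intro real_sqrt_le_mono) (simp add: pos_le_divide_eq)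
  also have "\<dots> = 1 / sqrt (real (k + 1))" by (simp add: real_sqrt_divide)
  finally show ?thesis .
qed

section \<open>The heat kernel as a Poisson mixture of Erlang densities\<close>

definition poisson_weight :: "real \<Rightarrow> nat \<Rightarrow> real" where
  "poisson_weight a m = exp (- a) * a ^ m / fact m"

lemma poisson_weight_nonneg: "a \<ge> 0 \<Longrightarrow> poisson_weight a m \<ge> 0"
  by (simp add: poisson_weight_def)

lemma poisson_weight_sums: "poisson_weight a sums 1"
proof -
  have "(\<lambda>m. exp (- a) * (a ^ m / fact m)) sums (exp (- a) * exp a)"
    using exp_converges[of a] by (intro sums_mult) (simp add: divide_inverse mult.commute)
  then show ?thesis by (simp add: poisson_weight_def[abs_def] exp_add[symmetric])
qed

lemma poisson_weight_shift:
  assumes "a \<ge> 0"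
  shows "summable (\<lambda>k. poisson_weight a (k + m))" "(\<Sum>k. poisson_weight a (k + m)) \<le> 1"
proof -
  note s = sums_summable[OF poisson_weight_sums[of a]]
  show "summable (\<lambda>k. poisson_weight a (k + m))" using s by (rule summable_ignore_initial_segment)
  have "(\<Sum>k. poisson_weight a (k + m)) = 1 - (\<Sum>k<m. poisson_weight a k)"
    using suminf_minus_initial_segment[OF s, of m] sums_unique[OF poisson_weight_sums[of a]] by simp
  also have "\<dots> \<le> 1" using poisson_weight_nonneg[OF assms] by (simp add: sum_nonneg)
  finally show "(\<Sum>k. poisson_weight a (k + m)) \<le> 1" .
qed

text \<open>Comparison with the exponential series of \<open>(x / 2)\<^sup>2\<close>. Convergence is
  settled here, since the infinite sum in \<open>bessel_I\<close> does not include it.\<close>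

lemma bessel_I_1_sums:
  "(\<lambda>k. (x / 2) ^ (2 * k + 1) / (fact k * fact (k + 1))) sums bessel_I 1 x"
proof -
  have "summable (\<lambda>k. (x / 2) ^ (2 * k + 1) / (fact k * fact (k + 1)))"
  proof (rule summable_comparison_test')
    show "summable (\<lambda>k. \<bar>x / 2\<bar> * (((x / 2)\<^sup>2) ^ k / fact k))"
    proof (rule summable_mult)
      show "summable (\<lambda>k. ((x / 2)\<^sup>2) ^ k / fact k)"
        using summable_exp[of "(x / 2)\<^sup>2"] by (simp only: divide_inverse mult.commute)
    qed
    fix k :: nat
    have p: "(x / 2) ^ (2 * k + 1) = (x / 2) * ((x / 2)\<^sup>2) ^ k" by (simp only: power_add power_mult power_one_right) (rule mult.commute)
    have "norm ((x / 2) ^ (2 * k + 1) / (fact k * fact (k + 1))) = \<bar>x / 2\<bar> * (((x / 2)\<^sup>2) ^ k / fact k) / fact (k + 1)"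
      unfolding p by (simp add: abs_mult del: fact_Suc)
    also have "\<dots> \<le> \<bar>x / 2\<bar> * (((x / 2)\<^sup>2) ^ k / fact k) / 1"
      by (intro divide_left_mono) (auto simp: fact_ge_1 simp del: fact_Suc)
    finally show "norm ((x / 2) ^ (2 * k + 1) / (fact k * fact (k + 1))) \<le> \<bar>x / 2\<bar> * (((x / 2)\<^sup>2) ^ k / fact k)" by simp
  qed
  then show ?thesis by (simp add: bessel_I_def summable_sums)
qed

text \<open>Termwise, the Bessel series is a mixture of the Erlang densities of shape
  \<open>k + 1\<close> and rate \<open>1 / t\<close>, with the Poisson probabilities of mean
  \<open>z / t\<close> at \<open>k + 1\<close>. The missing probability at 0 is the mass absorbed at
  the boundary. Positivity and both estimates of the kernel rest on this form.\<close>

lemma q0_sums: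
  assumes "z > 0" "w > 0" "t > 0"
  shows "(\<lambda>k. poisson_weight (z / t) (k + 1) * erlang_density k (1 / t) w) sums q0 z w t"
proof -
  define c where "c = sqrt (z / w) * (exp (- (z + w) / t) / t)"
  define s where "s = sqrt (z * w) / t"
  have s2: "s\<^sup>2 = (z / t) * (w / t)" using assms by (simp add: s_def power_divide power2_eq_square)
  have s1: "sqrt (z / w) * s = z / t" using assms by (simp add: s_def real_sqrt_divide real_sqrt_mult field_simps)
  have "(\<lambda>k. c * (((2 * sqrt (z * w) / t) / 2) ^ (2 * k + 1) / (fact k * fact (k + 1)))) sums (c * bessel_I 1 (2 * sqrt (z * w) / t))"
    by (rule sums_mult[OF bessel_I_1_sums])
  also have "c * bessel_I 1 (2 * sqrt (z * w) / t) = q0 z w t" by (simp add: c_def q0_def)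
  also have "(\<lambda>k. c * (((2 * sqrt (z * w) / t) / 2) ^ (2 * k + 1) / (fact k * fact (k + 1))))
      = (\<lambda>k. poisson_weight (z / t) (k + 1) * erlang_density k (1 / t) w)"
  proof
    fix k
    have h: "(2 * sqrt (z * w) / t) / 2 = s" by (simp add: s_def)
    have e: "exp (- (z + w) / t) = exp (- (z / t)) * exp (- (w / t))"
      by (simp add: exp_add[symmetric] add_divide_distrib diff_divide_distrib)
    have "c * (s ^ (2 * k + 1) / (fact k * fact (k + 1)))
        = (sqrt (z / w) * s) * (s\<^sup>2) ^ k * (exp (- (z / t)) * exp (- (w / t)) / t) / (fact k * fact (k + 1))"
      unfolding c_def e by (simp add: power_mult[symmetric] power_add)
    also have "\<dots> = (z / t) * ((z / t) ^ k * (w / t) ^ k) * (exp (- (z / t)) * exp (- (w / t)) / t) / (fact k * fact (k + 1))"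
      unfolding s1 s2 power_mult_distrib ..
    also have "\<dots> = (exp (- (z / t)) * (z / t) ^ (k + 1) / fact (k + 1)) * ((1 / t) * (w / t) ^ k * exp (- (w / t)) / fact k)"
      by (simp add: mult_ac del: fact_Suc)
    also have "(1 / t) * (w / t) ^ k * exp (- (w / t)) / fact k = erlang_density k (1 / t) w"
      using assms by (simp add: erlang_density_def power_divide)
    finally show "c * (((2 * sqrt (z * w) / t) / 2) ^ (2 * k + 1) / (fact k * fact (k + 1)))
      = poisson_weight (z / t) (k + 1) * erlang_density k (1 / t) w"
      unfolding h by (simp add: poisson_weight_def del: fact_Suc)
  qed
  finally show ?thesis .
qed

lemma q0_nonneg: "z > 0 \<Longrightarrow> w > 0 \<Longrightarrow> t > 0 \<Longrightarrow> q0 z w t \<ge> 0"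
  by (rule sums_le[OF _ sums_zero q0_sums]) (auto intro!: mult_nonneg_nonneg poisson_weight_nonneg)

text \<open>The Erlang densities of shape \<open>k + 1\<close> are bounded by \<open>1 / (t * sqrt (k + 1))\<close>. For a Poisson
  variable \<open>N\<close> of mean \<open>a\<close>, the mean of \<open>1 / sqrt N\<close> on \<open>N > 0\<close> is at most \<open>2 / sqrt a\<close>, because
  \<open>2 / sqrt N \<le> 1 / sqrt a + sqrt a / N\<close> and the mean of \<open>1 / (N + 1)\<close> is at most \<open>1 / a\<close>.\<close>

lemma q0_bound:
  assumes "z > 0" "w > 0" "t > 0"
  shows "q0 z w t \<le> 2 / sqrt (z * t)"
proof -
  define a where "a = z / t"
  have a: "a > 0" using assms by (simp add: a_def)
  note sm = poisson_weight_shift[OF less_imp_le[OF a]]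
  have summand_le: "poisson_weight a (k + 1) * erlang_density k (1 / t) w
      \<le> (1 / t) * ((1 / (2 * sqrt a)) * poisson_weight a (k + 1) + (1 / sqrt a) * poisson_weight a (k + 2))" for k
  proof -
    define r where "r = sqrt (real (k + 1))"
    have r: "r > 0" "r\<^sup>2 = real (k + 1)" by (auto simp: r_def)
    have sa: "sqrt a > 0" "(sqrt a)\<^sup>2 = a" using a by auto
    have "erlang_density k (1 / t) w = (1 / t) * ((w / t) ^ k * exp (- (w / t)) / fact k)"
      using assms by (simp add: erlang_density_def power_divide)
    also have "\<dots> \<le> (1 / t) * (1 / r)"
      unfolding r_def using assms by (intro mult_left_mono poisson_weight_bound) auto
    \<comment> \<open>Arithmetic-geometric mean inequality, sharp where \<open>k + 1 = a\<close>,
      that is, near the mean of the Poisson law.\<close>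
    also have "\<dots> \<le> (1 / t) * (1 / (2 * sqrt a) + sqrt a / (2 * r\<^sup>2))"
    proof (intro mult_left_mono)
      have "0 \<le> (r - sqrt a)\<^sup>2" by simp
      then have "2 * sqrt a * r \<le> r\<^sup>2 + (sqrt a)\<^sup>2" by (simp add: power2_eq_square algebra_simps)
      then show "1 / r \<le> 1 / (2 * sqrt a) + sqrt a / (2 * r\<^sup>2)"
        using r(1) sa(1) by (simp add: field_simps power2_eq_square)
    qed (use assms in auto)
    \<comment> \<open>By \<open>k + 2 \<le> 2 * (k + 1)\<close>; the denominator
      \<open>k + 2\<close> is the one that turns the Poisson weight at \<open>k + 1\<close> into
      that at \<open>k + 2\<close>.\<close>
    also have "\<dots> \<le> (1 / t) * (1 / (2 * sqrt a) + sqrt a / real (k + 2))"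
      unfolding r(2) using assms sa by (intro mult_left_mono add_left_mono divide_left_mono) auto
    finally have "poisson_weight a (k + 1) * erlang_density k (1 / t) w
        \<le> poisson_weight a (k + 1) * ((1 / t) * (1 / (2 * sqrt a) + sqrt a / real (k + 2)))"
      using a by (intro mult_left_mono poisson_weight_nonneg) auto
    also have "\<dots> = (1 / t) * ((1 / (2 * sqrt a)) * poisson_weight a (k + 1) + sqrt a * (poisson_weight a (k + 1) / real (k + 2)))"
      by (simp add: algebra_simps)
    also have "poisson_weight a (k + 1) / real (k + 2) = poisson_weight a (k + 2) / a"
      using a by (simp add: poisson_weight_def)
    also have "sqrt a * (poisson_weight a (k + 2) / a) = (1 / sqrt a) * poisson_weight a (k + 2)"
      using a by (simp add: real_divide_square_eq field_simps)
    finally show ?thesis .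
  qed
  have "q0 z w t \<le> (\<Sum>k. (1 / t) * ((1 / (2 * sqrt a)) * poisson_weight a (k + 1) + (1 / sqrt a) * poisson_weight a (k + 2)))"
    using sums_unique[OF q0_sums[OF assms]] sums_summable[OF q0_sums[OF assms]]
    by (simp only: a_def[symmetric]) (intro suminf_le summand_le summable_mult summable_add sm)
  also have "\<dots> = (1 / t) * ((1 / (2 * sqrt a)) * (\<Sum>k. poisson_weight a (k + 1)) + (1 / sqrt a) * (\<Sum>k. poisson_weight a (k + 2)))"
    by (simp only: suminf_mult suminf_add[symmetric] summable_mult summable_add sm)
  also have "\<dots> \<le> (1 / t) * ((1 / (2 * sqrt a)) * 1 + (1 / sqrt a) * 1)"
    using assms a by (intro mult_left_mono add_mono sm) auto
  \<comment> \<open>The sum of \<open>1/2\<close> and \<open>1\<close> is rounded up to 2.\<close>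
  also have "\<dots> \<le> (1 / t) * (2 / sqrt a)" using assms a by (intro mult_left_mono) (auto simp: field_simps)
  also have "\<dots> = 2 / sqrt (z * t)"
    using assms by (simp add: a_def real_sqrt_divide real_sqrt_mult field_simps)
  finally show ?thesis .
qed

lemma measurable_bessel_I [measurable]: "bessel_I m \<in> borel_measurable borel"
  unfolding bessel_I_def[abs_def] by measurable

lemma measurable_q0 [measurable (raw)]:
  assumes [measurable]: "f \<in> borel_measurable N" "g \<in> borel_measurable N" "h \<in> borel_measurable N"
  shows "(\<lambda>x. q0 (f x) (g x) (h x)) \<in> borel_measurable N"
  unfolding q0_def by measurable

text \<open>Each Erlang density has mass 1, so the mass of the mixture is the sum of the Poisson
  weights from 1 on.\<close>

lemma nn_integral_q0_le_1:
  assumes "z > 0" "t > 0"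
  shows "(\<integral>\<^sup>+w. ennreal (q0 z w t) * indicator {0<..} w \<partial>lborel) \<le> 1"
proof -
  define a where "a = z / t"
  have a: "a \<ge> 0" using assms by (simp add: a_def)
  note sm = poisson_weight_shift[OF a]
  have "(\<integral>\<^sup>+w. ennreal (q0 z w t) * indicator {0<..} w \<partial>lborel)
      \<le> (\<integral>\<^sup>+w. (\<Sum>k. ennreal (poisson_weight a (k + 1)) * ennreal (erlang_density k (1 / t) w)) \<partial>lborel)"
  proof (rule nn_integral_mono)
    fix w :: real
    show "ennreal (q0 z w t) * indicator {0<..} w \<le> (\<Sum>k. ennreal (poisson_weight a (k + 1)) * ennreal (erlang_density k (1 / t) w))"
    proof (cases "w > 0")
      case True
      note s = q0_sums[OF assms(1) True assms(2), folded a_def]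
      have "(\<Sum>k. ennreal (poisson_weight a (k + 1) * erlang_density k (1 / t) w)) = ennreal (q0 z w t)"
        unfolding sums_unique[OF s]
        by (rule suminf_ennreal2[OF _ sums_summable[OF s]]) (use assms a in \<open>auto intro!: mult_nonneg_nonneg poisson_weight_nonneg\<close>)
      then show ?thesis using assms a True by (simp add: ennreal_mult poisson_weight_nonneg)
    qed simp
  qed
  also have "\<dots> = (\<Sum>k. \<integral>\<^sup>+w. ennreal (poisson_weight a (k + 1)) * ennreal (erlang_density k (1 / t) w) \<partial>lborel)"
    by (rule nn_integral_suminf) simp
  also have "\<dots> = (\<Sum>k. ennreal (poisson_weight a (k + 1)))"
  proof (rule suminf_cong)
    fix k
    have "(\<integral>\<^sup>+w. ennreal (erlang_density k (1 / t) w) \<partial>lborel) = 1"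
      using nn_integral_erlang_ith_moment[of "1 / t" k 0] assms by simp
    then show "(\<integral>\<^sup>+w. ennreal (poisson_weight a (k + 1)) * ennreal (erlang_density k (1 / t) w) \<partial>lborel) = ennreal (poisson_weight a (k + 1))"
      by (subst nn_integral_cmult) auto
  qed
  also have "\<dots> = ennreal (\<Sum>k. poisson_weight a (k + 1))"
    by (rule suminf_ennreal2[OF poisson_weight_nonneg[OF a] sm(1)])
  also have "\<dots> \<le> 1" using sm(2)[of 1] by simp
  finally show ?thesis .
qed

lemma nn_integral_q0_square:
  assumes "z > 0" "t > 0"
  shows "(\<integral>\<^sup>+w. ennreal ((q0 z w t)\<^sup>2) * indicator {0<..} w \<partial>lborel) \<le> ennreal (2 / sqrt (z * t))"
proof -
  have "(\<integral>\<^sup>+w. ennreal ((q0 z w t)\<^sup>2) * indicator {0<..} w \<partial>lborel)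
      \<le> (\<integral>\<^sup>+w. ennreal (2 / sqrt (z * t)) * (ennreal (q0 z w t) * indicator {0<..} w) \<partial>lborel)"
  proof (rule nn_integral_mono)
    fix w :: real
    show "ennreal ((q0 z w t)\<^sup>2) * indicator {0<..} w \<le> ennreal (2 / sqrt (z * t)) * (ennreal (q0 z w t) * indicator {0<..} w)"
    proof (cases "w > 0")
      case True
      have "(q0 z w t)\<^sup>2 \<le> 2 / sqrt (z * t) * q0 z w t"
        unfolding power2_eq_square using assms True by (intro mult_right_mono q0_bound q0_nonneg)
      then show ?thesis using assms True q0_nonneg[OF assms(1) True assms(2)]
        by (simp add: ennreal_mult[symmetric])
    qed simp
  qed
  also have "\<dots> = ennreal (2 / sqrt (z * t)) * (\<integral>\<^sup>+w. ennreal (q0 z w t) * indicator {0<..} w \<partial>lborel)"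
    by (rule nn_integral_cmult) simp
  also have "\<dots> \<le> ennreal (2 / sqrt (z * t)) * 1" by (intro mult_left_mono nn_integral_q0_le_1 assms) simp
  finally show ?thesis by simp
qed

lemma u0_bounds:
  assumes "z > 0" "t > 0"
  shows "0 \<le> u0 z t" "u0 z t \<le> 1"
proof -
  have eq: "u0 z t = (\<integral>w. indicator {0<..} w * q0 z w t \<partial>lborel)"
    by (simp add: u0_def set_lebesgue_integral_def)
  have nn: "0 \<le> indicator {0<..} w * q0 z w t" for w
    using q0_nonneg[OF assms(1) _ assms(2)] by (auto simp: indicator_def)
  show "0 \<le> u0 z t" unfolding eq using nn by simp
  have "ennreal (\<integral>w. indicator {0<..} w * q0 z w t \<partial>lborel) \<le> (\<integral>\<^sup>+w. ennreal (indicator {0<..} w * q0 z w t) \<partial>lborel)"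
  proof (cases "integrable lborel (\<lambda>w. indicator {0<..} w * q0 z w t)")
    case True
    then show ?thesis using nn by (subst nn_integral_eq_integral) auto
  next
    case False
    \<comment> \<open>Without integrability the Bochner integral is 0 by convention, and the
      inequality is trivial.\<close>
    then show ?thesis by (simp add: not_integrable_integral_eq)
  qed
  also have "\<dots> = (\<integral>\<^sup>+w. ennreal (q0 z w t) * indicator {0<..} w \<partial>lborel)"
    by (intro nn_integral_cong) (auto simp: indicator_def)
  also have "\<dots> \<le> 1" by (rule nn_integral_q0_le_1[OF assms])
  finally show "u0 z t \<le> 1" unfolding eq by simp
qed

lemma measurable_u0 [measurable (raw)]:
  assumes [measurable]: "f \<in> borel_measurable N" "g \<in> borel_measurable N"
  shows "(\<lambda>x. u0 (f x) (g x)) \<in> borel_measurable N"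
  unfolding u0_def set_lebesgue_integral_def by measurable

section \<open>Measurability and norms of the chaos kernels\<close>

lemma measurable_quadrant_borel: "X \<in> N \<rightarrow>\<^sub>M quadrant \<Longrightarrow> X \<in> N \<rightarrow>\<^sub>M borel"
  unfolding quadrant_def by (auto simp: measurable_restrict_space2_iff)

text \<open>The end point depends on the parameter as well, because the recursion moves it to the
  last point of the configuration.\<close>

lemma measurable_chaos_kernel:
  assumes "f \<in> borel_measurable N" "g \<in> borel_measurable N" and X: "\<And>i. i < n \<Longrightarrow> (\<lambda>\<omega>. X \<omega> i) \<in> N \<rightarrow>\<^sub>M quadrant"
  shows "(\<lambda>\<omega>. chaos_kernel \<beta> n (f \<omega>) (g \<omega>) (X \<omega>)) \<in> borel_measurable N"
  using assms
proof (induction n arbitrary: f g)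
  case 0
  then show ?case by simp
next
  case (Suc n)
  have "(\<lambda>\<omega>. X \<omega> n) \<in> N \<rightarrow>\<^sub>M borel \<Otimes>\<^sub>M borel"
    using measurable_quadrant_borel[OF Suc.prems(3)[of n]] by (simp add: borel_prod)
  then have m[measurable]: "(\<lambda>\<omega>. fst (X \<omega> n)) \<in> borel_measurable N" "(\<lambda>\<omega>. snd (X \<omega> n)) \<in> borel_measurable N"
    by (auto dest: measurable_compose[OF _ measurable_fst] measurable_compose[OF _ measurable_snd])
  note [measurable] = Suc.prems(1,2)
  have [measurable]: "(\<lambda>\<omega>. chaos_kernel \<beta> n (fst (X \<omega> n)) (snd (X \<omega> n)) (X \<omega>)) \<in> borel_measurable N"
    by (rule Suc.IH[OF m]) (use Suc.prems(3) in auto)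
  have "(\<lambda>\<omega>. indicator {0<..<g \<omega>} (snd (X \<omega> n)) :: real) = (\<lambda>\<omega>. if 0 < snd (X \<omega> n) \<and> snd (X \<omega> n) < g \<omega> then 1 else 0)"
    by (auto simp: indicator_def)
  moreover have "(\<lambda>\<omega>. if 0 < snd (X \<omega> n) \<and> snd (X \<omega> n) < g \<omega> then 1 else 0 :: real) \<in> borel_measurable N" by measurable
  ultimately have [measurable]: "(\<lambda>\<omega>. indicator {0<..<g \<omega>} (snd (X \<omega> n)) :: real) \<in> borel_measurable N" by simp
  show ?case by (simp add: split_beta)
qed

lemma chaos_kernel_cong: "(\<And>i. i < n \<Longrightarrow> x i = y i) \<Longrightarrow> chaos_kernel \<beta> n z t x = chaos_kernel \<beta> n z t y"
  by (induction n arbitrary: z t) (auto split: prod.splits)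

text \<open>Space is the inner integral and time the outer one: the heat kernel is estimated in
  space first, and the rest is a Beta integral in time.\<close>

lemma nn_integral_quadrant:
  assumes [measurable]: "f \<in> borel_measurable (borel \<Otimes>\<^sub>M borel)"
  shows "(\<integral>\<^sup>+x. f x \<partial>quadrant) = (\<integral>\<^sup>+\<tau>. (\<integral>\<^sup>+w. f (w, \<tau>) * indicator {0<..} w \<partial>lborel) * indicator {0<..} \<tau> \<partial>lborel)"
proof -
  have "(\<integral>\<^sup>+x. f x \<partial>quadrant) = (\<integral>\<^sup>+x. f x * indicator ({0<..} \<times> {0<..}) x \<partial>lborel)"
    unfolding quadrant_def by (rule nn_integral_restrict_space) (simp add: quadrant_open)
  also have "\<dots> = (\<integral>\<^sup>+x. f x * indicator ({0<..} \<times> {0<..}) x \<partial>(lborel \<Otimes>\<^sub>M lborel))" by (simp add: lborel_prod)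
  also have "\<dots> = (\<integral>\<^sup>+\<tau>. (\<integral>\<^sup>+w. f (w, \<tau>) * indicator ({0<..} \<times> {0<..}) (w, \<tau>) \<partial>lborel) \<partial>lborel)"
    by (subst lborel_pair.nn_integral_snd[symmetric]) (auto simp: split_beta')
  also have "\<dots> = (\<integral>\<^sup>+\<tau>. (\<integral>\<^sup>+w. (f (w, \<tau>) * indicator {0<..} w) * indicator {0<..} \<tau> \<partial>lborel) \<partial>lborel)"
    by (intro nn_integral_cong) (auto simp: indicator_def)
  also have "\<dots> = (\<integral>\<^sup>+\<tau>. (\<integral>\<^sup>+w. f (w, \<tau>) * indicator {0<..} w \<partial>lborel) * indicator {0<..} \<tau> \<partial>lborel)"
    by (intro nn_integral_cong nn_integral_multc) simp
  finally show ?thesis .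
qed

lemma nn_integral_Beta_scaled:
  fixes a b t :: real
  assumes "a > 0" "b > 0" "t > 0"
  shows "(\<integral>\<^sup>+s. ennreal (s powr (a - 1) * (t - s) powr (b - 1)) * indicator {0<..<t} s \<partial>lborel)
    = ennreal (Beta a b * t powr (a + b - 1))"
proof -
  have has: "((\<lambda>x. x powr (a - 1) * (1 - x) powr (b - 1)) has_integral Beta a b) {0<..<1}"
    using has_integral_Beta_real[OF assms(1,2)] by (simp add: has_integral_Icc_iff_Ioo)
  have hi: "((\<lambda>x. indicator {0<..<1} x * (x powr (a - 1) * (1 - x) powr (b - 1))) has_integral Beta a b) UNIV"
  proof -
    have "(\<lambda>x. indicator {0<..<1} x * (x powr (a - 1) * (1 - x) powr (b - 1)))
        = (\<lambda>x. if x \<in> {0<..<1} then x powr (a - 1) * (1 - x) powr (b - 1) else 0)"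
      by (auto simp: indicator_def)
    with has show ?thesis by (simp only: has_integral_restrict_UNIV)
  qed
  have unit: "(\<integral>\<^sup>+x. ennreal (indicator {0<..<1} x * (x powr (a - 1) * (1 - x) powr (b - 1))) \<partial>lborel) = ennreal (Beta a b)"
    by (rule nn_integral_has_integral_lborel[OF _ _ hi]) auto
  have scaled: "ennreal ((0 + t * x) powr (a - 1) * (t - (0 + t * x)) powr (b - 1)) * indicator {0<..<t} (0 + t * x)
        = ennreal (t powr (a + b - 2)) * ennreal (indicator {0<..<1} x * (x powr (a - 1) * (1 - x) powr (b - 1)))" for x :: real
    proof (cases "0 < x \<and> x < 1")
      case True
      have "t - t * x = t * (1 - x)" by (simp add: algebra_simps)
      then have "(t * x) powr (a - 1) * (t - t * x) powr (b - 1) = t powr (a + b - 2) * (x powr (a - 1) * (1 - x) powr (b - 1))"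
        using True assms by (simp add: powr_mult powr_add[symmetric] mult_ac)
      then show ?thesis using True assms by (simp add: ennreal_mult[symmetric])
    next
      case False
      then have "t * x \<notin> {0<..<t}" using assms by (auto simp: zero_less_mult_iff)
      then show ?thesis using False by auto
    qed
  have "(\<integral>\<^sup>+s. ennreal (s powr (a - 1) * (t - s) powr (b - 1)) * indicator {0<..<t} s \<partial>lborel)
      = ennreal \<bar>t\<bar> * (\<integral>\<^sup>+x. ennreal ((0 + t * x) powr (a - 1) * (t - (0 + t * x)) powr (b - 1)) * indicator {0<..<t} (0 + t * x) \<partial>lborel)"
    by (rule nn_integral_real_affine) (use assms in auto)
  also have "\<dots> = ennreal \<bar>t\<bar> * (\<integral>\<^sup>+x. ennreal (t powr (a + b - 2)) * ennreal (indicator {0<..<1} x * (x powr (a - 1) * (1 - x) powr (b - 1))) \<partial>lborel)"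
    by (simp only: scaled)
  also have "\<dots> = ennreal \<bar>t\<bar> * (ennreal (t powr (a + b - 2)) * ennreal (Beta a b))"
    by (subst nn_integral_cmult) (auto simp: unit)
  also have "\<dots> = ennreal (Beta a b * t powr (a + b - 1))"
  proof -
    have "t * t powr (a + b - 2) = t powr (a + b - 1)"
      using assms powr_add[of t 1 "a + b - 2"] by (simp add: algebra_simps)
    moreover have "Beta a b \<ge> 0" using assms by (simp add: Beta_def Gamma_real_pos less_imp_le)
    ultimately show ?thesis using assms by (simp add: ennreal_mult[symmetric] mult_ac)
  qed
  finally show ?thesis .
qed

text \<open>The solution of the recursion in \<open>kernel_const_Suc\<close>: each time integration
  contributes the 2 of the heat kernel bound and a Beta value whose Gamma quotients telescope, up to
  \<open>Gamma (1/2) = sqrt pi\<close>.\<close>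

definition kernel_const :: "nat \<Rightarrow> real" where
  "kernel_const n = (2 * sqrt pi) ^ n / Gamma (real n / 2 + 1)"

lemma kernel_const_pos: "kernel_const n > 0"
  unfolding kernel_const_def by (intro divide_pos_pos zero_less_power Gamma_real_pos) auto

lemma kernel_const_Suc: "2 * kernel_const n * Beta (real n / 2 + 1) (1 / 2) = kernel_const (Suc n)"
proof -
  have "Gamma (real n / 2 + 1) > 0" "Gamma (real (Suc n) / 2 + 1) > 0"
    by (auto intro!: Gamma_real_pos add_nonneg_pos)
  then have "Gamma (real n / 2 + 1) \<noteq> 0" "Gamma (real (Suc n) / 2 + 1) \<noteq> 0" by linarith+
  moreover have "real n / 2 + 1 + 1 / 2 = real (Suc n) / 2 + 1" by (simp add: field_simps)
  ultimately show ?thesis by (simp add: kernel_const_def Beta_def Gamma_one_half_real)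
qed

text \<open>As the base is at most 1, the smallest admissible exponent
  \<open>2 * \<beta> = 1/2\<close> gives the largest value, and this is at most
  \<open>sqrt w\<close>.\<close>

lemma min_powr_le_1:
  fixes w \<beta> :: real
  assumes "w > 0" "\<beta> \<ge> 1/4"
  shows "(min w 1 powr \<beta>)\<^sup>2 * (1 / sqrt w) \<le> 1" "(min w 1 powr \<beta>)\<^sup>2 \<le> 1"
proof -
  have sq: "(min w 1 powr \<beta>)\<^sup>2 = min w 1 powr (2 * \<beta>)"
    using assms by (simp add: power2_eq_square powr_add[symmetric])
  show "(min w 1 powr \<beta>)\<^sup>2 \<le> 1" unfolding sq using assms by (intro powr_le1) auto
  have "min w 1 powr (2 * \<beta>) \<le> min w 1 powr (1/2)" using assms by (intro powr_mono') auto
  also have "\<dots> = sqrt (min w 1)" using assms by (simp add: powr_half_sqrt)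
  also have "\<dots> \<le> sqrt w" by simp
  finally show "(min w 1 powr \<beta>)\<^sup>2 * (1 / sqrt w) \<le> 1" unfolding sq using assms by simp
qed

text \<open>Values in the extended reals admit Tonelli's theorem before the kernels are known to be
  square integrable.\<close>

definition kernel_norm :: "real \<Rightarrow> nat \<Rightarrow> real \<Rightarrow> real \<Rightarrow> ennreal" where
  "kernel_norm \<beta> n z t = (\<integral>\<^sup>+x. ennreal ((chaos_kernel \<beta> n z t x)\<^sup>2) \<partial>quadrant_pow n)"

lemma measurable_chaos_kernel_quadrant_pow: "chaos_kernel \<beta> n z t \<in> borel_measurable (quadrant_pow n)"
  using measurable_chaos_kernel[of "\<lambda>_. z" "quadrant_pow n" "\<lambda>_. t" n "\<lambda>x. x" \<beta>] by simp

lemma kernel_norm_0: "kernel_norm \<beta> 0 z t = ennreal ((u0 z t)\<^sup>2)"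
proof -
  have "emeasure (PiM {} (\<lambda>_::nat. quadrant)) (space (PiM {} (\<lambda>_. quadrant))) = 1"
    by (simp add: space_PiM)
  then show ?thesis by (simp add: kernel_norm_def quadrant_pow_def)
qed

lemma kernel_norm_Suc:
  "kernel_norm \<beta> (Suc n) z t = (\<integral>\<^sup>+(w, \<tau>). ennreal ((indicator {0<..<t} \<tau> * q0 z w (t - \<tau>) * min w 1 powr \<beta>)\<^sup>2) * kernel_norm \<beta> n w \<tau> \<partial>quadrant)"
proof -
  have m: "(\<lambda>x. ennreal ((chaos_kernel \<beta> m z t x)\<^sup>2)) \<in> borel_measurable (quadrant_pow m)" for m z t
    using measurable_chaos_kernel_quadrant_pow by measurable
  have "kernel_norm \<beta> (Suc n) z t = (\<integral>\<^sup>+p. (\<integral>\<^sup>+y. ennreal ((chaos_kernel \<beta> (Suc n) z t (y(n := p)))\<^sup>2) \<partial>quadrant_pow n) \<partial>quadrant)"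
    unfolding kernel_norm_def by (rule nn_integral_quadrant_pow_Suc[OF m])
  also have "\<dots> = (\<integral>\<^sup>+(w, \<tau>). ennreal ((indicator {0<..<t} \<tau> * q0 z w (t - \<tau>) * min w 1 powr \<beta>)\<^sup>2) * kernel_norm \<beta> n w \<tau> \<partial>quadrant)"
  proof (rule nn_integral_cong)
    fix p :: "real \<times> real"
    obtain w \<tau> where p: "p = (w, \<tau>)" by (cases p)
    have ck: "chaos_kernel \<beta> n w \<tau> (y(n := p)) = chaos_kernel \<beta> n w \<tau> y" for y
      by (rule chaos_kernel_cong) auto
    have "(\<integral>\<^sup>+y. ennreal ((chaos_kernel \<beta> (Suc n) z t (y(n := p)))\<^sup>2) \<partial>quadrant_pow n)
        = (\<integral>\<^sup>+y. ennreal ((indicator {0<..<t} \<tau> * q0 z w (t - \<tau>) * min w 1 powr \<beta>)\<^sup>2) * ennreal ((chaos_kernel \<beta> n w \<tau> y)\<^sup>2) \<partial>quadrant_pow n)"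
      unfolding p using ck[unfolded p] by (simp add: power_mult_distrib ennreal_mult mult_ac)
    also have "\<dots> = ennreal ((indicator {0<..<t} \<tau> * q0 z w (t - \<tau>) * min w 1 powr \<beta>)\<^sup>2) * kernel_norm \<beta> n w \<tau>"
      unfolding kernel_norm_def by (rule nn_integral_cmult[OF m])
    finally show "(\<integral>\<^sup>+y. ennreal ((chaos_kernel \<beta> (Suc n) z t (y(n := p)))\<^sup>2) \<partial>quadrant_pow n)
      = (case p of (w, \<tau>) \<Rightarrow> ennreal ((indicator {0<..<t} \<tau> * q0 z w (t - \<tau>) * min w 1 powr \<beta>)\<^sup>2) * kernel_norm \<beta> n w \<tau>)"
      by (simp add: p)
  qed
  finally show ?thesis .
qed

text \<open>The hypothesis is uniform in \<open>w\<close>, so the integral over \<open>w\<close>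
  sees only the squared heat kernel and is at most \<open>2 / sqrt (z * (t - \<tau>))\<close> times
  a function of \<open>\<tau>\<close>. The factor \<open>1 / sqrt z\<close> remains because no
  weight is applied at the end point \<open>z\<close>.\<close>

lemma kernel_norm_step:
  assumes z: "z > 0" and t: "t > 0"
    and bound: "\<And>w \<tau>. w > 0 \<Longrightarrow> \<tau> > 0 \<Longrightarrow>
      ennreal ((min w 1 powr \<beta>)\<^sup>2) * kernel_norm \<beta> n w \<tau> \<le> ennreal (kernel_const n * \<tau> powr (real n / 2))"
  shows "kernel_norm \<beta> (Suc n) z t \<le> ennreal (kernel_const (Suc n) * t powr (real (Suc n) / 2) / sqrt z)"
proof -
  let ?g = "\<lambda>\<tau>. kernel_const n * \<tau> powr (real n / 2)"
  let ?f = "\<lambda>(w, \<tau>). ennreal ((q0 z w (t - \<tau>))\<^sup>2) * (ennreal (?g \<tau>) * indicator {0<..<t} \<tau>)"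
  have g0: "?g \<tau> \<ge> 0" for \<tau> using kernel_const_pos[of n] by simp
  have fm: "?f \<in> borel_measurable (borel \<Otimes>\<^sub>M borel)" by measurable
  have "kernel_norm \<beta> (Suc n) z t \<le> (\<integral>\<^sup>+x. ?f x \<partial>quadrant)"
    unfolding kernel_norm_Suc
  proof (rule nn_integral_mono)
    fix p assume p: "p \<in> space quadrant"
    obtain w \<tau> where wt: "p = (w, \<tau>)" by (cases p)
    then have pos: "w > 0" "\<tau> > 0" using p by (auto simp: space_quadrant)
    have "ennreal ((indicator {0<..<t} \<tau> * q0 z w (t - \<tau>) * min w 1 powr \<beta>)\<^sup>2) * kernel_norm \<beta> n w \<tau>
        = (ennreal ((q0 z w (t - \<tau>))\<^sup>2) * indicator {0<..<t} \<tau>) * (ennreal ((min w 1 powr \<beta>)\<^sup>2) * kernel_norm \<beta> n w \<tau>)"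
      by (auto simp: power_mult_distrib ennreal_mult indicator_def mult_ac)
    also have "\<dots> \<le> (ennreal ((q0 z w (t - \<tau>))\<^sup>2) * indicator {0<..<t} \<tau>) * ennreal (?g \<tau>)"
      by (intro mult_left_mono bound pos) simp
    finally show "(case p of (w, \<tau>) \<Rightarrow> ennreal ((indicator {0<..<t} \<tau> * q0 z w (t - \<tau>) * min w 1 powr \<beta>)\<^sup>2) * kernel_norm \<beta> n w \<tau>) \<le> ?f p"
      by (simp add: wt mult_ac)
  qed
  also have "\<dots> = (\<integral>\<^sup>+\<tau>. (\<integral>\<^sup>+w. ?f (w, \<tau>) * indicator {0<..} w \<partial>lborel) * indicator {0<..} \<tau> \<partial>lborel)"
    by (rule nn_integral_quadrant[OF fm])
  also have "\<dots> \<le> (\<integral>\<^sup>+\<tau>. ennreal (2 * kernel_const n / sqrt z) * (ennreal (\<tau> powr (real n / 2 + 1 - 1) * (t - \<tau>) powr (1/2 - 1)) * indicator {0<..<t} \<tau>) \<partial>lborel)"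
  proof (rule nn_integral_mono)
    fix \<tau> :: real
    show "(\<integral>\<^sup>+w. ?f (w, \<tau>) * indicator {0<..} w \<partial>lborel) * indicator {0<..} \<tau>
        \<le> ennreal (2 * kernel_const n / sqrt z) * (ennreal (\<tau> powr (real n / 2 + 1 - 1) * (t - \<tau>) powr (1/2 - 1)) * indicator {0<..<t} \<tau>)"
    proof (cases "\<tau> \<in> {0<..<t}")
      case True
      then have tt: "t - \<tau> > 0" by simp
      have "(\<integral>\<^sup>+w. ?f (w, \<tau>) * indicator {0<..} w \<partial>lborel)
          = (\<integral>\<^sup>+w. ennreal (?g \<tau>) * (ennreal ((q0 z w (t - \<tau>))\<^sup>2) * indicator {0<..} w) \<partial>lborel)"
        using True by (intro nn_integral_cong) (simp add: mult_ac)
      also have "\<dots> = ennreal (?g \<tau>) * (\<integral>\<^sup>+w. ennreal ((q0 z w (t - \<tau>))\<^sup>2) * indicator {0<..} w \<partial>lborel)"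
        by (rule nn_integral_cmult) simp
      also have "\<dots> \<le> ennreal (?g \<tau>) * ennreal (2 / sqrt (z * (t - \<tau>)))"
        by (intro mult_left_mono nn_integral_q0_square z tt) simp
      also have "\<dots> = ennreal (?g \<tau> * (2 / sqrt (z * (t - \<tau>))))"
        by (rule ennreal_mult[symmetric]) (use g0 z tt in auto)
      also have "?g \<tau> * (2 / sqrt (z * (t - \<tau>))) = (2 * kernel_const n / sqrt z) * (\<tau> powr (real n / 2 + 1 - 1) * (t - \<tau>) powr (1/2 - 1))"
      proof -
        have "(t - \<tau>) powr (1/2 - 1) = 1 / sqrt (t - \<tau>)"
          using tt powr_minus_divide[of "t - \<tau>" "1/2"] by (simp add: powr_half_sqrt)
        then show ?thesis by (simp add: real_sqrt_mult)
      qed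
      also have "ennreal \<dots> = ennreal (2 * kernel_const n / sqrt z) * ennreal (\<tau> powr (real n / 2 + 1 - 1) * (t - \<tau>) powr (1/2 - 1))"
        by (rule ennreal_mult) (use z kernel_const_pos[of n] in auto)
      finally have fin: "(\<integral>\<^sup>+w. ?f (w, \<tau>) * indicator {0<..} w \<partial>lborel)
        \<le> ennreal (2 * kernel_const n / sqrt z) * ennreal (\<tau> powr (real n / 2 + 1 - 1) * (t - \<tau>) powr (1/2 - 1))" .
      have ind: "indicator {0<..<t} \<tau> = (1 :: ennreal)" "indicator {0<..} \<tau> = (1 :: ennreal)" using True by auto
      show ?thesis using fin by (simp only: ind mult_1_right)
    next
      case False
      then show ?thesis by (auto simp: indicator_def)
    qed
  qed
  also have "\<dots> = ennreal (2 * kernel_const n / sqrt z) * ennreal (Beta (real n / 2 + 1) (1/2) * t powr (real n / 2 + 1 + 1/2 - 1))"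
    by (subst nn_integral_cmult) (simp_all only: nn_integral_Beta_scaled[of "real n / 2 + 1" "1/2" t] t, auto)
  also have "\<dots> = ennreal ((2 * kernel_const n / sqrt z) * (Beta (real n / 2 + 1) (1/2) * t powr (real n / 2 + 1 + 1/2 - 1)))"
    using z kernel_const_pos[of n] by (subst ennreal_mult) (auto simp: Beta_def Gamma_real_pos less_imp_le)
  also have "(2 * kernel_const n / sqrt z) * (Beta (real n / 2 + 1) (1/2) * t powr (real n / 2 + 1 + 1/2 - 1))
      = (2 * kernel_const n * Beta (real n / 2 + 1) (1/2)) * t powr (real (Suc n) / 2) / sqrt z"
    by (simp add: field_simps)
  also have "2 * kernel_const n * Beta (real n / 2 + 1) (1/2) = kernel_const (Suc n)" by (rule kernel_const_Suc)
  finally show ?thesis .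
qed

text \<open>The weight at the end point cancels the factor \<open>1 / sqrt w\<close> left by the
  preceding step, so that this quantity reproduces itself. At order 0 the bound is
  \<open>u0 w t \<le> 1\<close>.\<close>

lemma kernel_norm_weighted_bound:
  assumes b: "\<beta> \<ge> 1/4" and "w > 0" "t > 0"
  shows "ennreal ((min w 1 powr \<beta>)\<^sup>2) * kernel_norm \<beta> n w t \<le> ennreal (kernel_const n * t powr (real n / 2))"
  using assms(2,3)
proof (induction n arbitrary: w t)
  case 0
  have "kernel_norm \<beta> 0 w t = ennreal ((u0 w t)\<^sup>2)"
    by (rule kernel_norm_0)
  also have "\<dots> \<le> ennreal 1" using u0_bounds[OF 0] by (intro ennreal_leI) (simp add: power_le_one)
  finally have 1: "kernel_norm \<beta> 0 w t \<le> 1" by simp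
  have "ennreal ((min w 1 powr \<beta>)\<^sup>2) * kernel_norm \<beta> 0 w t \<le> ennreal 1 * 1"
    by (rule mult_mono[OF ennreal_leI[OF min_powr_le_1(2)[OF 0(1) b]] 1]) simp_all
  then show ?case using 0 by (simp add: kernel_const_def)
next
  case (Suc n)
  let ?K = "kernel_const (Suc n) * t powr (real (Suc n) / 2)"
  have K: "?K \<ge> 0" using kernel_const_pos[of "Suc n"] by simp
  have "ennreal ((min w 1 powr \<beta>)\<^sup>2) * kernel_norm \<beta> (Suc n) w t \<le> ennreal ((min w 1 powr \<beta>)\<^sup>2) * ennreal (?K / sqrt w)"
    by (rule mult_left_mono[OF kernel_norm_step[OF Suc.prems Suc.IH] zero_le])
  also have "\<dots> = ennreal (((min w 1 powr \<beta>)\<^sup>2 * (1 / sqrt w)) * ?K)"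
    using K Suc.prems by (subst ennreal_mult[symmetric]) (auto simp: mult_ac)
  also have "\<dots> \<le> ennreal (1 * ?K)"
    using K min_powr_le_1(1)[OF Suc.prems(1) b] by (intro ennreal_leI mult_right_mono) auto
  finally show ?case by simp
qed

lemma kernel_norm_bound:
  assumes "\<beta> \<ge> 1/4" "z > 0" "t > 0" "n \<ge> 1"
  shows "kernel_norm \<beta> n z t \<le> ennreal (kernel_const n * t powr (real n / 2) / sqrt z)"
  using kernel_norm_step[OF assms(2,3) kernel_norm_weighted_bound[OF assms(1)], of "n - 1"] assms(4) by simp

lemma in_Lp_2_chaos_kernel:
  assumes "\<beta> \<ge> 1/4" "z > 0" "t > 0"
  shows "in_Lp 2 (quadrant_pow n) (chaos_kernel \<beta> n z t)"
proof -
  have "kernel_norm \<beta> n z t < \<infinity>"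
  proof (cases "n = 0")
    case True
    then show ?thesis by (simp add: kernel_norm_0)
  next
    case False
    then have "kernel_norm \<beta> n z t \<le> ennreal (kernel_const n * t powr (real n / 2) / sqrt z)"
      using assms by (intro kernel_norm_bound) auto
    also have "\<dots> < \<infinity>" by simp
    finally show ?thesis .
  qed
  then show ?thesis
    unfolding in_Lp_2_iff kernel_norm_def
    using measurable_chaos_kernel_quadrant_pow[of \<beta> n z t] by (auto intro!: integrableI_bounded)
qed

lemma integral_chaos_kernel_square:
  assumes "\<beta> \<ge> 1/4" "z > 0" "t > 0" "n \<ge> 1"
  shows "(\<integral>x. (chaos_kernel \<beta> n z t x)\<^sup>2 \<partial>quadrant_pow n) \<le> kernel_const n * t powr (real n / 2) / sqrt z"
proof -
  have "ennreal (\<integral>x. (chaos_kernel \<beta> n z t x)\<^sup>2 \<partial>quadrant_pow n) = kernel_norm \<beta> n z t"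
    unfolding kernel_norm_def using in_Lp_2_chaos_kernel[OF assms(1-3), of n]
    by (intro nn_integral_eq_integral[symmetric]) (auto simp: in_Lp_2_iff)
  also have "\<dots> \<le> ennreal (kernel_const n * t powr (real n / 2) / sqrt z)" by (rule kernel_norm_bound[OF assms])
  finally show ?thesis using kernel_const_pos[of n] assms by (subst (asm) ennreal_le_iff) auto
qed

lemma chaos_kernel_times_increasing:
  assumes "chaos_kernel \<beta> n z t x \<noteq> 0"
  shows "\<forall>j<n. snd (x j) < t \<and> (\<forall>i<j. snd (x i) < snd (x j))"
  using assms
proof (induction n arbitrary: z t)
  case (Suc n)
  obtain w \<tau> where p: "x n = (w, \<tau>)" by (cases "x n")
  have \<tau>: "\<tau> < t" and nz: "chaos_kernel \<beta> n w \<tau> x \<noteq> 0"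
    using Suc.prems by (auto simp: p indicator_def split: if_splits)
  from Suc.IH[OF nz] \<tau> show ?case
    by (force simp: p less_Suc_eq)
qed simp

text \<open>Strict monotonicity gives \<open>i \<le> \<sigma> i\<close>; both sides have the same
  sum over \<open>{..<n}\<close>, so equality holds for every \<open>i\<close>.\<close>

lemma permutes_mono_imp_id:
  assumes \<sigma>: "\<sigma> permutes {..<n::nat}" and mono: "\<And>i j. i < j \<Longrightarrow> j < n \<Longrightarrow> \<sigma> i < \<sigma> j"
  shows "\<sigma> = id"
proof -
  have ge: "i \<le> \<sigma> i" if "i < n" for i
    using that
  proof (induction i)
    case (Suc i)
    then have "i \<le> \<sigma> i" "\<sigma> i < \<sigma> (Suc i)" using mono[of i "Suc i"] by auto
    then show ?case by simp
  qed simp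
  have sum: "(\<Sum>i<n. i) = (\<Sum>i<n. \<sigma> i)"
    using sum.permute[OF \<sigma>, of "\<lambda>i. i"] by (simp add: comp_def)
  have "\<sigma> i = i" if "i < n" for i
    using sum_mono_inv[OF sum, of i] ge that by auto
  moreover have "\<sigma> i = i" if "\<not> i < n" for i using permutes_not_in[OF \<sigma>] that by simp
  ultimately show ?thesis by (auto simp: fun_eq_iff)
qed

text \<open>The kernel is supported on increasing times, where no nontrivial permutation maps into the
  support. So no factorial is lost in the norm of the multiple integral.\<close>

lemma perm_form_chaos_kernel:
  "perm_form n (chaos_kernel \<beta> n z t) (chaos_kernel \<beta> n z t) = (\<integral>x. (chaos_kernel \<beta> n z t x)\<^sup>2 \<partial>quadrant_pow n)"
proof -
  let ?f = "chaos_kernel \<beta> n z t"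
  have 0: "?f (x \<circ> \<sigma>) * ?f x = 0" if \<sigma>: "\<sigma> permutes {..<n}" and ne: "\<sigma> \<noteq> id" for \<sigma> x
  proof (rule ccontr)
    assume "?f (x \<circ> \<sigma>) * ?f x \<noteq> 0"
    then have 1: "?f (x \<circ> \<sigma>) \<noteq> 0" and 2: "?f x \<noteq> 0" by auto
    have "\<sigma> i < \<sigma> j" if ij: "i < j" "j < n" for i j
    proof (rule ccontr)
      assume "\<not> \<sigma> i < \<sigma> j"
      moreover have "\<sigma> i \<noteq> \<sigma> j" using permutes_inj[OF \<sigma>] ij by (auto dest: injD)
      ultimately have "\<sigma> j < \<sigma> i" by simp
      moreover have "\<sigma> i < n" using permutes_in_image[OF \<sigma>, of i] ij by simp
      ultimately have "snd (x (\<sigma> j)) < snd (x (\<sigma> i))" using chaos_kernel_times_increasing[OF 2] by blast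
      moreover have "snd (x (\<sigma> i)) < snd (x (\<sigma> j))"
        using chaos_kernel_times_increasing[OF 1] ij by auto
      ultimately show False by simp
    qed
    with permutes_mono_imp_id[OF \<sigma>] ne show False by blast
  qed
  have "perm_form n ?f ?f = (\<Sum>\<sigma>\<in>{\<sigma>. \<sigma> permutes {..<n}}. if \<sigma> = id then \<integral>x. (?f x)\<^sup>2 \<partial>quadrant_pow n else 0)"
    unfolding perm_form_def by (intro sum.cong refl) (auto simp: 0 power2_eq_square)
  also have "\<dots> = (\<integral>x. (?f x)\<^sup>2 \<partial>quadrant_pow n)"
    using finite_perms permutes_id[of "{..<n}"] by (simp add: sum.delta)
  finally show ?thesis .
qed

section \<open>The mild solution\<close>

text \<open>The power is concave, and the right-hand side is its tangent at
  \<open>y = 1\<close>.\<close>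

lemma powr_le_affine:
  fixes y s :: real
  assumes "0 \<le> y" "0 \<le> s" "s \<le> 1"
  shows "y powr s \<le> s * y + (1 - s)"
proof (cases "y = 0")
  case True
  then show ?thesis using assms by simp
next
  case False
  then show ?thesis using Youngs_inequality_0[of s "1 - s" y 1] assms by simp
qed

lemma abs_powr_eq_even_power_powr:
  fixes x :: real
  assumes "k \<ge> 1"
  shows "\<bar>x\<bar> powr p = (x ^ (2 * k)) powr (p / real (2 * k))"
proof (cases "x = 0")
  case False
  have "x ^ (2 * k) = \<bar>x\<bar> ^ (2 * k)" by (simp add: power_even_abs)
  also have "\<dots> = \<bar>x\<bar> powr real (2 * k)" using False by (intro powr_realpow[symmetric]) simp
  finally show ?thesis using assms False by (simp add: powr_powr)
qed (use assms in simp)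

lemma (in prob_space) in_Lp_even_moment:
  assumes X: "X \<in> borel_measurable M" and i: "integrable M (\<lambda>\<omega>. X \<omega> ^ (2 * k))"
    and k: "k \<ge> 1" and p: "0 < p" "p \<le> real (2 * k)"
  shows "in_Lp p M X"
  unfolding in_Lp_def
proof (intro conjI X)
  define s where "s = p / real (2 * k)"
  have s: "0 \<le> s" "s \<le> 1" using k p by (auto simp: s_def)
  show "integrable M (\<lambda>\<omega>. \<bar>X \<omega>\<bar> powr p)"
  proof (rule Bochner_Integration.integrable_bound)
    show "integrable M (\<lambda>\<omega>. s * X \<omega> ^ (2 * k) + (1 - s))" using i by simp
    show "AE \<omega> in M. norm (\<bar>X \<omega>\<bar> powr p) \<le> norm (s * X \<omega> ^ (2 * k) + (1 - s))"
    proof (rule AE_I2)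
      fix \<omega>
      have "(X \<omega> ^ (2 * k)) powr s \<le> s * X \<omega> ^ (2 * k) + (1 - s)"
        by (rule powr_le_affine[OF _ s]) (simp add: zero_le_even_power)
      then show "norm (\<bar>X \<omega>\<bar> powr p) \<le> norm (s * X \<omega> ^ (2 * k) + (1 - s))"
        by (simp add: abs_powr_eq_even_power_powr[OF k] s_def)
    qed
  qed (use X in measurable)
qed

text \<open>Jensen's inequality in tangent form: the even power is normalized by
  \<open>b ^ k\<close>, so that its mean is at most 1, and the tangent bound is integrated.\<close>

lemma (in prob_space) Lp_norm_even_moment:
  assumes X: "X \<in> borel_measurable M" and i: "integrable M (\<lambda>\<omega>. X \<omega> ^ (2 * k))"
    and k: "k \<ge> 1" and p: "0 < p" "p \<le> real (2 * k)"
    and b: "expectation (\<lambda>\<omega>. X \<omega> ^ (2 * k)) \<le> b ^ k" "b > 0"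
  shows "Lp_norm p M X \<le> sqrt b"
proof -
  define s where "s = p / real (2 * k)"
  have s: "0 \<le> s" "s \<le> 1" using k p by (auto simp: s_def)
  have pt: "\<bar>X \<omega>\<bar> powr p \<le> b powr (p / 2) * (s * (X \<omega> ^ (2 * k) / b ^ k) + (1 - s))" for \<omega>
  proof -
    have "\<bar>X \<omega>\<bar> powr p = (b ^ k) powr s * (X \<omega> ^ (2 * k) / b ^ k) powr s"
      using b(2) by (subst powr_mult[symmetric]) (auto simp: abs_powr_eq_even_power_powr[OF k] s_def zero_le_even_power)
    also have "(b ^ k) powr s = b powr (p / 2)"
      using b(2) k by (simp add: powr_realpow[symmetric] powr_powr s_def)
    also have "b powr (p / 2) * (X \<omega> ^ (2 * k) / b ^ k) powr s \<le> b powr (p / 2) * (s * (X \<omega> ^ (2 * k) / b ^ k) + (1 - s))"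
      using b(2) by (intro mult_left_mono powr_le_affine s) (auto simp: zero_le_even_power)
    finally show ?thesis .
  qed
  have "expectation (\<lambda>\<omega>. \<bar>X \<omega>\<bar> powr p) \<le> expectation (\<lambda>\<omega>. b powr (p / 2) * (s * (X \<omega> ^ (2 * k) / b ^ k) + (1 - s)))"
    using in_Lp_even_moment[OF X i k p] i by (intro integral_mono pt) (auto simp: in_Lp_def)
  also have "\<dots> = b powr (p / 2) * (s * (expectation (\<lambda>\<omega>. X \<omega> ^ (2 * k)) / b ^ k) + (1 - s))"
    using i by (simp add: prob_space)
  also have "\<dots> \<le> b powr (p / 2) * (s * 1 + (1 - s))"
    using b s by (intro mult_left_mono add_mono) auto
  finally have "expectation (\<lambda>\<omega>. \<bar>X \<omega>\<bar> powr p) \<le> b powr (p / 2)" by simp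
  then have "Lp_norm p M X \<le> (b powr (p / 2)) powr (1 / p)"
    unfolding Lp_norm_def using p by (intro powr_mono2) auto
  also have "\<dots> = sqrt b" using p b by (simp add: powr_powr powr_half_sqrt)
  finally show ?thesis .
qed

section \<open>Estimates for the summation of the series\<close>

text \<open>Geometric weights replace a factor that would depend on the number \<open>m\<close> of
  summands, so the estimate survives the passage to infinite tails. They are affordable because the
  Gamma function in the moment bounds outgrows every geometric sequence.\<close>

lemma power_sum_le_weighted:
  fixes a :: "nat \<Rightarrow> real"
  assumes "k \<ge> 1"
  shows "(\<Sum>i<m. a i) ^ (2 * k) \<le> (\<Sum>i<m. (4 ^ k) ^ Suc i * a i ^ (2 * k))"
proof (induction m arbitrary: a)
  case 0
  then show ?case using assms by (simp add: power_0_left)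
next
  case (Suc m)
  have two: "(x + y) ^ (2 * k) \<le> 4 ^ k * (x ^ (2 * k) + y ^ (2 * k))" for x y :: real
  proof -
    have "\<bar>x + y\<bar> \<le> 2 * \<bar>x\<bar> \<or> \<bar>x + y\<bar> \<le> 2 * \<bar>y\<bar>" by linarith
    then have "\<bar>x + y\<bar> ^ (2 * k) \<le> (2 * \<bar>x\<bar>) ^ (2 * k) \<or> \<bar>x + y\<bar> ^ (2 * k) \<le> (2 * \<bar>y\<bar>) ^ (2 * k)"
      by (meson abs_ge_zero power_mono)
    then have "(x + y) ^ (2 * k) \<le> 2 ^ (2 * k) * x ^ (2 * k) \<or> (x + y) ^ (2 * k) \<le> 2 ^ (2 * k) * y ^ (2 * k)"
      by (simp add: power_mult_distrib power_even_abs)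
    moreover have "0 \<le> 2 ^ (2 * k) * x ^ (2 * k)" "0 \<le> 2 ^ (2 * k) * y ^ (2 * k)"
      by (simp_all add: zero_le_even_power)
    ultimately have "(x + y) ^ (2 * k) \<le> 2 ^ (2 * k) * x ^ (2 * k) + 2 ^ (2 * k) * y ^ (2 * k)" by linarith
    then show ?thesis by (simp add: power_mult distrib_left)
  qed
  have "(\<Sum>i<Suc m. a i) ^ (2 * k) = (a 0 + (\<Sum>i<m. a (Suc i))) ^ (2 * k)"
    by (simp only: sum.lessThan_Suc_shift)
  also have "\<dots> \<le> 4 ^ k * (a 0 ^ (2 * k) + (\<Sum>i<m. a (Suc i)) ^ (2 * k))" by (rule two)
  also have "\<dots> \<le> 4 ^ k * (a 0 ^ (2 * k) + (\<Sum>i<m. (4 ^ k) ^ Suc i * a (Suc i) ^ (2 * k)))"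
    by (intro mult_left_mono add_left_mono Suc.IH) simp
  also have "\<dots> = (\<Sum>i<Suc m. (4 ^ k) ^ Suc i * a i ^ (2 * k))"
    by (simp only: sum.lessThan_Suc_shift) (simp add: distrib_left sum_distrib_left mult.assoc)
  finally show ?case .
qed

text \<open>The functional equation of \<open>Gamma\<close> relates terms at distance two, with
  ratio \<open>\<rho>\<^sup>2 / (n / 2 + 1)\<close>, which is eventually at most
  \<open>1/4\<close>.\<close>

lemma power_over_Gamma_le_geometric:
  fixes \<rho> :: real
  assumes "\<rho> > 0"
  shows "\<exists>C>0. \<forall>n. \<rho> ^ n / Gamma (real n / 2 + 1) \<le> C * (1 / 2) ^ n"
proof -
  define b where "b n = \<rho> ^ n / Gamma (real n / 2 + 1)" for n
  have Gpos: "Gamma (real n / 2 + 1) > 0" for n by (intro Gamma_real_pos) (auto intro: add_nonneg_pos)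
  have bpos: "b n > 0" for n using assms Gpos[of n] by (simp add: b_def)
  have rec: "b (n + 2) = \<rho>\<^sup>2 / (real n / 2 + 1) * b n" for n
  proof -
    have "Gamma (real (n + 2) / 2 + 1) = Gamma ((real n / 2 + 1) + 1)" by (simp add: field_simps)
    also have "\<dots> = (real n / 2 + 1) * Gamma (real n / 2 + 1)"
      by (rule Gamma_plus1) (use Gpos[of n] Gamma_eq_zero_iff[of "real n / 2 + 1"] in auto)
    finally show ?thesis by (simp add: b_def power_add power2_eq_square)
  qed
  obtain N :: nat where N: "8 * \<rho>\<^sup>2 \<le> real N" using real_arch_simple by blast
  \<comment> \<open>Terms up to \<open>N + 1\<close> enter, since steps of two need start values of
    both parities.\<close>
  define C where "C = (\<Sum>i\<le>N + 1. b i * 2 ^ i)"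
  have C: "b n \<le> C * (1 / 2) ^ n" for n
  proof (induction n rule: less_induct)
    case (less n)
    show ?case
    proof (cases "n \<le> N + 1")
      case True
      have "b n * 2 ^ n \<le> C" unfolding C_def
        by (rule member_le_sum[of n "{..N + 1}" "\<lambda>i. b i * 2 ^ i"]) (use True less_imp_le[OF bpos] in auto)
      then show ?thesis by (simp add: power_divide field_simps)
    next
      case False
      then obtain m where m: "n = m + 2" "N \<le> m" by (intro that[of "n - 2"]) auto
      have "\<rho>\<^sup>2 / (real m / 2 + 1) \<le> 1 / 4"
      proof -
        have "4 * \<rho>\<^sup>2 \<le> real m / 2 + 1" using N m(2) by simp
        then show ?thesis by (simp add: divide_le_eq)
      qed
      then have "b n \<le> 1 / 4 * b m" unfolding m(1) rec using bpos[of m] by (intro mult_right_mono) auto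
      also have "\<dots> \<le> 1 / 4 * (C * (1 / 2) ^ m)" using less.IH[of m] m(1) by simp
      also have "\<dots> = C * (1 / 2) ^ n" by (simp add: m(1) power_add power2_eq_square)
      finally show ?thesis .
    qed
  qed
  have "0 < b 0" by (rule bpos)
  also have "\<dots> \<le> C" using C[of 0] by simp
  finally show ?thesis using C unfolding b_def by blast
qed

section \<open>Moments of the chaos components\<close>

context isonormal_process
begin

text \<open>At order 0 the product space is a single point of mass 1 and products of variables are
  empty, so that a constant kernel is elementary and is its own integral.\<close>

lemma has_wiener_integral_const: "has_wiener_integral M W 0 (\<lambda>x. c) (\<lambda>\<omega>. c)"
proof -
  have "emeasure (quadrant_pow 0) (space (quadrant_pow 0)) = 1"
    by (simp add: quadrant_pow_def space_PiM)
  then interpret q0: prob_space "quadrant_pow 0" by (rule prob_spaceI)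
  have "in_Lp 2 (quadrant_pow 0) (\<lambda>x. c)" "in_Lp 2 M (\<lambda>\<omega>. c)" by (simp_all add: in_Lp_2_iff)
  moreover have "elementary_fun 0 [(c, \<lambda>i. {})] = (\<lambda>x. c)" "elementary_integral W 0 [(c, \<lambda>i. {})] = (\<lambda>\<omega>. c)"
    by (simp_all add: fun_eq_iff elementary_fun_def elementary_integral_def)
  moreover have "is_elementary 0 [(c, \<lambda>i. {})]" by (simp add: is_elementary_def disjoint_family_on_def)
  ultimately show ?thesis unfolding has_wiener_integral_def
    by (intro exI[of _ "\<lambda>k. [(c, \<lambda>i. {})]"]) (simp add: Lp_tendsto_2_const)
qed

lemma has_wiener_integral_chaos_term:
  assumes "\<beta> \<ge> 1/4" "z > 0" "t > 0"
  shows "has_wiener_integral M W n (chaos_kernel \<beta> n z t) (chaos_term M W \<beta> n z t)"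
  unfolding chaos_term_def by (rule has_wiener_integral_wiener_integral[OF in_Lp_2_chaos_kernel[OF assms]])

lemma in_Lp_2_chaos_term:
  assumes "\<beta> \<ge> 1/4" "z > 0" "t > 0"
  shows "in_Lp 2 M (chaos_term M W \<beta> n z t)"
  by (rule has_wiener_integral_in_Lp_2(2)[OF has_wiener_integral_chaos_term[OF assms]])

lemma chaos_term_0_AE:
  assumes "\<beta> \<ge> 1/4" "z > 0" "t > 0"
  shows "AE \<omega> in M. chaos_term M W \<beta> 0 z t \<omega> = u0 z t"
  by (rule wiener_integral_AE_unique[OF has_wiener_integral_chaos_term[OF assms] has_wiener_integral_const]) simp

lemma chaos_term_moments:
  assumes "\<beta> \<ge> 1/4" "z > 0" "t > 0" "n \<ge> 1" "k \<ge> 1"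
  shows "expectation (\<lambda>\<omega>. chaos_term M W \<beta> n z t \<omega> ^ (2 * k))
    \<le> (real (2 * k - 1) ^ n * (kernel_const n * t powr (real n / 2) / sqrt z)) ^ k"
proof -
  note I = has_wiener_integral_chaos_term[OF assms(1-3), of n]
  have "expectation (\<lambda>\<omega>. (chaos_term M W \<beta> n z t \<omega>)\<^sup>2) = (\<integral>x. (chaos_kernel \<beta> n z t x)\<^sup>2 \<partial>quadrant_pow n)"
    using wiener_integral_inner[OF I I] by (simp add: power2_eq_square perm_form_chaos_kernel[unfolded power2_eq_square])
  also have "\<dots> \<le> kernel_const n * t powr (real n / 2) / sqrt z" by (rule integral_chaos_kernel_square[OF assms(1-4)])
  finally have "(real (2 * k - 1) ^ n * expectation (\<lambda>\<omega>. (chaos_term M W \<beta> n z t \<omega>)\<^sup>2)) ^ k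
      \<le> (real (2 * k - 1) ^ n * (kernel_const n * t powr (real n / 2) / sqrt z)) ^ k"
    by (intro power_mono mult_left_mono) auto
  then show ?thesis using wiener_integral_hypercontractive(2)[OF I assms(5)] by linarith
qed

lemma chaos_term_even_integrable:
  assumes "\<beta> \<ge> 1/4" "z > 0" "t > 0" "k \<ge> 1"
  shows "integrable M (\<lambda>\<omega>. chaos_term M W \<beta> n z t \<omega> ^ (2 * k))"
  by (rule wiener_integral_hypercontractive(1)[OF has_wiener_integral_chaos_term[OF assms(1-3)] assms(4)])

text \<open>Rounding \<open>p / 2\<close> up gives \<open>2 * k - 1 < p + 1\<close>, and
  \<open>p + 1 \<le> 3 * (p - 1)\<close> for \<open>p \<ge> 2\<close>.\<close>

lemma ex_even_exponent:
  fixes p :: real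
  assumes "p \<ge> 2"
  obtains k :: nat where "k \<ge> 1" "p \<le> real (2 * k)" "real (2 * k - 1) \<le> 3 * (p - 1)"
proof -
  define k where "k = nat \<lceil>p / 2\<rceil>"
  have "real k \<ge> p / 2" "real k < p / 2 + 1" using assms unfolding k_def by linarith+
  moreover from this have "k \<ge> 1" using assms by linarith
  ultimately show ?thesis using that[of k] assms by (simp add: of_nat_diff)
qed

theorem chaos_term_Lp_bound:
  assumes "\<beta> \<ge> 1/4" "z > 0" "t > 0" "n \<ge> 1" "p \<ge> 2"
  shows "in_Lp p M (chaos_term M W \<beta> n z t)"
    "Lp_norm p M (chaos_term M W \<beta> n z t)
      \<le> (6 * (p - 1) * sqrt pi * sqrt t) powr (real n / 2) / (sqrt (Gamma (real n / 2 + 1)) * z powr (1 / 4))"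
proof -
  obtain k :: nat where k: "k \<ge> 1" "p \<le> real (2 * k)" "real (2 * k - 1) \<le> 3 * (p - 1)"
    using ex_even_exponent[OF assms(5)] .
  have p: "0 < p" using assms(5) by simp
  let ?X = "chaos_term M W \<beta> n z t"
  have X: "?X \<in> borel_measurable M" using in_Lp_2_chaos_term[OF assms(1-3)] by (rule in_Lp_2_measurable)
  note i = chaos_term_even_integrable[OF assms(1-3) k(1), of n]
  show "in_Lp p M ?X" by (rule in_Lp_even_moment[OF X i k(1) p k(2)])
  have G: "Gamma (real n / 2 + 1) > 0" by (intro Gamma_real_pos) (auto intro: add_nonneg_pos)
  define b where "b = real (2 * k - 1) ^ n * (kernel_const n * t powr (real n / 2) / sqrt z)"
  have "real (2 * k - 1) > 0" using k(1) by simp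
  then have b: "b > 0" unfolding b_def using kernel_const_pos[of n] assms by simp
  \<comment> \<open>The constant 6 is the product of the 3 lost in passing to an even exponent and
    the 2 of the heat kernel bound.\<close>
  define D where "D = 6 * (p - 1) * sqrt pi * sqrt t"
  have D: "D > 0" using assms by (simp add: D_def)
  have "Lp_norm p M ?X \<le> sqrt b"
    by (rule Lp_norm_even_moment[OF X i k(1) p k(2) _ b]) (unfold b_def, rule chaos_term_moments[OF assms(1-4) k(1)])
  also have "\<dots> \<le> sqrt (D ^ n / Gamma (real n / 2 + 1) / sqrt z)"
  proof (rule real_sqrt_le_mono)
    have "b \<le> (3 * (p - 1)) ^ n * (kernel_const n * t powr (real n / 2) / sqrt z)"
      unfolding b_def using kernel_const_pos[of n] assms k(3) by (intro mult_right_mono power_mono) auto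
    also have "t powr (real n / 2) = sqrt t ^ n"
      using assms by (simp add: powr_half_sqrt[symmetric] powr_realpow[symmetric] powr_powr)
    also have "(3 * (p - 1)) ^ n * (kernel_const n * sqrt t ^ n / sqrt z) = D ^ n / Gamma (real n / 2 + 1) / sqrt z"
    proof -
      have "D = (3 * (p - 1)) * ((2 * sqrt pi) * sqrt t)" by (simp add: D_def)
      then have "D ^ n = (3 * (p - 1)) ^ n * ((2 * sqrt pi) ^ n * sqrt t ^ n)" by (simp only: power_mult_distrib)
      then show ?thesis by (simp add: kernel_const_def)
    qed
    finally show "b \<le> D ^ n / Gamma (real n / 2 + 1) / sqrt z" .
  qed
  also have "\<dots> = D powr (real n / 2) / (sqrt (Gamma (real n / 2 + 1)) * z powr (1 / 4))"
  proof -
    have "sqrt (D ^ n) = D powr (real n / 2)"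
      using D by (simp add: powr_half_sqrt[symmetric] powr_realpow[symmetric] powr_powr)
    moreover have "sqrt (sqrt z) = z powr (1 / 4)"
      using assms by (simp add: powr_half_sqrt[symmetric] powr_powr)
    ultimately show ?thesis by (simp add: real_sqrt_divide real_sqrt_mult)
  qed
  finally show "Lp_norm p M ?X \<le> (6 * (p - 1) * sqrt pi * sqrt t) powr (real n / 2) / (sqrt (Gamma (real n / 2 + 1)) * z powr (1 / 4))"
    by (simp add: D_def)
qed

text \<open>Tested against \<open>Z\<close>, the partial sums are constant from the index
  \<open>m + 1\<close> on.\<close>

lemma expectation_series_mult:
  assumes lim: "Lp_tendsto 2 M (\<lambda>N \<omega>. \<Sum>n<N. X n \<omega>) Y" and X: "\<And>n. in_Lp 2 M (X n)" and Z: "in_Lp 2 M Z"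
    and orth: "\<And>n. n \<noteq> m \<Longrightarrow> expectation (\<lambda>\<omega>. X n \<omega> * Z \<omega>) = 0"
  shows "expectation (\<lambda>\<omega>. Y \<omega> * Z \<omega>) = expectation (\<lambda>\<omega>. X m \<omega> * Z \<omega>)"
proof -
  have "(\<lambda>N. expectation (\<lambda>\<omega>. (\<Sum>n<N. X n \<omega>) * Z \<omega>)) \<longlonglongrightarrow> expectation (\<lambda>\<omega>. Y \<omega> * Z \<omega>)"
    by (rule Lp_tendsto_2_inner[OF lim Lp_tendsto_2_const[OF Z]])
  moreover have "expectation (\<lambda>\<omega>. (\<Sum>n<N. X n \<omega>) * Z \<omega>) = expectation (\<lambda>\<omega>. X m \<omega> * Z \<omega>)" if N: "N \<ge> Suc m" for N
  proof -
    have "expectation (\<lambda>\<omega>. (\<Sum>n<N. X n \<omega>) * Z \<omega>) = (\<Sum>n<N. expectation (\<lambda>\<omega>. X n \<omega> * Z \<omega>))"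
      unfolding sum_distrib_right by (rule Bochner_Integration.integral_sum) (intro in_Lp_2_prod_integrable X Z)
    also have "\<dots> = (\<Sum>n<N. if n = m then expectation (\<lambda>\<omega>. X m \<omega> * Z \<omega>) else 0)"
      by (intro sum.cong refl) (auto simp: orth)
    also have "\<dots> = expectation (\<lambda>\<omega>. X m \<omega> * Z \<omega>)" using N by simp
    finally show ?thesis .
  qed
  then have "(\<lambda>N. expectation (\<lambda>\<omega>. (\<Sum>n<N. X n \<omega>) * Z \<omega>)) \<longlonglongrightarrow> expectation (\<lambda>\<omega>. X m \<omega> * Z \<omega>)"
    by (intro tendsto_eventually) (auto simp: eventually_sequentially)
  ultimately show ?thesis by (rule LIMSEQ_unique)
qed

end

section \<open>Identification of the chaos expansion of a mild solution\<close>

locale mild_solution_process = isonormal_process +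
  fixes \<beta> :: real and u :: "real \<Rightarrow> real \<Rightarrow> 'a \<Rightarrow> real"
  assumes beta: "\<beta> \<ge> 1/4" and mild: "mild_solution M W \<beta> u"
begin

lemma in_Lp_2_u: "z > 0 \<Longrightarrow> t > 0 \<Longrightarrow> in_Lp 2 M (u z t)"
  using mild by (simp add: mild_solution_def)

lemma mild_chaos_expansion:
  assumes "z > 0" "t > 0"
  obtains Y g where "AE \<omega> in M. u z t \<omega> = u0 z t + Y \<omega>"
    "\<forall>n. in_Lp 2 (quadrant_pow (Suc n)) (g n)"
    "AE x in quadrant. Lp_tendsto 2 M (\<lambda>N \<omega>. \<Sum>n<N. wiener_integral M W n (\<lambda>y. g n (y(n := x))) \<omega>)
       (\<lambda>\<omega>. indicator {0<..<t} (snd x) * q0 z (fst x) (t - snd x) * min (fst x) 1 powr \<beta> * u (fst x) (snd x) \<omega>)"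
    "Lp_tendsto 2 M (\<lambda>N \<omega>. \<Sum>n<N. wiener_integral M W (Suc n) (g n) \<omega>) Y"
proof -
  obtain Y where "has_skorohod_integral M W
      (\<lambda>(w, \<tau>) \<omega>. indicator {0<..<t} \<tau> * q0 z w (t - \<tau>) * min w 1 powr \<beta> * u w \<tau> \<omega>) Y"
    "AE \<omega> in M. u z t \<omega> = u0 z t + Y \<omega>"
    using mild assms unfolding mild_solution_def by blast
  then show ?thesis using that unfolding has_skorohod_integral_def by (auto simp: split_beta')
qed

text \<open>If the components of order \<open>n\<close> of the solution are known everywhere, then the expansion of the
  integrand determines its kernel \<open>g n\<close> up to symmetrization in all variables but the last one, which
  determines the integral of \<open>g n\<close>.\<close>

lemma integral_of_expansion_kernel:
  assumes comp: "\<And>w \<tau> Z. w > 0 \<Longrightarrow> \<tau> > 0 \<Longrightarrow> Z \<in> wiener_chaos M W n \<Longrightarrow>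
      expectation (\<lambda>\<omega>. u w \<tau> \<omega> * Z \<omega>) = expectation (\<lambda>\<omega>. chaos_term M W \<beta> n w \<tau> \<omega> * Z \<omega>)"
    and z: "z > 0" and t: "t > 0" and g: "\<And>n. in_Lp 2 (quadrant_pow (Suc n)) (g n)"
    and exp: "AE x in quadrant. Lp_tendsto 2 M (\<lambda>N \<omega>. \<Sum>n<N. wiener_integral M W n (\<lambda>y. g n (y(n := x))) \<omega>)
       (\<lambda>\<omega>. indicator {0<..<t} (snd x) * q0 z (fst x) (t - snd x) * min (fst x) 1 powr \<beta> * u (fst x) (snd x) \<omega>)"
  shows "AE \<omega> in M. wiener_integral M W (Suc n) (g n) \<omega> = chaos_term M W \<beta> (Suc n) z t \<omega>"
proof -
  let ?f = "chaos_kernel \<beta> (Suc n) z t"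
  note Ig = has_wiener_integral_wiener_integral[OF g, of n]
  note If = has_wiener_integral_chaos_term[OF beta z t, of "Suc n"]
  \<comment> \<open>One null set serves all orders \<open>m\<close>: each term of the expansion at
    \<open>x\<close> must be a genuine multiple integral before orthogonality can remove the terms
    of order other than \<open>n\<close>.\<close>
  have "AE x in quadrant. \<forall>m. in_Lp 2 (quadrant_pow m) (\<lambda>y. g m (y(m := x)))"
    using AE_in_Lp_2_section[OF g] by (simp add: AE_all_countable)
  then have "AE x in quadrant. \<exists>X. has_wiener_integral M W n (\<lambda>y. g n (y(n := x)) - ?f (y(n := x))) X \<and> (AE \<omega> in M. X \<omega> = 0)"
    using exp AE_space
  proof eventually_elim
    case (elim x)
    define w where "w = fst x"
    define \<tau> where "\<tau> = snd x"
    define c where "c = indicator {0<..<t} \<tau> * q0 z w (t - \<tau>) * min w 1 powr \<beta>"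
    have pos: "w > 0" "\<tau> > 0" using elim(3) by (auto simp: w_def \<tau>_def space_quadrant)
    let ?G = "\<lambda>m. wiener_integral M W m (\<lambda>y. g m (y(m := x)))"
    have G: "has_wiener_integral M W m (\<lambda>y. g m (y(m := x))) (?G m)" for m
      using elim(1) by (intro has_wiener_integral_wiener_integral) simp
    have lim: "Lp_tendsto 2 M (\<lambda>N \<omega>. \<Sum>n<N. ?G n \<omega>) (\<lambda>\<omega>. c * u w \<tau> \<omega>)"
      using elim(2) by (simp add: c_def w_def \<tau>_def)
    define T where "T = chaos_term M W \<beta> n w \<tau>"
    have T: "has_wiener_integral M W n (chaos_kernel \<beta> n w \<tau>) T"
      unfolding T_def by (rule has_wiener_integral_chaos_term[OF beta pos])
    \<comment> \<open>The difference to be shown null lies in the chaos of order \<open>n\<close>,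
      so it serves as its own test variable.\<close>
    define X where "X = (\<lambda>\<omega>. ?G n \<omega> - c * T \<omega>)"
    have "has_wiener_integral M W n (\<lambda>y. g n (y(n := x)) - c * chaos_kernel \<beta> n w \<tau> y) X"
      unfolding X_def by (intro has_wiener_integral_diff has_wiener_integral_cmult G T)
    moreover have "c * chaos_kernel \<beta> n w \<tau> y = ?f (y(n := x))" for y
      using chaos_kernel_cong[of n y "y(n := x)" \<beta> w \<tau>]
      by (simp add: c_def w_def \<tau>_def split_beta)
    ultimately have IX: "has_wiener_integral M W n (\<lambda>y. g n (y(n := x)) - ?f (y(n := x))) X" by simp
    note XL = has_wiener_integral_in_Lp_2(2)[OF IX]
    have XZ: "X \<in> wiener_chaos M W n" using IX by (auto simp: wiener_chaos_def)
    have "c * expectation (\<lambda>\<omega>. T \<omega> * X \<omega>) = c * expectation (\<lambda>\<omega>. u w \<tau> \<omega> * X \<omega>)"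
      using comp[OF pos XZ] by (simp add: T_def)
    also have "\<dots> = expectation (\<lambda>\<omega>. (c * u w \<tau> \<omega>) * X \<omega>)" by (simp add: mult.assoc)
    also have "\<dots> = expectation (\<lambda>\<omega>. ?G n \<omega> * X \<omega>)"
      by (rule expectation_series_mult[OF lim _ XL])
        (use has_wiener_integral_in_Lp_2(2)[OF G] wiener_integral_inner[OF G IX] in auto)
    finally have eq: "expectation (\<lambda>\<omega>. ?G n \<omega> * X \<omega>) = c * expectation (\<lambda>\<omega>. T \<omega> * X \<omega>)" ..
    have "expectation (\<lambda>\<omega>. (X \<omega> - 0)\<^sup>2) = expectation (\<lambda>\<omega>. ?G n \<omega> * X \<omega> - c * (T \<omega> * X \<omega>))"
      by (simp add: X_def power2_eq_square algebra_simps)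
    also have "\<dots> = 0"
      using eq in_Lp_2_prod_integrable[OF has_wiener_integral_in_Lp_2(2)[OF G[of n]] XL]
        in_Lp_2_prod_integrable[OF has_wiener_integral_in_Lp_2(2)[OF T] XL] by simp
    finally have "AE \<omega> in M. X \<omega> = 0" by (rule AE_eq_if_integral_square_0[OF XL in_Lp_2_zero])
    with IX show ?case by blast
  qed
  from wiener_integral_section_AE_0[OF has_wiener_integral_diff[OF Ig If] this] show ?thesis by simp
qed

text \<open>Tested against the chaos of order \<open>n + 1\<close>, the equation keeps only the term
  of that order of the Skorohod integral, and the sections of its kernel are governed by the
  components of order \<open>n\<close>, which the induction provides.\<close>

theorem expectation_u_mult_chaos:
  assumes "z > 0" "t > 0" "Z \<in> wiener_chaos M W n"
  shows "expectation (\<lambda>\<omega>. u z t \<omega> * Z \<omega>) = expectation (\<lambda>\<omega>. chaos_term M W \<beta> n z t \<omega> * Z \<omega>)"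
  using assms
proof (induction n arbitrary: z t Z)
  case (0 z t Z)
  obtain Y g where Y: "AE \<omega> in M. u z t \<omega> = u0 z t + Y \<omega>" and g: "\<forall>n. in_Lp 2 (quadrant_pow (Suc n)) (g n)"
    and exp: "AE x in quadrant. Lp_tendsto 2 M (\<lambda>N \<omega>. \<Sum>n<N. wiener_integral M W n (\<lambda>y. g n (y(n := x))) \<omega>)
       (\<lambda>\<omega>. indicator {0<..<t} (snd x) * q0 z (fst x) (t - snd x) * min (fst x) 1 powr \<beta> * u (fst x) (snd x) \<omega>)"
    and lim: "Lp_tendsto 2 M (\<lambda>N \<omega>. \<Sum>n<N. wiener_integral M W (Suc n) (g n) \<omega>) Y"
    using mild_chaos_expansion[OF 0(1,2)] .
  obtain f where Z: "has_wiener_integral M W 0 f Z" using 0(3) by (auto simp: wiener_chaos_def)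
  note ZL = has_wiener_integral_in_Lp_2(2)[OF Z] and YL = Lp_tendsto_2_D(2)[OF lim]
  have Ig: "has_wiener_integral M W (Suc n) (g n) (wiener_integral M W (Suc n) (g n))" for n
    by (rule has_wiener_integral_wiener_integral[OF g[rule_format]])
  \<comment> \<open>All integrals in the series of \<open>Y\<close> have positive order, so only
    \<open>u0\<close> contributes at order 0.\<close>
  have o: "expectation (\<lambda>\<omega>. wiener_integral M W (Suc n) (g n) \<omega> * Z \<omega>) = 0" for n
    using wiener_integral_inner[OF Ig Z] by simp
  have YZ: "expectation (\<lambda>\<omega>. Y \<omega> * Z \<omega>) = 0"
    using expectation_series_mult[OF lim has_wiener_integral_in_Lp_2(2)[OF Ig] ZL o, of 0] o by simp
  have Zi: "integrable M Z"
    using in_Lp_2_prod_integrable[OF ZL, of "\<lambda>_. 1"] by (simp add: in_Lp_2_iff)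
  have "expectation (\<lambda>\<omega>. u z t \<omega> * Z \<omega>) = expectation (\<lambda>\<omega>. u0 z t * Z \<omega> + Y \<omega> * Z \<omega>)"
  proof (rule integral_cong_AE)
    show "AE \<omega> in M. u z t \<omega> * Z \<omega> = u0 z t * Z \<omega> + Y \<omega> * Z \<omega>"
      using Y by eventually_elim (simp add: distrib_right)
  qed (use in_Lp_2_u[OF 0(1,2)] ZL YL in \<open>auto simp: in_Lp_2_iff\<close>)
  also have "\<dots> = expectation (\<lambda>\<omega>. u0 z t * Z \<omega>)"
    using YZ Zi in_Lp_2_prod_integrable[OF YL ZL] by simp
  also have "\<dots> = expectation (\<lambda>\<omega>. chaos_term M W \<beta> 0 z t \<omega> * Z \<omega>)"
  proof (rule integral_cong_AE)
    show "AE \<omega> in M. u0 z t * Z \<omega> = chaos_term M W \<beta> 0 z t \<omega> * Z \<omega>"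
      using chaos_term_0_AE[OF beta 0(1,2)] by eventually_elim simp
  qed (use in_Lp_2_chaos_term[OF beta 0(1,2), of 0] ZL in \<open>auto simp: in_Lp_2_iff\<close>)
  finally show ?case .
next
  case (Suc n z t Z)
  obtain Y g where Y: "AE \<omega> in M. u z t \<omega> = u0 z t + Y \<omega>" and g: "\<forall>n. in_Lp 2 (quadrant_pow (Suc n)) (g n)"
    and exp: "AE x in quadrant. Lp_tendsto 2 M (\<lambda>N \<omega>. \<Sum>n<N. wiener_integral M W n (\<lambda>y. g n (y(n := x))) \<omega>)
       (\<lambda>\<omega>. indicator {0<..<t} (snd x) * q0 z (fst x) (t - snd x) * min (fst x) 1 powr \<beta> * u (fst x) (snd x) \<omega>)"
    and lim: "Lp_tendsto 2 M (\<lambda>N \<omega>. \<Sum>n<N. wiener_integral M W (Suc n) (g n) \<omega>) Y"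
    using mild_chaos_expansion[OF Suc.prems(1,2)] .
  obtain f where Z: "has_wiener_integral M W (Suc n) f Z" using Suc.prems(3) by (auto simp: wiener_chaos_def)
  note ZL = has_wiener_integral_in_Lp_2(2)[OF Z] and YL = Lp_tendsto_2_D(2)[OF lim]
  have Ig: "has_wiener_integral M W (Suc n) (g n) (wiener_integral M W (Suc n) (g n))" for n
    by (rule has_wiener_integral_wiener_integral[OF g[rule_format]])
  have o: "expectation (\<lambda>\<omega>. wiener_integral M W (Suc m) (g m) \<omega> * Z \<omega>) = 0" if "m \<noteq> n" for m
    using wiener_integral_inner[OF Ig Z] that by simp
  have YZ: "expectation (\<lambda>\<omega>. Y \<omega> * Z \<omega>) = expectation (\<lambda>\<omega>. wiener_integral M W (Suc n) (g n) \<omega> * Z \<omega>)"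
    by (rule expectation_series_mult[OF lim has_wiener_integral_in_Lp_2(2)[OF Ig] ZL o])
  \<comment> \<open>The constant \<open>u0 z t\<close> lies in the chaos of order 0.\<close>
  have Z0: "expectation (\<lambda>\<omega>. u0 z t * Z \<omega>) = 0"
    using wiener_integral_inner[OF has_wiener_integral_const Z, of "u0 z t"] by simp
  have Zi: "integrable M Z"
    using in_Lp_2_prod_integrable[OF ZL, of "\<lambda>_. 1"] by (simp add: in_Lp_2_iff)
  have "expectation (\<lambda>\<omega>. u z t \<omega> * Z \<omega>) = expectation (\<lambda>\<omega>. u0 z t * Z \<omega> + Y \<omega> * Z \<omega>)"
  proof (rule integral_cong_AE)
    show "AE \<omega> in M. u z t \<omega> * Z \<omega> = u0 z t * Z \<omega> + Y \<omega> * Z \<omega>"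
      using Y by eventually_elim (simp add: distrib_right)
  qed (use in_Lp_2_u[OF Suc.prems(1,2)] ZL YL in \<open>auto simp: in_Lp_2_iff\<close>)
  also have "\<dots> = expectation (\<lambda>\<omega>. u0 z t * Z \<omega>) + expectation (\<lambda>\<omega>. Y \<omega> * Z \<omega>)"
    by (rule Bochner_Integration.integral_add) (use Zi in_Lp_2_prod_integrable[OF YL ZL] in auto)
  also have "\<dots> = expectation (\<lambda>\<omega>. wiener_integral M W (Suc n) (g n) \<omega> * Z \<omega>)" by (simp only: Z0 YZ add_0)
  also have "\<dots> = expectation (\<lambda>\<omega>. chaos_term M W \<beta> (Suc n) z t \<omega> * Z \<omega>)"
  proof (rule integral_cong_AE)
    have "AE \<omega> in M. wiener_integral M W (Suc n) (g n) \<omega> = chaos_term M W \<beta> (Suc n) z t \<omega>"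
      by (rule integral_of_expansion_kernel[OF Suc.IH Suc.prems(1,2) g[rule_format] exp])
    then show "AE \<omega> in M. wiener_integral M W (Suc n) (g n) \<omega> * Z \<omega> = chaos_term M W \<beta> (Suc n) z t \<omega> * Z \<omega>"
      by eventually_elim simp
  qed (use in_Lp_2_chaos_term[OF beta Suc.prems(1,2), of "Suc n"] ZL has_wiener_integral_in_Lp_2(2)[OF Ig[of n]] in \<open>auto simp: in_Lp_2_iff\<close>)
  finally show ?case .
qed

lemma chaos_component_chaos_term:
  assumes "z > 0" "t > 0"
  shows "chaos_component M W n (u z t) (chaos_term M W \<beta> n z t)"
  unfolding chaos_component_def
proof (intro conjI ballI)
  show "in_Lp 2 M (u z t)" by (rule in_Lp_2_u[OF assms])
  show "chaos_term M W \<beta> n z t \<in> wiener_chaos M W n"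
    using has_wiener_integral_chaos_term[OF beta assms] by (auto simp: wiener_chaos_def)
  fix Z assume Z: "Z \<in> wiener_chaos M W n"
  then have ZL: "in_Lp 2 M Z" by (auto simp: wiener_chaos_def dest: has_wiener_integral_in_Lp_2)
  show "expectation (\<lambda>\<omega>. (u z t \<omega> - chaos_term M W \<beta> n z t \<omega>) * Z \<omega>) = 0"
    using expectation_u_mult_chaos[OF assms Z] in_Lp_2_prod_integrable[OF in_Lp_2_u[OF assms] ZL]
      in_Lp_2_prod_integrable[OF in_Lp_2_chaos_term[OF beta assms, of n] ZL]
    by (simp add: left_diff_distrib)
qed

section \<open>Convergence of the chaos series\<close>

text \<open>A Skorohod integral comes with a convergent series of multiple integrals. Its terms
  agree almost surely with the chaos terms, and the orders are shifted by one because
  \<open>u0\<close> stands in front.\<close>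

lemma chaos_series_Lp_tendsto_2:
  assumes "z > 0" "t > 0"
  shows "Lp_tendsto 2 M (\<lambda>N \<omega>. \<Sum>n<N. chaos_term M W \<beta> n z t \<omega>) (u z t)"
proof -
  obtain Y g where Y: "AE \<omega> in M. u z t \<omega> = u0 z t + Y \<omega>" and g: "\<forall>n. in_Lp 2 (quadrant_pow (Suc n)) (g n)"
    and exp: "AE x in quadrant. Lp_tendsto 2 M (\<lambda>N \<omega>. \<Sum>n<N. wiener_integral M W n (\<lambda>y. g n (y(n := x))) \<omega>)
       (\<lambda>\<omega>. indicator {0<..<t} (snd x) * q0 z (fst x) (t - snd x) * min (fst x) 1 powr \<beta> * u (fst x) (snd x) \<omega>)"
    and lim: "Lp_tendsto 2 M (\<lambda>N \<omega>. \<Sum>n<N. wiener_integral M W (Suc n) (g n) \<omega>) Y"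
    using mild_chaos_expansion[OF assms] .
  let ?T = "\<lambda>n. chaos_term M W \<beta> n z t"
  have TL: "in_Lp 2 M (?T n)" for n by (rule in_Lp_2_chaos_term[OF beta assms])
  have SL: "in_Lp 2 M (\<lambda>\<omega>. \<Sum>n<N. ?T n \<omega>)" for N by (intro in_Lp_2_sum TL)
  have "Lp_tendsto 2 M (\<lambda>N \<omega>. \<Sum>n<Suc N. ?T n \<omega>) (u z t)"
  proof (rule Lp_tendsto_2_cong_AE)
    have "in_Lp 2 M (\<lambda>\<omega>. u0 z t)" by (simp add: in_Lp_2_iff)
    then show "Lp_tendsto 2 M (\<lambda>N \<omega>. u0 z t + (\<Sum>n<N. wiener_integral M W (Suc n) (g n) \<omega>)) (\<lambda>\<omega>. u0 z t + Y \<omega>)"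
      by (intro Lp_tendsto_2_add[OF _ lim] Lp_tendsto_2_const)
    have "AE \<omega> in M. \<forall>n. wiener_integral M W (Suc n) (g n) \<omega> = ?T (Suc n) \<omega>"
      unfolding AE_all_countable
      by (intro allI integral_of_expansion_kernel[OF expectation_u_mult_chaos assms g[rule_format] exp])
    then show "AE \<omega> in M. u0 z t + (\<Sum>n<N. wiener_integral M W (Suc n) (g n) \<omega>) = (\<Sum>n<Suc N. ?T n \<omega>)" for N
      using chaos_term_0_AE[OF beta assms]
      by eventually_elim (simp add: sum.lessThan_Suc_shift del: sum.lessThan_Suc)
    show "AE \<omega> in M. u0 z t + Y \<omega> = u z t \<omega>" using Y by eventually_elim simp
    show "(\<lambda>\<omega>. \<Sum>n<Suc N. ?T n \<omega>) \<in> borel_measurable M" for N using SL by (rule in_Lp_2_measurable)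
    show "u z t \<in> borel_measurable M" using in_Lp_2_u[OF assms] by (rule in_Lp_2_measurable)
  qed
  then show ?thesis
    using SL unfolding Lp_tendsto_2_iff by (auto intro: LIMSEQ_imp_Suc)
qed

text \<open>Even moments of blocks of the series are bounded by tails of a convergent numerical
  series. Fatou's lemma transfers the bound from the differences of partial sums to the distance
  from the solution.\<close>

theorem chaos_series_Lp_tendsto:
  assumes z: "z > 0" and t: "t > 0" and p: "p \<ge> 2"
  shows "in_Lp p M (u z t)" "Lp_tendsto p M (\<lambda>N \<omega>. \<Sum>n<N. chaos_term M W \<beta> n z t \<omega>) (u z t)"
proof -
  obtain k :: nat where k: "k \<ge> 1" "p \<le> real (2 * k)" using ex_even_exponent[OF p] by metis
  have p0: "0 < p" using p by simp
  define T where "T n = chaos_term M W \<beta> n z t" for n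
  define S where "S N \<omega> = (\<Sum>n<N. T n \<omega>)" for N \<omega>
  have lim: "Lp_tendsto 2 M S (u z t)"
    using chaos_series_Lp_tendsto_2[OF z t] by (simp add: S_def[abs_def] T_def)
  note SL = Lp_tendsto_2_D(1)[OF lim] and uL = Lp_tendsto_2_D(2)[OF lim]
  have Sm: "S N \<in> borel_measurable M" and um: "u z t \<in> borel_measurable M" for N
    using SL uL by (auto intro: in_Lp_2_measurable)
  have Tm: "T n \<in> borel_measurable M" for n
    unfolding T_def by (rule in_Lp_2_measurable[OF in_Lp_2_chaos_term[OF beta z t]])
  have Ti: "integrable M (\<lambda>\<omega>. T n \<omega> ^ (2 * k))" for n
    unfolding T_def by (rule chaos_term_even_integrable[OF beta z t k(1)])
  define B where "B n = real (2 * k - 1) ^ n * (kernel_const n * t powr (real n / 2) / sqrt z)" for n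
  have k1: "real (2 * k - 1) > 0" using k(1) by simp
  have B: "B n > 0" for n unfolding B_def using k1 kernel_const_pos[of n] z t by simp
  have TB: "expectation (\<lambda>\<omega>. T n \<omega> ^ (2 * k)) \<le> B n ^ k" if "n \<ge> 1" for n
    unfolding T_def B_def by (rule chaos_term_moments[OF beta z t that k(1)])
  \<comment> \<open>For \<open>n \<ge> 1\<close> this dominates the moment of order
    \<open>2 * k\<close> of the term \<open>T n\<close>, multiplied by its geometric weight.\<close>
  define d where "d n = (4 ^ k) ^ Suc n * B n ^ k" for n
  have d: "d n > 0" for n using B[of n] by (simp add: d_def)
  have sd: "summable d"
  proof -
    \<comment> \<open>\<open>d n\<close> is the power of exponent \<open>k\<close> of a constant
      times \<open>\<rho> ^ n / Gamma (real n / 2 + 1)\<close>; the factor 4 accounts for the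
      weights.\<close>
    define \<rho> where "\<rho> = 4 * (real (2 * k - 1) * ((2 * sqrt pi) * sqrt t))"
    have \<rho>n: "\<rho> ^ n = 4 ^ n * (real (2 * k - 1) ^ n * ((2 * sqrt pi) ^ n * sqrt t ^ n))" for n
      unfolding \<rho>_def by (simp only: power_mult_distrib)
    have "\<rho> > 0" using k1 t by (simp add: \<rho>_def)
    from power_over_Gamma_le_geometric[OF this] obtain C where C: "C > 0"
      "\<And>n. \<rho> ^ n / Gamma (real n / 2 + 1) \<le> C * (1 / 2) ^ n" by blast
    have "norm (d n) \<le> (4 * C / sqrt z) ^ k * ((1 / 2) ^ k) ^ n" for n
    proof -
      have "t powr (real n / 2) = sqrt t ^ n"
        using t by (simp add: powr_half_sqrt[symmetric] powr_realpow[symmetric] powr_powr)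
      then have "4 ^ Suc n * B n = 4 * (\<rho> ^ n / Gamma (real n / 2 + 1)) / sqrt z"
        unfolding \<rho>n by (simp add: B_def kernel_const_def)
      also have "\<dots> \<le> 4 * (C * (1 / 2) ^ n) / sqrt z"
        using z C(2)[of n] by (intro divide_right_mono mult_left_mono) auto
      finally have "4 ^ Suc n * B n \<le> (4 * C / sqrt z) * (1 / 2) ^ n" by simp
      then have "(4 ^ Suc n * B n) ^ k \<le> ((4 * C / sqrt z) * (1 / 2) ^ n) ^ k"
        using B[of n] by (intro power_mono) auto
      also have "(4 ^ Suc n * B n) ^ k = d n"
        by (simp only: d_def power_mult_distrib power_mult[symmetric] mult.commute)
      also have "((4 * C / sqrt z) * (1 / 2) ^ n) ^ k = (4 * C / sqrt z) ^ k * ((1 / 2) ^ k) ^ n"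
        by (simp only: power_mult_distrib power_mult[symmetric] mult.commute)
      finally show ?thesis using d[of n] by simp
    qed
    moreover have "(1 / 2 :: real) ^ k < 1" using k(1) by (simp add: power_less_one_iff)
    then have "summable (\<lambda>n. (4 * C / sqrt z) ^ k * ((1 / 2) ^ k) ^ n)"
      by (intro summable_mult summable_geometric) simp
    ultimately show ?thesis by (rule summable_comparison_test'[rotated])
  qed
  define tail where "tail N = (\<Sum>i. d (i + N))" for N
  have tail_pos: "tail N > 0" for N
    unfolding tail_def using d by (intro suminf_pos summable_ignore_initial_segment sd) auto
  have tail_lim: "tail \<longlonglongrightarrow> 0"
  proof -
    have "(\<lambda>N. suminf d - (\<Sum>i<N. d i)) \<longlonglongrightarrow> suminf d - suminf d"
      by (intro tendsto_intros summable_LIMSEQ sd)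
    moreover have "tail = (\<lambda>N. suminf d - (\<Sum>i<N. d i))"
      unfolding tail_def using suminf_minus_initial_segment[OF sd] by auto
    ultimately show ?thesis by simp
  qed
  have block_integrable: "integrable M (\<lambda>\<omega>. (\<Sum>i<m. T (N + i) \<omega>) ^ (2 * k))" for N m
  proof (rule Bochner_Integration.integrable_bound)
    show "integrable M (\<lambda>\<omega>. \<Sum>i<m. (4 ^ k) ^ Suc i * T (N + i) \<omega> ^ (2 * k))" using Ti by simp
    show "(\<lambda>\<omega>. (\<Sum>i<m. T (N + i) \<omega>) ^ (2 * k)) \<in> borel_measurable M" using Tm by measurable
    show "AE \<omega> in M. norm ((\<Sum>i<m. T (N + i) \<omega>) ^ (2 * k)) \<le> norm (\<Sum>i<m. (4 ^ k) ^ Suc i * T (N + i) \<omega> ^ (2 * k))"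
      using power_sum_le_weighted[OF k(1)] by (intro AE_I2) (simp add: zero_le_even_power order_trans[OF _ abs_ge_self])
  qed
  have block: "expectation (\<lambda>\<omega>. (\<Sum>i<m. T (N + i) \<omega>) ^ (2 * k)) \<le> tail N" if "N \<ge> 1" for N m
  proof -
    have "expectation (\<lambda>\<omega>. (\<Sum>i<m. T (N + i) \<omega>) ^ (2 * k)) \<le> expectation (\<lambda>\<omega>. \<Sum>i<m. (4 ^ k) ^ Suc i * T (N + i) \<omega> ^ (2 * k))"
      by (intro integral_mono block_integrable power_sum_le_weighted k(1)) (use Ti in simp)
    also have "\<dots> = (\<Sum>i<m. (4 ^ k) ^ Suc i * expectation (\<lambda>\<omega>. T (N + i) \<omega> ^ (2 * k)))"
      using Ti by (subst Bochner_Integration.integral_sum) auto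
    \<comment> \<open>The weights of a block start anew at \<open>i = 0\<close>; they only grow when
      counted from the beginning of the series.\<close>
    also have "\<dots> \<le> (\<Sum>i<m. d (i + N))"
    proof (rule sum_mono)
      fix i
      have "(4 ^ k) ^ Suc i * expectation (\<lambda>\<omega>. T (N + i) \<omega> ^ (2 * k)) \<le> (4 ^ k) ^ Suc (i + N) * B (i + N) ^ k"
      proof (rule mult_mono)
        show "(4 ^ k) ^ Suc i \<le> ((4 ^ k) ^ Suc (i + N) :: real)" by (intro power_increasing) auto
        show "expectation (\<lambda>\<omega>. T (N + i) \<omega> ^ (2 * k)) \<le> B (i + N) ^ k"
          using TB[of "N + i"] that by (simp add: add.commute)
        show "0 \<le> expectation (\<lambda>\<omega>. T (N + i) \<omega> ^ (2 * k))" by (simp add: zero_le_even_power)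
      qed simp
      then show "(4 ^ k) ^ Suc i * expectation (\<lambda>\<omega>. T (N + i) \<omega> ^ (2 * k)) \<le> d (i + N)" by (simp only: d_def)
    qed
    also have "\<dots> \<le> tail N"
      unfolding tail_def using d by (intro sum_le_suminf summable_ignore_initial_segment sd) (auto intro: less_imp_le)
    finally show ?thesis .
  qed
  have rest: "integrable M (\<lambda>\<omega>. (S N \<omega> - u z t \<omega>) ^ (2 * k))"
    "expectation (\<lambda>\<omega>. (S N \<omega> - u z t \<omega>) ^ (2 * k)) \<le> tail N" if N: "N \<ge> 1" for N
  proof -
    have nn: "0 \<le> x ^ (2 * k)" for x :: real by (simp add: zero_le_even_power)
    have "(\<integral>\<^sup>+\<omega>. ennreal ((S N \<omega> - u z t \<omega>) ^ (2 * k)) \<partial>M) \<le> ennreal (tail N)"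
    proof (rule Lp_tendsto_2_Fatou[where X="\<lambda>m \<omega>. S N \<omega> - S m \<omega>" and Y="\<lambda>\<omega>. S N \<omega> - u z t \<omega>"
          and \<phi>="\<lambda>x. x ^ (2 * k)" and B="\<lambda>_. tail N"])
      show "Lp_tendsto 2 M (\<lambda>m \<omega>. S N \<omega> - S m \<omega>) (\<lambda>\<omega>. S N \<omega> - u z t \<omega>)"
        by (intro Lp_tendsto_2_diff Lp_tendsto_2_const SL lim)
      show "continuous_on UNIV (\<lambda>x :: real. x ^ (2 * k))" by (intro continuous_intros)
      show "\<forall>\<^sub>F m in sequentially. (\<integral>\<^sup>+\<omega>. ennreal ((S N \<omega> - S m \<omega>) ^ (2 * k)) \<partial>M) \<le> ennreal (tail N)"
        unfolding eventually_sequentially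
      proof (intro exI[of _ N] allI impI)
        fix m assume "N \<le> m"
        then obtain l where m: "m = N + l" by (auto simp: le_iff_add)
        have "S m \<omega> = S N \<omega> + (\<Sum>i<l. T (N + i) \<omega>)" for \<omega>
          unfolding m S_def by (induction l) auto
        then have eq: "(S N \<omega> - S m \<omega>) ^ (2 * k) = (\<Sum>i<l. T (N + i) \<omega>) ^ (2 * k)" for \<omega>
          by (simp add: power_minus_even)
        have "(\<integral>\<^sup>+\<omega>. ennreal ((S N \<omega> - S m \<omega>) ^ (2 * k)) \<partial>M) = ennreal (expectation (\<lambda>\<omega>. (\<Sum>i<l. T (N + i) \<omega>) ^ (2 * k)))"
          unfolding eq using nn by (intro nn_integral_eq_integral block_integrable) auto
        then show "(\<integral>\<^sup>+\<omega>. ennreal ((S N \<omega> - S m \<omega>) ^ (2 * k)) \<partial>M) \<le> ennreal (tail N)"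
          using block[OF N] by (simp add: ennreal_leI)
      qed
    qed simp
    then have le: "(\<integral>\<^sup>+\<omega>. ennreal ((S N \<omega> - u z t \<omega>) ^ (2 * k)) \<partial>M) \<le> ennreal (tail N)" .
    have m: "(\<lambda>\<omega>. (S N \<omega> - u z t \<omega>) ^ (2 * k)) \<in> borel_measurable M"
      using Sm um by (intro borel_measurable_power borel_measurable_diff)
    show i: "integrable M (\<lambda>\<omega>. (S N \<omega> - u z t \<omega>) ^ (2 * k))"
      using nn m by (intro integrableI_bounded) (auto simp: le_less_trans[OF le])
    show "expectation (\<lambda>\<omega>. (S N \<omega> - u z t \<omega>) ^ (2 * k)) \<le> tail N"
      using le nn nn_integral_eq_integral[OF i] less_imp_le[OF tail_pos[of N]] by simp
  qed
  have Si: "integrable M (\<lambda>\<omega>. S N \<omega> ^ (2 * k))" for N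
    using block_integrable[of 0 N] by (simp add: S_def)
  have SLp: "in_Lp p M (S N)" for N by (rule in_Lp_even_moment[OF Sm Si k(1) p0 k(2)])
  \<comment> \<open>The remainder is controlled from \<open>N = 1\<close> on, so the solution is
    split into \<open>S 1\<close> and the remainder after it.\<close>
  define V where "V = S 1"
  have Vi: "integrable M (\<lambda>\<omega>. V \<omega> ^ (2 * k))" unfolding V_def by (rule Si)
  have "(V \<omega> - u z t \<omega>) ^ (2 * k) = (u z t \<omega> - V \<omega>) ^ (2 * k)" for \<omega>
    by (simp only: power_mult power2_commute)
  then have uVi: "integrable M (\<lambda>\<omega>. (u z t \<omega> - V \<omega>) ^ (2 * k))"
    using rest(1)[of 1] by (simp only: V_def order_refl)
  have ui: "integrable M (\<lambda>\<omega>. u z t \<omega> ^ (2 * k))"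
  proof (rule Bochner_Integration.integrable_bound)
    let ?a = "\<lambda>\<omega> i :: nat. if i = 0 then V \<omega> else u z t \<omega> - V \<omega>"
    show "integrable M (\<lambda>\<omega>. \<Sum>i<2. (4 ^ k) ^ Suc i * ?a \<omega> i ^ (2 * k))"
    proof (intro Bochner_Integration.integrable_sum integrable_mult_right)
      fix i :: nat
      show "integrable M (\<lambda>\<omega>. ?a \<omega> i ^ (2 * k))" using Vi uVi by (cases "i = 0") auto
    qed
    show "(\<lambda>\<omega>. u z t \<omega> ^ (2 * k)) \<in> borel_measurable M" using um by (rule borel_measurable_power)
    show "AE \<omega> in M. norm (u z t \<omega> ^ (2 * k)) \<le> norm (\<Sum>i<2. (4 ^ k) ^ Suc i * ?a \<omega> i ^ (2 * k))"
    proof (rule AE_I2)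
      fix \<omega>
      have "(\<Sum>i<2. ?a \<omega> i) = u z t \<omega>" by (simp add: numeral_2_eq_2)
      with power_sum_le_weighted[OF k(1), of "?a \<omega>" 2]
      have "u z t \<omega> ^ (2 * k) \<le> (\<Sum>i<2. (4 ^ k) ^ Suc i * ?a \<omega> i ^ (2 * k))" by simp
      then show "norm (u z t \<omega> ^ (2 * k)) \<le> norm (\<Sum>i<2. (4 ^ k) ^ Suc i * ?a \<omega> i ^ (2 * k))"
        by (simp add: zero_le_even_power order_trans[OF _ abs_ge_self] del: sum.lessThan_Suc)
    qed
  qed
  show uLp: "in_Lp p M (u z t)" by (rule in_Lp_even_moment[OF um ui k(1) p0 k(2)])
  have "(\<lambda>N. Lp_norm p M (\<lambda>\<omega>. S N \<omega> - u z t \<omega>)) \<longlonglongrightarrow> 0"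
  proof (rule tendsto_sandwich[OF _ _ tendsto_const])
    show "\<forall>\<^sub>F N in sequentially. 0 \<le> Lp_norm p M (\<lambda>\<omega>. S N \<omega> - u z t \<omega>)" by (simp add: Lp_norm_def)
    show "\<forall>\<^sub>F N in sequentially. Lp_norm p M (\<lambda>\<omega>. S N \<omega> - u z t \<omega>) \<le> sqrt (root k (tail N))"
      unfolding eventually_sequentially
    proof (intro exI[of _ 1] allI impI)
      fix N :: nat assume N: "1 \<le> N"
      show "Lp_norm p M (\<lambda>\<omega>. S N \<omega> - u z t \<omega>) \<le> sqrt (root k (tail N))"
      proof (rule Lp_norm_even_moment[OF _ rest(1)[OF N] k(1) p0 k(2)])
        show "(\<lambda>\<omega>. S N \<omega> - u z t \<omega>) \<in> borel_measurable M" using Sm um by (rule borel_measurable_diff)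
        \<comment> \<open>\<open>Lp_norm_even_moment\<close> expects the bound as a power of
          exponent \<open>k\<close>, hence the root of the tail.\<close>
        show "expectation (\<lambda>\<omega>. (S N \<omega> - u z t \<omega>) ^ (2 * k)) \<le> root k (tail N) ^ k"
          using rest(2)[OF N] k(1) tail_pos[of N] by (simp add: real_root_pow_pos)
        show "root k (tail N) > 0" using k(1) tail_pos[of N] by (simp add: real_root_gt_zero)
      qed
    qed
    have "(\<lambda>N. sqrt (root k (tail N))) \<longlonglongrightarrow> sqrt (root k 0)" by (intro tendsto_intros tail_lim)
    then show "(\<lambda>N. sqrt (root k (tail N))) \<longlonglongrightarrow> 0" by simp
  qed
  then have "Lp_tendsto p M S (u z t)" unfolding Lp_tendsto_def using SLp uLp by blast
  then show "Lp_tendsto p M (\<lambda>N \<omega>. \<Sum>n<N. chaos_term M W \<beta> n z t \<omega>) (u z t)"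
    by (simp add: S_def[abs_def] T_def)
qed

end

theorem theorem3p5:
  fixes M :: "'a measure"
    and W :: "(real \<times> real \<Rightarrow> real) \<Rightarrow> 'a \<Rightarrow> real"
  assumes "white_noise M W"
  shows "\<exists>C>0. \<forall>\<beta>\<ge>1/4.
     (\<forall>n\<ge>1. \<forall>p\<ge>2. \<forall>z>0. \<forall>t>0.
        in_Lp p M (chaos_term M W \<beta> n z t) \<and>
        Lp_norm p M (chaos_term M W \<beta> n z t)
          \<le> (C * (p - 1) * sqrt pi * sqrt t) powr (real n / 2)
             / (sqrt (Gamma (real n / 2 + 1)) * z powr (1 / 4))) \<and>
     (\<forall>u. mild_solution M W \<beta> u \<longrightarrow>
        (\<forall>z>0. \<forall>t>0.
           (\<forall>n. chaos_component M W n (u z t) (chaos_term M W \<beta> n z t)) \<and>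
           (\<forall>p\<ge>2. in_Lp p M (u z t) \<and>
              Lp_tendsto p M (\<lambda>N \<omega>. \<Sum>n<N. chaos_term M W \<beta> n z t \<omega>) (u z t))))"
proof (intro exI[of _ 6] conjI allI impI)
  interpret isonormal_process M W using assms by unfold_locales (simp add: white_noise_def)
  fix \<beta> :: real assume beta: "\<beta> \<ge> 1/4"
  {
    fix n :: nat and p z t :: real
    assume "n \<ge> 1" "p \<ge> 2" "z > 0" "t > 0"
    then show "in_Lp p M (chaos_term M W \<beta> n z t)"
      "Lp_norm p M (chaos_term M W \<beta> n z t)
          \<le> (6 * (p - 1) * sqrt pi * sqrt t) powr (real n / 2)
             / (sqrt (Gamma (real n / 2 + 1)) * z powr (1 / 4))"
      using chaos_term_Lp_bound[OF beta] by blast+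
  }
  fix u assume "mild_solution M W \<beta> u"
  then interpret mild_solution_process M W \<beta> u using beta by unfold_locales
  fix z t :: real assume zt: "z > 0" "t > 0"
  show "chaos_component M W n (u z t) (chaos_term M W \<beta> n z t)" for n
    by (rule chaos_component_chaos_term[OF zt])
  fix p :: real assume "p \<ge> 2"
  then show "in_Lp p M (u z t)" "Lp_tendsto p M (\<lambda>N \<omega>. \<Sum>n<N. chaos_term M W \<beta> n z t \<omega>) (u z t)"
    using chaos_series_Lp_tendsto[OF zt] by blast+
qed simp

end
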